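(* Let $M$ be a manifold-with-boundary equipped with a free circle action near its boundary, and let $M_{\mathrm{cut}}$ be the manifold obtained from $M$ by the smooth cutting construction, with its submanifold $M_{\mathrm{red}}=(\partial M)/S^1$. Let $\beta$ be a differential form on $M$ that is basic on $\partial M$ and invariant near $\partial M$, and let $\beta_{\mathrm{red}}$ and $\beta_{\mathrm{cut}}$ be the induced differential forms on $M_{\mathrm{red}}$ and $M_{\mathrm{cut}}$. Then $\beta_{\mathrm{red}}$ coincides with the pullback of $\beta_{\mathrm{cut}}$ under the inclusion map $M_{\mathrm{red}}\to M_{\mathrm{cut}}$.
   Context: Manifolds, with or without boundary, are smooth, Hausdorff and second countable. $S^1=\{a\in\mathbb{C}: |a|=1\}$. For a manifold-with-boundary $M$, $\mathring{M}$ denotes the interior and $\partial M$ the boundary. "A free circle action near the boundary" means a smooth free action of $S^1$ on an open neighbourhood $U_M$ of $\partial M$ in $M$; necessarily $\partial M$ is $S^1$-invariant. Cut space: let $\sim$ be the equivalence relation on $M$ in which distinct points are equivalent iff they both lie in $\partial M$ and lie in the same $S^1$-orbit. $M_{\mathrm{cut}} := M/{\sim}$ with the quotient topology; $c \colon M \to M_{\mathrm{cut}}$ is the quotient map. An invariant boundary defining function on $M$ is a smooth $f \colon M \to \mathbb{R}_{\ge 0}$ such that $f^{-1}(0)=\partial M$, $df|_{\partial M}$ never vanishes, and $f$ is $S^1$-invariant on some $S^1$-invariant neighbourhood of $\partial M$ in $U_M$. Fix such an $f$. $\mathcal{F}_M$ is the set of functions $h \colon M_{\mathrm{cut}}\to\mathbb{R}$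 such that $\widehat{h} := h\circ c$ satisfies: ($\mathcal{F}1$) $\widehat{h}|_{\mathring{M}}$ is smooth; ($\mathcal{F}2$) there exist an $S^1$-invariant open neighbourhood $V$ of $\partial M$ in $U_M$ and a smooth $H \colon V\times\mathbb{C}\to\mathbb{R}$ such that $H(a\cdot x,z)=H(x,az)$ for all $a\in S^1$, $(x,z)\in V\times\mathbb{C}$, and $\widehat{h}(x)=H(x,\sqrt{f(x)})$ for all $x\in V$. $\mathcal{F}_M$ does not depend on $f$, and $M_{\mathrm{cut}}$ carries the unique manifold structure for which $\mathcal{F}_M$ is the set of smooth real-valued functions. $\mathring{M}_{\mathrm{cut}} := c(\mathring{M})$ is open and dense and $c|_{\mathring{M}} \colon \mathring{M}\to\mathring{M}_{\mathrm{cut}}$ is a diffeomorphism. $M_{\mathrm{red}} := c(\partial M)=(\partial M)/S^1$ is a closed codimension-two submanifold of $M_{\mathrm{cut}}$, and $\partial M\to M_{\mathrm{red}}$ is a principal $S^1$-bundle. "$\beta$ is basic on $\partial M$ and invariant near $\partial M$" means: the pullback of $\beta$ to $\partial M$ is $S^1$-basic (i.e. $S^1$-invariant and annihilated by contraction with the vector field generating the circle action), and the restriction of $\beta$ to some $S^1$-invariant neighbourhood of $\partial M$ in $U_M$ is $S^1$-invariant. For such $\beta$: $\beta_{\mathrm{cut}}$ is the unique differential form on $M_{\mathrm{cut}}$ whose pullback through $c|_{\mathring{M}}$ coincides with $\beta|_{\mathring{M}}$; $\beta_{\mathrm{red}}$ is the unique differential form on $M_{\mathrm{red}}$ whose pullback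 to $\partial M$ under the quotient map coincides with the pullback of $\beta$ to $\partial M$. *)

theory Defs
  imports "HOL-Analysis.Analysis"
begin

section \<open>Smooth maps on subsets of Euclidean spaces\<close>

primrec Ck_on :: "nat \<Rightarrow> 'a::real_normed_vector set \<Rightarrow> ('a \<Rightarrow> 'b::real_normed_vector) \<Rightarrow> bool" where
  "Ck_on 0 W f \<longleftrightarrow> continuous_on W f"
| "Ck_on (Suc k) W f \<longleftrightarrow>
     (\<exists>f'. (\<forall>x\<in>W. (f has_derivative f' x) (at x)) \<and> (\<forall>v. Ck_on k W (\<lambda>x. f' x v)))"

text \<open>
  Smoothness on an arbitrary set means local extendability to a smooth map on an open set. On
  relatively open subsets of half-spaces this is smoothness up to the boundary; on embedded
  submanifolds it is smoothness in the sense of the submanifold.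
\<close>

definition smooth_on :: "'a::real_normed_vector set \<Rightarrow> ('a \<Rightarrow> 'b::real_normed_vector) \<Rightarrow> bool" where
  "smooth_on S f \<longleftrightarrow>
     (\<forall>x\<in>S. \<exists>W g. open W \<and> x \<in> W \<and> (\<forall>k. Ck_on k W g) \<and> (\<forall>y\<in>S \<inter> W. g y = f y))"


section \<open>Charted spaces, smooth maps, manifolds with boundary\<close>

text \<open>
  A charted space is a topological space with a set of pairs \<open>(U, \<phi>)\<close>, the charts. The images of
  the charts may be arbitrary subsets of the Euclidean space, so that the structures induced on
  subsets (below) are again charted spaces; manifolds are singled out by a predicate.
\<close>

record ('a, 'e) charted =
  mtop :: "'a topology"
  charts :: "('a set \<times> ('a \<Rightarrow> 'e)) set"

definition smooth_map ::
  "('a, 'e::euclidean_space) charted \<Rightarrow> ('b, 'f::euclidean_space) charted \<Rightarrow> ('a \<Rightarrow> 'b) \<Rightarrow> bool" where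
  "smooth_map M N F \<longleftrightarrow>
     continuous_map (mtop M) (mtop N) F \<and>
     (\<forall>(U, \<phi>)\<in>charts M. \<forall>(V, \<psi>)\<in>charts N.
        smooth_on (\<phi> ` {x\<in>U. F x \<in> V}) (\<lambda>y. \<psi> (F (inv_into U \<phi> y))))"

definition euclid :: "'e::euclidean_space set \<Rightarrow> ('e, 'e) charted" where
  "euclid S = \<lparr>mtop = top_of_set S, charts = {(S, \<lambda>x. x)}\<rparr>"

definition prod_charted ::
  "('a, 'e::euclidean_space) charted \<Rightarrow> ('b, 'f::euclidean_space) charted \<Rightarrow> ('a \<times> 'b, 'e \<times> 'f) charted" where
  "prod_charted M N =
     \<lparr>mtop = prod_topology (mtop M) (mtop N),
      charts = {(U \<times> V, map_prod \<phi> \<psi>) | U \<phi> V \<psi>. (U, \<phi>) \<in> charts M \<and> (V, \<psi>) \<in> charts N}\<rparr>"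

text \<open>
  The structure induced on a subset, by restricting charts. The functions smooth on \<open>induced M S\<close>
  are those that locally extend to smooth functions on \<open>M\<close>; hence this is the usual manifold
  structure when \<open>S\<close> is open, when \<open>S\<close> is the boundary, and when \<open>S\<close> is an embedded submanifold.
\<close>

definition induced :: "('a, 'e) charted \<Rightarrow> 'a set \<Rightarrow> ('a, 'e) charted" where
  "induced M S =
     \<lparr>mtop = subtopology (mtop M) S, charts = {(U \<inter> S, \<phi>) | U \<phi>. (U, \<phi>) \<in> charts M}\<rparr>"

definition smooth_functions :: "('a, 'e::euclidean_space) charted \<Rightarrow> ('a \<Rightarrow> real) set" where
  "smooth_functions M = {g. smooth_map M (euclid UNIV) g}"

definition second_countable_space :: "'a topology \<Rightarrow> bool" where
  "second_countable_space X \<longleftrightarrow>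
     (\<exists>B. countable B \<and> (\<forall>V\<in>B. openin X V) \<and>
          (\<forall>U x. openin X U \<and> x \<in> U \<longrightarrow> (\<exists>V\<in>B. x \<in> V \<and> V \<subseteq> U)))"

text \<open>
  Manifolds are modelled on a linear subspace \<open>E\<close> of a Euclidean type, so that every dimension
  \<open>dim E\<close>, including 0, occurs. The model half-space is cut out by a vector \<open>u\<close> of \<open>E\<close>; it is all
  of \<open>E\<close> if \<open>u = 0\<close>, and then the manifold has no boundary.
\<close>

definition half_space :: "'e::euclidean_space set \<Rightarrow> 'e \<Rightarrow> 'e set" where
  "half_space E u = {y\<in>E. 0 \<le> u \<bullet> y}"

definition manifold_with_boundary ::
  "'e::euclidean_space set \<Rightarrow> 'e \<Rightarrow> ('a, 'e) charted \<Rightarrow> bool" where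
  "manifold_with_boundary E u M \<longleftrightarrow>
     subspace E \<and> u \<in> E \<and>
     Hausdorff_space (mtop M) \<and> second_countable_space (mtop M) \<and>
     (\<forall>(U, \<phi>)\<in>charts M.
        openin (mtop M) U \<and>
        openin (top_of_set (half_space E u)) (\<phi> ` U) \<and>
        homeomorphic_map (subtopology (mtop M) U) (top_of_set (\<phi> ` U)) \<phi>) \<and>
     topspace (mtop M) = (\<Union>(U, \<phi>)\<in>charts M. U) \<and>
     (\<forall>(U, \<phi>)\<in>charts M. \<forall>(V, \<psi>)\<in>charts M.
        smooth_on (\<phi> ` (U \<inter> V)) (\<lambda>y. \<psi> (inv_into U \<phi> y)))"

definition bdry :: "'e::euclidean_space \<Rightarrow> ('a, 'e) charted \<Rightarrow> 'a set" where
  "bdry u M = {x. \<exists>(U, \<phi>)\<in>charts M. x \<in> U \<and> u \<noteq> 0 \<and> u \<bullet> \<phi> x = 0}"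

definition intr :: "'e::euclidean_space \<Rightarrow> ('a, 'e) charted \<Rightarrow> 'a set" where
  "intr u M = topspace (mtop M) - bdry u M"


section \<open>Tangent vectors and differential forms\<close>

text \<open>
  Tangent vectors at \<open>p\<close> are derivations at \<open>p\<close> of the algebra of smooth functions, extended by 0 to
  the other functions so that equality of tangent vectors is equality of functionals. (Functions
  that agree on the carrier but differ elsewhere are not identified here, but the Leibniz rule
  forces a derivation to agree on them.)
\<close>

type_synonym 'a tvec = "('a \<Rightarrow> real) \<Rightarrow> real"

definition tangent_space :: "('a, 'e::euclidean_space) charted \<Rightarrow> 'a \<Rightarrow> 'a tvec set" where
  "tangent_space M p =
     {X. (\<forall>g\<in>smooth_functions M. \<forall>h\<in>smooth_functions M. \<forall>a b.
            X (\<lambda>x. a * g x + b * h x) = a * X g + b * X h) \<and>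
         (\<forall>g\<in>smooth_functions M. \<forall>h\<in>smooth_functions M.
            X (\<lambda>x. g x * h x) = X g * h p + g p * X h) \<and>
         (\<forall>g. g \<notin> smooth_functions M \<longrightarrow> X g = 0)}"

definition push_forward ::
  "('b, 'f::euclidean_space) charted \<Rightarrow> ('a \<Rightarrow> 'b) \<Rightarrow> 'a tvec \<Rightarrow> 'b tvec" where
  "push_forward N F X = (\<lambda>g. if g \<in> smooth_functions N then X (\<lambda>x. g (F x)) else 0)"

definition vector_field :: "('a, 'e::euclidean_space) charted \<Rightarrow> ('a \<Rightarrow> 'a tvec) \<Rightarrow> bool" where
  "vector_field M Z \<longleftrightarrow>
     (\<forall>p\<in>topspace (mtop M). Z p \<in> tangent_space M p) \<and>
     (\<forall>g\<in>smooth_functions M. (\<lambda>p. Z p g) \<in> smooth_functions M)"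

definition tangent_tuple :: "nat \<Rightarrow> ('a, 'e::euclidean_space) charted \<Rightarrow> 'a \<Rightarrow> 'a tvec list \<Rightarrow> bool" where
  "tangent_tuple k M p Xs \<longleftrightarrow>
     p \<in> topspace (mtop M) \<and> length Xs = k \<and> set Xs \<subseteq> tangent_space M p"

text \<open>
  A \<open>k\<close>-form takes lists of \<open>k\<close> tangent vectors at a point; it is normalised to 0 on all other
  arguments, so that equality of forms is equality of functions. Smoothness is tested on smooth
  vector fields.
\<close>

definition differential_form ::
  "nat \<Rightarrow> ('a, 'e::euclidean_space) charted \<Rightarrow> ('a \<Rightarrow> 'a tvec list \<Rightarrow> real) \<Rightarrow> bool" where
  "differential_form k M \<beta> \<longleftrightarrow>
     (\<forall>p Xs. \<not> tangent_tuple k M p Xs \<longrightarrow> \<beta> p Xs = 0) \<and>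
     (\<forall>p Xs i X Y a b.
        tangent_tuple k M p Xs \<and> i < k \<and> X \<in> tangent_space M p \<and> Y \<in> tangent_space M p \<longrightarrow>
        \<beta> p (Xs[i := (\<lambda>g. a * X g + b * Y g)]) = a * \<beta> p (Xs[i := X]) + b * \<beta> p (Xs[i := Y])) \<and>
     (\<forall>p Xs i j.
        tangent_tuple k M p Xs \<and> i < j \<and> j < k \<and> Xs ! i = Xs ! j \<longrightarrow> \<beta> p Xs = 0) \<and>
     (\<forall>Zs. length Zs = k \<and> (\<forall>Z\<in>set Zs. vector_field M Z) \<longrightarrow>
        (\<lambda>p. \<beta> p (map (\<lambda>Z. Z p) Zs)) \<in> smooth_functions M)"

definition form_pullback ::
  "nat \<Rightarrow> ('a, 'e::euclidean_space) charted \<Rightarrow> ('b, 'f::euclidean_space) charted \<Rightarrow> ('a \<Rightarrow> 'b) \<Rightarrow>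
   ('b \<Rightarrow> 'b tvec list \<Rightarrow> real) \<Rightarrow> 'a \<Rightarrow> 'a tvec list \<Rightarrow> real" where
  "form_pullback k M N F \<beta> p Xs =
     (if tangent_tuple k M p Xs then \<beta> (F p) (map (push_forward N F) Xs) else 0)"


section \<open>Circle actions near the boundary and the cut space\<close>

abbreviation circle :: "complex set" where
  "circle \<equiv> sphere 0 1"

definition free_circle_action ::
  "('a, 'e::euclidean_space) charted \<Rightarrow> (complex \<Rightarrow> 'a \<Rightarrow> 'a) \<Rightarrow> bool" where
  "free_circle_action W act \<longleftrightarrow>
     smooth_map (prod_charted (euclid circle) W) W (\<lambda>(a, x). act a x) \<and>
     (\<forall>x\<in>topspace (mtop W). act 1 x = x) \<and>
     (\<forall>a\<in>circle. \<forall>b\<in>circle. \<forall>x\<in>topspace (mtop W). act a (act b x) = act (a * b) x) \<and>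
     (\<forall>a\<in>circle. \<forall>x\<in>topspace (mtop W). act a x = x \<longrightarrow> a = 1)"

definition free_circle_action_near_boundary ::
  "'e::euclidean_space \<Rightarrow> ('a, 'e) charted \<Rightarrow> 'a set \<Rightarrow> (complex \<Rightarrow> 'a \<Rightarrow> 'a) \<Rightarrow> bool" where
  "free_circle_action_near_boundary u M U act \<longleftrightarrow>
     openin (mtop M) U \<and> bdry u M \<subseteq> U \<and> free_circle_action (induced M U) act"

text \<open>
  Neighbourhoods are taken to be open; the interior of an invariant neighbourhood of the boundary
  is again one.
\<close>

definition invariant_nbhd ::
  "'e::euclidean_space \<Rightarrow> ('a, 'e) charted \<Rightarrow> 'a set \<Rightarrow> (complex \<Rightarrow> 'a \<Rightarrow> 'a) \<Rightarrow> 'a set \<Rightarrow> bool" where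
  "invariant_nbhd u M U act V \<longleftrightarrow>
     openin (mtop M) V \<and> bdry u M \<subseteq> V \<and> V \<subseteq> U \<and> (\<forall>a\<in>circle. \<forall>x\<in>V. act a x \<in> V)"

definition cut_rel ::
  "'e::euclidean_space \<Rightarrow> ('a, 'e) charted \<Rightarrow> (complex \<Rightarrow> 'a \<Rightarrow> 'a) \<Rightarrow> 'a rel" where
  "cut_rel u M act =
     {(x, y). x \<in> topspace (mtop M) \<and> y \<in> topspace (mtop M) \<and>
              (x = y \<or> x \<in> bdry u M \<and> y \<in> bdry u M \<and> (\<exists>a\<in>circle. y = act a x))}"

definition cut_map ::
  "'e::euclidean_space \<Rightarrow> ('a, 'e) charted \<Rightarrow> (complex \<Rightarrow> 'a \<Rightarrow> 'a) \<Rightarrow> 'a \<Rightarrow> 'a set" where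
  "cut_map u M act x = cut_rel u M act `` {x}"

definition invariant_boundary_defining ::
  "'e::euclidean_space \<Rightarrow> ('a, 'e) charted \<Rightarrow> 'a set \<Rightarrow> (complex \<Rightarrow> 'a \<Rightarrow> 'a) \<Rightarrow> ('a \<Rightarrow> real) \<Rightarrow> bool" where
  "invariant_boundary_defining u M U act f \<longleftrightarrow>
     f \<in> smooth_functions M \<and>
     (\<forall>x\<in>topspace (mtop M). 0 \<le> f x) \<and>
     {x\<in>topspace (mtop M). f x = 0} = bdry u M \<and>
     (\<forall>x\<in>bdry u M. \<exists>X\<in>tangent_space M x. X f \<noteq> 0) \<and>
     (\<exists>V. invariant_nbhd u M U act V \<and> (\<forall>a\<in>circle. \<forall>x\<in>V. f (act a x) = f x))"

definition cut_functions ::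
  "'e::euclidean_space \<Rightarrow> ('a, 'e) charted \<Rightarrow> 'a set \<Rightarrow> (complex \<Rightarrow> 'a \<Rightarrow> 'a) \<Rightarrow> ('a \<Rightarrow> real) \<Rightarrow>
   ('a set \<Rightarrow> real) set" where
  "cut_functions u M U act f =
     {h. (h \<circ> cut_map u M act) \<in> smooth_functions (induced M (intr u M)) \<and>
         (\<exists>V H. invariant_nbhd u M U act V \<and>
                H \<in> smooth_functions (prod_charted (induced M V) (euclid (UNIV :: complex set))) \<and>
                (\<forall>a\<in>circle. \<forall>x\<in>V. \<forall>z. H (act a x, z) = H (x, a * z)) \<and>
                (\<forall>x\<in>V. (h \<circ> cut_map u M act) x = H (x, complex_of_real (sqrt (f x)))))}"

text \<open>
  \<open>N\<close> is the cut space with the manifold structure (without boundary) determined by the cut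
  functions. That the topology of \<open>N\<close> is the quotient topology is expressed by \<open>quotient_map\<close>,
  which also forces the points of \<open>N\<close> to be the equivalence classes.
\<close>

definition is_cut_manifold ::
  "'e::euclidean_space set \<Rightarrow> 'e \<Rightarrow> ('a, 'e) charted \<Rightarrow> 'a set \<Rightarrow> (complex \<Rightarrow> 'a \<Rightarrow> 'a) \<Rightarrow>
   ('a \<Rightarrow> real) \<Rightarrow> ('a set, 'e) charted \<Rightarrow> bool" where
  "is_cut_manifold E u M U act f N \<longleftrightarrow>
     manifold_with_boundary E 0 N \<and>
     quotient_map (mtop M) (mtop N) (cut_map u M act) \<and>
     smooth_functions N = cut_functions u M U act f"

definition reduced_space ::
  "'e::euclidean_space \<Rightarrow> ('a, 'e) charted \<Rightarrow> (complex \<Rightarrow> 'a \<Rightarrow> 'a) \<Rightarrow> ('a set, 'e) charted \<Rightarrow>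
   ('a set, 'e) charted" where
  "reduced_space u M act N = induced N (cut_map u M act ` bdry u M)"


section \<open>Basic forms and the induced forms on the cut and reduced spaces\<close>

definition invariant_form ::
  "nat \<Rightarrow> ('a, 'e::euclidean_space) charted \<Rightarrow> (complex \<Rightarrow> 'a \<Rightarrow> 'a) \<Rightarrow> ('a \<Rightarrow> 'a tvec list \<Rightarrow> real) \<Rightarrow> bool" where
  "invariant_form k W act \<beta> \<longleftrightarrow> (\<forall>a\<in>circle. form_pullback k W W (act a) \<beta> = \<beta>)"

definition generating_field ::
  "('a, 'e::euclidean_space) charted \<Rightarrow> (complex \<Rightarrow> 'a \<Rightarrow> 'a) \<Rightarrow> 'a \<Rightarrow> 'a tvec" where
  "generating_field W act x =
     (\<lambda>g. if g \<in> smooth_functions W then deriv (\<lambda>t::real. g (act (cis t) x)) 0 else 0)"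

text \<open>In degree 0 the contraction condition is void, as forms vanish on lists of the wrong length.\<close>

definition basic_form ::
  "nat \<Rightarrow> ('a, 'e::euclidean_space) charted \<Rightarrow> (complex \<Rightarrow> 'a \<Rightarrow> 'a) \<Rightarrow> ('a \<Rightarrow> 'a tvec list \<Rightarrow> real) \<Rightarrow> bool" where
  "basic_form k W act \<beta> \<longleftrightarrow>
     invariant_form k W act \<beta> \<and>
     (\<forall>x\<in>topspace (mtop W). \<forall>Xs. \<beta> x (generating_field W act x # Xs) = 0)"

definition form_restrict ::
  "nat \<Rightarrow> ('a, 'e::euclidean_space) charted \<Rightarrow> 'a set \<Rightarrow> ('a \<Rightarrow> 'a tvec list \<Rightarrow> real) \<Rightarrow>
   'a \<Rightarrow> 'a tvec list \<Rightarrow> real" where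
  "form_restrict k M S \<beta> = form_pullback k (induced M S) M (\<lambda>x. x) \<beta>"

definition basic_on_boundary ::
  "nat \<Rightarrow> 'e::euclidean_space \<Rightarrow> ('a, 'e) charted \<Rightarrow> (complex \<Rightarrow> 'a \<Rightarrow> 'a) \<Rightarrow>
   ('a \<Rightarrow> 'a tvec list \<Rightarrow> real) \<Rightarrow> bool" where
  "basic_on_boundary k u M act \<beta> \<longleftrightarrow>
     basic_form k (induced M (bdry u M)) act (form_restrict k M (bdry u M) \<beta>)"

definition invariant_near_boundary ::
  "nat \<Rightarrow> 'e::euclidean_space \<Rightarrow> ('a, 'e) charted \<Rightarrow> 'a set \<Rightarrow> (complex \<Rightarrow> 'a \<Rightarrow> 'a) \<Rightarrow>
   ('a \<Rightarrow> 'a tvec list \<Rightarrow> real) \<Rightarrow> bool" where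
  "invariant_near_boundary k u M U act \<beta> \<longleftrightarrow>
     (\<exists>V. invariant_nbhd u M U act V \<and> invariant_form k (induced M V) act (form_restrict k M V \<beta>))"

definition is_cut_form ::
  "nat \<Rightarrow> 'e::euclidean_space \<Rightarrow> ('a, 'e) charted \<Rightarrow> (complex \<Rightarrow> 'a \<Rightarrow> 'a) \<Rightarrow> ('a set, 'e) charted \<Rightarrow>
   ('a \<Rightarrow> 'a tvec list \<Rightarrow> real) \<Rightarrow> ('a set \<Rightarrow> 'a set tvec list \<Rightarrow> real) \<Rightarrow> bool" where
  "is_cut_form k u M act N \<beta> \<beta>cut \<longleftrightarrow>
     differential_form k N \<beta>cut \<and>
     form_pullback k (induced M (intr u M)) N (cut_map u M act) \<beta>cut = form_restrict k M (intr u M) \<beta>"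

definition is_red_form ::
  "nat \<Rightarrow> 'e::euclidean_space \<Rightarrow> ('a, 'e) charted \<Rightarrow> (complex \<Rightarrow> 'a \<Rightarrow> 'a) \<Rightarrow> ('a set, 'e) charted \<Rightarrow>
   ('a \<Rightarrow> 'a tvec list \<Rightarrow> real) \<Rightarrow> ('a set \<Rightarrow> 'a set tvec list \<Rightarrow> real) \<Rightarrow> bool" where
  "is_red_form k u M act N \<beta> \<beta>red \<longleftrightarrow>
     differential_form k (reduced_space u M act N) \<beta>red \<and>
     form_pullback k (induced M (bdry u M)) (reduced_space u M act N) (cut_map u M act) \<beta>red =
       form_restrict k M (bdry u M) \<beta>"

end

theory Submission
  imports Defs
begin

text \<open>
  Let \<open>p\<close> be a boundary point and \<open>c\<close> the quotient map. The tangent vectors at \<open>c p\<close> of the reduced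
  space are the images \<open>c\<^sub>* X\<close> of vectors \<open>X\<close> tangent to the boundary, and \<open>\<beta>red\<close> takes on them
  the value \<open>\<beta> p X\<close>. Extend each \<open>X\<close> to vectors at interior points near \<open>p\<close> that are tangent to the
  level sets of \<open>f\<close>. A smooth function on the cut space pulls back to \<open>H (x, \<surd>f x)\<close>, and the
  singular term \<open>d\<surd>f\<close> vanishes along these vectors; so their images in the cut space converge to
  the image of \<open>X\<close>. On interior points \<open>c\<^sup>* \<beta>cut = \<beta>\<close>, and the theorem follows by continuity
  of both forms.

  That every tangent vector of the reduced space lifts is a dimension count in the cut space. Its
  tangent vectors at \<open>c p\<close> are the derivatives of \<open>H\<close> at \<open>(p, 0)\<close> in the directions of
  \<open>T\<^sub>p\<partial>M \<times> \<complex>\<close>, with a kernel of dimension at most one because averaging over the circle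
  yields sufficiently many invariant functions; the complex direction is detected by functions
  \<open>Re (z \<cdot> cnj (\<zeta> x))\<close> with \<open>\<zeta>\<close> equivariant, which vanish on the reduced space.
\<close>

section \<open>Calculus of smooth maps\<close>

text \<open>The cut manifold is known only through its algebra of smooth functions: its charts bear
  no relation to those of \<open>M\<close>, and every function comes with its own witness
  \<open>H\<close>. Tangent vectors are therefore treated as derivations and tested on one function
  at a time. Two difficulties shape the proof. The quotient map is not smooth at the boundary, where
  the derivative of \<open>sqrt f\<close> is infinite, so \<open>\<beta>cut\<close> cannot simply be
  pulled back to all of \<open>M\<close>; the two forms meet only in a limit. And smoothness on a
  half-space, or on the set of pairs \<open>(\<phi> x, a * sqrt (f x))\<close>, means extendability,
  so a derivative has a meaning only along directions in which all extensions agree; much of the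
  work consists in showing that enough such directions exist. For the dimension count an upper bound
  on the kernel is enough, since \<open>M\<close> and \<open>N\<close> are modelled on the same
  \<open>E\<close>, and such a bound only asks for many functions on \<open>N\<close>. These are
  built on \<open>M\<close>, where bump functions and averages are at hand, and then
  descend.\<close>

lemma Ck_on_subset: "Ck_on k W f \<Longrightarrow> W' \<subseteq> W \<Longrightarrow> Ck_on k W' f"
proof (induction k arbitrary: f)
  case 0
  then show ?case by (auto intro: continuous_on_subset)
next
  case (Suc k)
  then show ?case by (simp) blast
qed

lemma Ck_on_cong_open:
  assumes "open W" "Ck_on k W f" "\<And>x. x \<in> W \<Longrightarrow> f x = g x"
  shows "Ck_on k W g"
  using assms
proof (induction k arbitrary: f g)
  case 0
  then show ?case by (auto cong: continuous_on_cong)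
next
  case (Suc k)
  then obtain f' where f': "\<forall>x\<in>W. (f has_derivative f' x) (at x)" "\<forall>v. Ck_on k W (\<lambda>x. f' x v)"
    by auto
  have "(g has_derivative f' x) (at x)" if "x \<in> W" for x
    using has_derivative_transform_within_open[of f "f' x" x UNIV W g] f' that Suc.prems by auto
  then show ?case using f' by auto
qed

lemma Ck_on_SucD: "Ck_on (Suc k) W f \<Longrightarrow> Ck_on k W f"
proof (induction k arbitrary: f)
  case 0
  then obtain f' where "\<forall>x\<in>W. (f has_derivative f' x) (at x)" by auto
  then have "\<forall>x\<in>W. isCont f x" using has_derivative_continuous by blast
  then show ?case by (simp add: continuous_at_imp_continuous_on)
next
  case (Suc k)
  from Suc.prems obtain f' where "\<forall>x\<in>W. (f has_derivative f' x) (at x)"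
    "\<forall>v. Ck_on (Suc k) W (\<lambda>x. f' x v)"
    by (subst (asm) Ck_on.simps) blast
  with Suc.IH show ?case by (subst Ck_on.simps) blast
qed

lemma Ck_on_continuous: "Ck_on k W f \<Longrightarrow> continuous_on W f"
  by (induction k) (auto dest: Ck_on_SucD simp del: Ck_on.simps(2))

lemma Ck_on_const: "Ck_on k W (\<lambda>x. c)"
proof (induction k arbitrary: c)
  case (Suc k)
  show ?case
    by (auto intro!: exI[of _ "\<lambda>x v. 0"] Suc)
qed auto

lemma Ck_on_linear: "bounded_linear f \<Longrightarrow> Ck_on k W f"
proof (induction k)
  case 0
  then show ?case by (simp add: linear_continuous_on)
next
  case (Suc k)
  then show ?case
    by (auto intro!: exI[of _ "\<lambda>x v. f v"] Ck_on_const bounded_linear_imp_has_derivative)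
qed

lemma Ck_on_add: "Ck_on k W f \<Longrightarrow> Ck_on k W g \<Longrightarrow> Ck_on k W (\<lambda>x. f x + g x)"
proof (induction k arbitrary: f g)
  case 0
  then show ?case by (auto intro: continuous_intros)
next
  case (Suc k)
  then obtain f' g' where
    "\<forall>x\<in>W. (f has_derivative f' x) (at x)" "\<forall>v. Ck_on k W (\<lambda>x. f' x v)"
    "\<forall>x\<in>W. (g has_derivative g' x) (at x)" "\<forall>v. Ck_on k W (\<lambda>x. g' x v)"
    by auto
  then show ?case
    by (auto intro!: exI[of _ "\<lambda>x v. f' x v + g' x v"] Suc.IH derivative_intros)
qed

lemma Ck_on_sum: "(\<And>i. i \<in> A \<Longrightarrow> Ck_on k W (f i)) \<Longrightarrow> Ck_on k W (\<lambda>x. \<Sum>i\<in>A. f i x)"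
  by (induction A rule: infinite_finite_induct) (auto intro: Ck_on_const Ck_on_add)

lemma Ck_on_bilinear:
  assumes "bounded_bilinear B"
  shows "Ck_on k W f \<Longrightarrow> Ck_on k W g \<Longrightarrow> Ck_on k W (\<lambda>x. B (f x) (g x))"
proof (induction k arbitrary: f g)
  case 0
  then show ?case using bounded_bilinear.continuous_on[OF assms] by auto
next
  case (Suc k)
  have C: "Ck_on k W f" "Ck_on k W g" using Suc.prems Ck_on_SucD by blast+
  obtain f' g' where
    d: "\<forall>x\<in>W. (f has_derivative f' x) (at x)" "\<forall>v. Ck_on k W (\<lambda>x. f' x v)"
    "\<forall>x\<in>W. (g has_derivative g' x) (at x)" "\<forall>v. Ck_on k W (\<lambda>x. g' x v)"
    using Suc.prems by auto
  show ?case
    using d C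
    by (auto intro!: exI[of _ "\<lambda>x v. B (f x) (g' x v) + B (f' x v) (g x)"] Suc.IH Ck_on_add
        bounded_bilinear.FDERIV[OF assms])
qed

text \<open>The induction hypothesis covers derivatives in fixed directions, while the chain rule
  produces \<open>g' (f x)\<close> in the moving direction \<open>f' x v\<close>. Expanding that
  direction in \<open>Basis\<close> leaves fixed directions with scalar coefficients, which is why
  the middle space is Euclidean.\<close>

lemma Ck_on_compose:
  fixes f :: "'a::real_normed_vector \<Rightarrow> 'b::euclidean_space"
    and g :: "'b \<Rightarrow> 'c::real_normed_vector"
  shows "Ck_on k W f \<Longrightarrow> Ck_on k W' g \<Longrightarrow> f ` W \<subseteq> W' \<Longrightarrow> Ck_on k W (\<lambda>x. g (f x))"
proof (induction k arbitrary: g)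
  case 0
  then show ?case by (auto intro: continuous_on_compose2)
next
  case (Suc k)
  have C: "Ck_on k W f" using Suc.prems Ck_on_SucD by blast
  obtain f' where d: "\<forall>x\<in>W. (f has_derivative f' x) (at x)" "\<forall>v. Ck_on k W (\<lambda>x. f' x v)"
    using Suc.prems by auto
  obtain g' where e: "\<forall>x\<in>W'. (g has_derivative g' x) (at x)" "\<forall>v. Ck_on k W' (\<lambda>x. g' x v)"
    using Suc.prems by auto
  let ?h = "\<lambda>x v. \<Sum>j\<in>Basis. (f' x v \<bullet> j) *\<^sub>R g' (f x) j"
  have "((\<lambda>x. g (f x)) has_derivative ?h x) (at x)" if x: "x \<in> W" for x
  proof -
    have gd: "(g has_derivative g' (f x)) (at (f x))" using e x Suc.prems by auto
    have "((\<lambda>x. g (f x)) has_derivative (\<lambda>v. g' (f x) (f' x v))) (at x)"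
      using has_derivative_compose[OF d(1)[rule_format, OF x] gd] .
    moreover have "(\<lambda>v. g' (f x) (f' x v)) = ?h x"
    proof
      fix v
      let ?w = "f' x v"
      have "linear (g' (f x))" using gd has_derivative_bounded_linear bounded_linear.linear by blast
      then have "g' (f x) (\<Sum>j\<in>Basis. (?w \<bullet> j) *\<^sub>R j) = ?h x v"
        by (simp add: linear_sum linear_scale)
      then show "g' (f x) ?w = ?h x v" by (simp add: euclidean_representation)
    qed
    ultimately show ?thesis by simp
  qed
  moreover have "Ck_on k W (\<lambda>x. ?h x v)" for v
  proof (intro Ck_on_sum Ck_on_bilinear[OF bounded_bilinear_scaleR])
    fix j :: 'b
    show "Ck_on k W (\<lambda>x. f' x v \<bullet> j)"
      by (rule Ck_on_bilinear[OF bounded_bilinear_inner]) (use d in \<open>auto intro: Ck_on_const\<close>)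
    show "Ck_on k W (\<lambda>x. g' (f x) j)"
      by (rule Suc.IH) (use C e Suc.prems in auto)
  qed
  ultimately show ?case unfolding Ck_on.simps by (intro exI[of _ ?h]) simp
qed

text \<open>Differentiation under the integral sign: the derivative is an integral of the same
  shape, so the induction on \<open>k\<close> closes. It serves Hadamard's lemma and the averaging
  over orbits.\<close>

lemma Ck_on_param_integral:
  fixes P :: "'a::euclidean_space \<times> real \<Rightarrow> 'b::banach"
  assumes "open W" "W \<times> {a..b} \<subseteq> \<Omega>"
  shows "Ck_on k \<Omega> P \<Longrightarrow> Ck_on k W (\<lambda>y. integral {a..b} (\<lambda>t. P (y, t)))"
proof (induction k arbitrary: P)
  case 0
  then have "continuous_on (W \<times> cbox a b) (\<lambda>(x, t). P (x, t))"
    using assms by (auto intro: continuous_on_subset)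
  from integral_continuous_on_param[OF this] show ?case by simp
next
  case (Suc k)
  obtain P' where d: "\<forall>x\<in>\<Omega>. (P has_derivative P' x) (at x)" "\<forall>v. Ck_on k \<Omega> (\<lambda>x. P' x v)"
    using Suc.prems by auto
  have P: "continuous_on \<Omega> P" using Suc.prems Ck_on_continuous by blast
  \<comment> \<open>\<open>leibniz_rule\<close> asks for a jointly continuous operator-valued
    derivative, whereas \<open>Ck_on\<close> speaks of its values on fixed vectors. In finite
    dimension continuity may be checked on basis vectors.\<close>
  let ?D = "\<lambda>y t. Blinfun (\<lambda>v. P' (y, t) (v, 0))"
  have dP: "((\<lambda>y. P (y, t)) has_derivative (\<lambda>v. P' (y, t) (v, 0))) (at y)"
    if "y \<in> W" "t \<in> {a..b}" for y t
  proof -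
    have "(y, t) \<in> \<Omega>" using that assms by auto
    then have "(P has_derivative P' (y, t)) (at (y, t))" using d(1) by (rule bspec[rotated])
    then show ?thesis
      by (intro has_derivative_compose[where f = "\<lambda>y. (y, t)" and g = P, simplified])
        (auto intro!: derivative_eq_intros)
  qed
  have app: "blinfun_apply (?D y t) v = P' (y, t) (v, 0)" if "y \<in> W" "t \<in> {a..b}" for y t v
    using bounded_linear_Blinfun_apply[OF has_derivative_bounded_linear[OF dP[OF that]]] by simp
  have contD: "continuous_on (W \<times> cbox a b) (\<lambda>(y, t). ?D y t)"
  proof (rule continuous_on_blinfun_componentwise)
    fix i :: 'a
    have "continuous_on (W \<times> cbox a b) (\<lambda>x. P' x (i, 0))"
      using Ck_on_continuous[OF d(2)[rule_format, of "(i, 0)"]] assms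
      by (auto intro: continuous_on_subset)
    then show "continuous_on (W \<times> cbox a b) (\<lambda>x. blinfun_apply (case x of (y, t) \<Rightarrow> ?D y t) i)"
      by (rule continuous_on_eq) (auto simp: app)
  qed
  have "((\<lambda>y. integral {a..b} (\<lambda>t. P (y, t))) has_derivative
      (\<lambda>v. integral {a..b} (\<lambda>t. P' (y, t) (v, 0)))) (at y)" if y: "y \<in> W" for y
  proof -
    obtain r where r: "r > 0" "ball y r \<subseteq> W" using assms(1) y openE by blast
    have A: "((\<lambda>y. integral (cbox a b) (\<lambda>t. P (y, t))) has_derivative
      integral (cbox a b) (?D y)) (at y within ball y r)"
    proof (rule leibniz_rule)
      fix x t assume x: "x \<in> ball y r" "t \<in> cbox a b"
      then have xW: "x \<in> W" "t \<in> {a..b}" using r by auto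
      then have "blinfun_apply (?D x t) = (\<lambda>v. P' (x, t) (v, 0))"
        using app by blast
      then show "((\<lambda>y. P (y, t)) has_derivative blinfun_apply (?D x t)) (at x within ball y r)"
        using has_derivative_at_withinI[OF dP[OF xW]] by simp
    next
      fix x assume x: "x \<in> ball y r"
      show "(\<lambda>t. P (x, t)) integrable_on cbox a b"
        by (rule integrable_continuous, rule continuous_on_compose2[OF P])
          (use x r assms in \<open>auto intro!: continuous_intros\<close>)
    next
      show "continuous_on (ball y r \<times> cbox a b) (\<lambda>(y, t). ?D y t)"
        by (rule continuous_on_subset[OF contD]) (use r in auto)
    qed (use r in auto)
    have B: "blinfun_apply (integral (cbox a b) (?D y)) = (\<lambda>v. integral {a..b} (\<lambda>t. P' (y, t) (v, 0)))"
    proof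
      fix v
      have "?D y integrable_on cbox a b"
        by (rule integrable_continuous, rule continuous_on_compose2[OF contD, of _ "\<lambda>t. (y, t)", simplified])
          (use y in \<open>auto intro!: continuous_intros\<close>)
      then have "blinfun_apply (integral (cbox a b) (?D y)) v = integral (cbox a b) (\<lambda>t. blinfun_apply (?D y t) v)"
        by (rule blinfun_apply_integral)
      also have "\<dots> = integral {a..b} (\<lambda>t. P' (y, t) (v, 0))"
        unfolding cbox_interval by (rule integral_cong) (simp add: app y)
      finally show "blinfun_apply (integral (cbox a b) (?D y)) v = integral {a..b} (\<lambda>t. P' (y, t) (v, 0))" .
    qed
    have C: "at y within ball y r = at y" using r(1) by (intro at_within_open) auto
    show ?thesis using A unfolding B C unfolding cbox_interval .
  qed
  moreover have "Ck_on k W (\<lambda>y. integral {a..b} (\<lambda>t. P' (y, t) (v, 0)))" for v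
    using Suc.IH[of "\<lambda>x. P' x (v, 0)"] d by auto
  ultimately show ?case unfolding Ck_on.simps
    by (intro exI[of _ "\<lambda>y v. integral {a..b} (\<lambda>t. P' (y, t) (v, 0))"]) simp
qed

section \<open>Infinitely differentiable maps\<close>

definition Cinf :: "'a::real_normed_vector set \<Rightarrow> ('a \<Rightarrow> 'b::real_normed_vector) \<Rightarrow> bool" where
  "Cinf W f \<longleftrightarrow> (\<forall>k. Ck_on k W f)"

abbreviation Df :: "('a::real_normed_vector \<Rightarrow> 'b::real_normed_vector) \<Rightarrow> 'a \<Rightarrow> 'a \<Rightarrow> 'b" where
  "Df f x v \<equiv> frechet_derivative f (at x) v"

lemma Cinf_subset: "Cinf W f \<Longrightarrow> W' \<subseteq> W \<Longrightarrow> Cinf W' f"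
  unfolding Cinf_def using Ck_on_subset by blast

lemma Cinf_continuous: "Cinf W f \<Longrightarrow> continuous_on W f"
  unfolding Cinf_def using Ck_on_continuous by blast

lemma Cinf_const: "Cinf W (\<lambda>x. c)"
  by (simp add: Cinf_def Ck_on_const del: Ck_on.simps)

lemma Cinf_linear: "bounded_linear f \<Longrightarrow> Cinf W f"
  by (simp add: Cinf_def Ck_on_linear del: Ck_on.simps)

lemma Cinf_bilinear: "bounded_bilinear B \<Longrightarrow> Cinf W f \<Longrightarrow> Cinf W g \<Longrightarrow> Cinf W (\<lambda>x. B (f x) (g x))"
  by (simp add: Cinf_def Ck_on_bilinear del: Ck_on.simps)

lemma Cinf_add: "Cinf W f \<Longrightarrow> Cinf W g \<Longrightarrow> Cinf W (\<lambda>x. f x + g x)"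
  by (simp add: Cinf_def Ck_on_add del: Ck_on.simps)

lemma Cinf_compose:
  fixes f :: "'a::real_normed_vector \<Rightarrow> 'b::euclidean_space"
  assumes "Cinf W f" "Cinf W' g" "f ` W \<subseteq> W'"
  shows "Cinf W (\<lambda>x. g (f x))"
  using assms Ck_on_compose unfolding Cinf_def by blast

lemma Cinf_linear_comp: "bounded_linear g \<Longrightarrow> Cinf W f \<Longrightarrow> Cinf W (\<lambda>x. g (f x))"
  for f :: "'a::real_normed_vector \<Rightarrow> 'b::euclidean_space"
  by (rule Cinf_compose[of W f UNIV]) (auto intro: Cinf_linear)

lemma Cinf_id: "Cinf W (\<lambda>x. x)"
  by (rule Cinf_linear) (rule bounded_linear_ident)

lemma Cinf_mult: "Cinf W f \<Longrightarrow> Cinf W g \<Longrightarrow> Cinf W (\<lambda>x. f x * g x)"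
  for f :: "'a::real_normed_vector \<Rightarrow> 'b::real_normed_algebra"
  by (rule Cinf_bilinear[OF bounded_bilinear_mult])

lemma Cinf_scaleR: "Cinf W f \<Longrightarrow> Cinf W g \<Longrightarrow> Cinf W (\<lambda>x. f x *\<^sub>R g x)"
  by (rule Cinf_bilinear[OF bounded_bilinear_scaleR])

lemma Cinf_inner: "Cinf W f \<Longrightarrow> Cinf W g \<Longrightarrow> Cinf W (\<lambda>x. f x \<bullet> g x)"
  by (rule Cinf_bilinear[OF bounded_bilinear_inner])

lemma Cinf_minus: "Cinf W f \<Longrightarrow> Cinf W g \<Longrightarrow> Cinf W (\<lambda>x. f x - g x)"
  using Cinf_add[of W f "\<lambda>x. (-1) *\<^sub>R g x"] Cinf_scaleR[OF Cinf_const, of W g "-1"] by simp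

lemma Cinf_Pair:
  fixes f :: "'a::real_normed_vector \<Rightarrow> 'b::euclidean_space" and g :: "'a \<Rightarrow> 'c::euclidean_space"
  assumes "Cinf W f" "Cinf W g"
  shows "Cinf W (\<lambda>x. (f x, g x))"
proof -
  have l1: "bounded_linear (\<lambda>a::'b. (a, 0::'c))" by (intro bounded_linear_Pair bounded_linear_ident bounded_linear_zero)
  have l2: "bounded_linear (\<lambda>b::'c. (0::'b, b))" by (intro bounded_linear_Pair bounded_linear_ident bounded_linear_zero)
  have "Cinf W (\<lambda>x. (f x, 0::'c) + (0::'b, g x))"
    by (rule Cinf_add[OF Cinf_linear_comp[OF l1 assms(1)] Cinf_linear_comp[OF l2 assms(2)]])
  then show ?thesis by simp
qed

lemma Cinf_fst: "Cinf W (fst :: 'a::real_normed_vector \<times> 'b::real_normed_vector \<Rightarrow> 'a)"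
  by (rule Cinf_linear) (rule bounded_linear_fst)

lemma Cinf_snd: "Cinf W (snd :: 'a::real_normed_vector \<times> 'b::real_normed_vector \<Rightarrow> 'b)"
  by (rule Cinf_linear) (rule bounded_linear_snd)

lemma Cinf_differentiable: "Cinf W f \<Longrightarrow> x \<in> W \<Longrightarrow> f differentiable (at x)"
  unfolding Cinf_def differentiable_def by (drule spec[of _ "Suc 0"]) auto

lemma Cinf_has_derivative: "Cinf W f \<Longrightarrow> x \<in> W \<Longrightarrow> (f has_derivative Df f x) (at x)"
  using Cinf_differentiable frechet_derivative_works by blast

lemma Cinf_linear_Df: "Cinf W f \<Longrightarrow> x \<in> W \<Longrightarrow> linear (Df f x)"
  using Cinf_has_derivative has_derivative_linear by blast

text \<open>The derivative supplied by \<open>Ck_on (Suc k)\<close> may depend on \<open>k\<close>.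
  Uniqueness of derivatives identifies all of them with \<open>Df\<close> on \<open>W\<close>, and
  openness of \<open>W\<close> lets the smoothness be transferred.\<close>

lemma Cinf_Df:
  assumes W: "open W" and f: "Cinf W f"
  shows "Cinf W (\<lambda>x. Df f x v)"
  unfolding Cinf_def
proof
  fix k
  have "Ck_on (Suc k) W f" using f Cinf_def by blast
  then obtain f' where f': "\<forall>x\<in>W. (f has_derivative f' x) (at x)" "\<forall>v. Ck_on k W (\<lambda>x. f' x v)"
    by auto
  have "f' x v = Df f x v" if "x \<in> W" for x
    using frechet_derivative_at[of f "f' x" x] f' that by auto
  then show "Ck_on k W (\<lambda>x. Df f x v)"
    by (rule Ck_on_cong_open[OF W f'(2)[rule_format, of v]])
qed

section \<open>Smoothness of inverse and square root, and a smooth cutoff function\<close>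

lemma Cinf_inverse: "Cinf {x. x \<noteq> 0} (inverse :: real \<Rightarrow> real)"
  unfolding Cinf_def
proof
  fix k
  \<comment> \<open>All negative powers are treated at once, because differentiation leads from one
    to the next; \<open>m = 0\<close> is the claim.\<close>
  have "Ck_on k {x::real. x \<noteq> 0} (\<lambda>x. inverse x ^ Suc m)" for m
  proof (induction k arbitrary: m)
    case 0
    show ?case by (auto intro!: continuous_intros)
  next
    case (Suc k)
    have "((\<lambda>x. inverse x ^ Suc m) has_derivative (\<lambda>v. v * (- real (Suc m) * inverse x ^ Suc (Suc m)))) (at x)"
      if "x \<noteq> 0" for x :: real
    proof -
      have "((\<lambda>x. inverse x ^ Suc m) has_real_derivative (- real (Suc m) * inverse x ^ Suc (Suc m))) (at x)"
        using DERIV_power[OF DERIV_inverse[OF that], of "Suc m"] by (simp add: algebra_simps)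
      then show ?thesis by (simp add: has_field_derivative_def mult_commute_abs)
    qed
    moreover have "Ck_on k {x::real. x \<noteq> 0} (\<lambda>x. v * (- real (Suc m) * inverse x ^ Suc (Suc m)))" for v
      by (intro Ck_on_bilinear[OF bounded_bilinear_mult] Ck_on_const Suc)
    ultimately show ?case unfolding Ck_on.simps by (intro exI[of _ "\<lambda>x v. v * (- real (Suc m) * inverse x ^ Suc (Suc m))"]) simp
  qed
  from this[of 0] show "Ck_on k {x::real. x \<noteq> 0} inverse" by simp
qed

lemma Cinf_sqrt: "Cinf {x. x > 0} sqrt"
  unfolding Cinf_def
proof
  fix k
  show "Ck_on k {x::real. x > 0} sqrt"
  proof (induction k)
    case 0
    show ?case by (auto intro!: continuous_intros)
  next
    case (Suc k)
    let ?d = "\<lambda>x v. v * (inverse (sqrt x) * inverse 2)"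
    have "(sqrt has_derivative ?d x) (at x)"
      if "x > 0" for x :: real
    proof -
      have "(sqrt has_real_derivative (inverse (sqrt x) * inverse 2)) (at x)"
        using that by (auto intro!: derivative_eq_intros simp: field_simps)
      then show ?thesis
        unfolding has_field_derivative_def by (simp add: mult_commute_abs del: times_divide_eq_right)
    qed
    moreover have "Ck_on k {x::real. x > 0} (\<lambda>x. ?d x v)" for v
    proof (intro Ck_on_bilinear[OF bounded_bilinear_mult] Ck_on_const)
      show "Ck_on k {x::real. x > 0} (\<lambda>x. inverse (sqrt x))"
        by (rule Ck_on_compose[OF Suc, of "{x. x \<noteq> 0}"]) (use Cinf_inverse Cinf_def in auto)
    qed
    ultimately show ?case unfolding Ck_on.simps by (intro exI[of _ ?d]) simp
  qed
qed

text \<open>The classical flat function \<open>exp (-1/x)\<close>, extended by 0. The factor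
  \<open>x^-m\<close> is there to make the family closed under differentiation, see
  \<open>flat_deriv\<close>.\<close>

definition flat :: "nat \<Rightarrow> real \<Rightarrow> real" where
  "flat m x = (if x > 0 then inverse x ^ m * exp (- inverse x) else 0)"

text \<open>One term of the series of \<open>exp (1/x)\<close>, that of degree \<open>m + 2\<close>,
  already gives the bound. The order \<open>x^2\<close> is what makes the difference quotient at 0
  tend to 0.\<close>

lemma flat_le: "x > 0 \<Longrightarrow> flat m x \<le> fact (m + 2) * x ^ 2"
proof -
  assume x: "x > 0"
  let ?y = "inverse x"
  have le: "?y ^ (m + 2) / fact (m + 2) \<le> exp ?y"
    using sum_le_suminf[OF summable_exp[of ?y], of "{m + 2}"] x
    by (simp add: exp_def divide_inverse mult.commute)
  have "?y ^ (m + 2) \<le> fact (m + 2) * exp ?y"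
    using le by (simp only: pos_divide_le_eq fact_gt_zero mult.commute)
  then have "?y ^ (m + 2) * exp (- ?y) \<le> fact (m + 2) * exp ?y * exp (- ?y)"
    by (rule mult_right_mono) simp
  then have "?y ^ (m + 2) * exp (- ?y) \<le> fact (m + 2)"
    by (simp only: mult.assoc exp_add[symmetric]) simp
  then have "?y ^ (m + 2) * exp (- ?y) * x ^ 2 \<le> fact (m + 2) * x ^ 2"
    by (intro mult_right_mono) auto
  moreover have "?y ^ (m + 2) * exp (- ?y) * x ^ 2 = flat m x"
    using x by (simp add: flat_def power_add field_simps power2_eq_square)
  ultimately show ?thesis by simp
qed

lemma flat_nonneg: "0 \<le> flat m x"
  by (simp add: flat_def)

lemma flat_pos: "x > 0 \<Longrightarrow> 0 < flat m x"
  by (simp add: flat_def)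

lemma flat_deriv: "(flat m has_real_derivative (flat (m + 2) x - real m * flat (m + 1) x)) (at x)"
proof -
  consider "x > 0" | "x < 0" | "x = 0" by linarith
  then show ?thesis
  proof cases
    case 1
    have x: "x \<noteq> 0" using 1 by simp
    have d1: "((\<lambda>x. inverse x ^ m) has_real_derivative - real m * inverse x ^ (m + 1)) (at x)"
      using DERIV_power[OF DERIV_inverse[OF x], of m] by (cases m) (simp_all add: algebra_simps)
    have d2: "((\<lambda>x. exp (- inverse x)) has_real_derivative exp (- inverse x) * inverse x ^ 2) (at x)"
      using DERIV_fun_exp[OF DERIV_minus[OF DERIV_inverse[OF x]]] by (simp add: power2_eq_square)
    have "- real m * inverse x ^ (m + 1) * exp (- inverse x) + exp (- inverse x) * inverse x ^ 2 * inverse x ^ m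
        = flat (m + 2) x - real m * flat (m + 1) x"
      using 1 by (simp add: flat_def power_add power2_eq_square)
    with DERIV_mult[OF d1 d2]
    have "((\<lambda>x. inverse x ^ m * exp (- inverse x)) has_real_derivative (flat (m + 2) x - real m * flat (m + 1) x)) (at x)"
      by simp
    then show ?thesis
      by (rule has_field_derivative_transform_within_open[of _ _ _ "{0<..}"]) (use 1 in \<open>auto simp: flat_def\<close>)
  next
    case 2
    have "((\<lambda>x. 0) has_real_derivative (flat (m + 2) x - real m * flat (m + 1) x)) (at x)"
      using 2 by (auto simp: flat_def)
    then show ?thesis
      by (rule has_field_derivative_transform_within_open[of _ _ _ "{..<0}"]) (use 2 in \<open>auto simp: flat_def\<close>)
  next
    case 3
    have "((\<lambda>h. (flat m (0 + h) - flat m 0) / h) \<longlongrightarrow> 0) (at 0)"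
    proof (rule Lim_null_comparison)
      show "\<forall>\<^sub>F h in at 0. norm ((flat m (0 + h) - flat m 0) / h) \<le> fact (m + 2) * \<bar>h\<bar>"
      proof (intro always_eventually allI)
        fix h :: real
        show "norm ((flat m (0 + h) - flat m 0) / h) \<le> fact (m + 2) * \<bar>h\<bar>"
        proof (cases "h > 0")
          case True
          have "flat m h / h \<le> (fact (m + 2) * h ^ 2) / h"
            using flat_le[OF True, of m] True by (intro divide_right_mono) auto
          then show ?thesis using True flat_nonneg[of m h] by (simp add: flat_def[of m 0] power2_eq_square)
        next
          case False
          then have "flat m h = 0" "flat m 0 = 0" by (auto simp: flat_def)
          then show ?thesis by (simp del: fact_Suc)
        qed
      qed
      have "((\<lambda>h. fact (m + 2) * \<bar>h\<bar>) \<longlongrightarrow> fact (m + 2) * \<bar>0::real\<bar>) (at 0)"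
        by (intro tendsto_intros)
      then show "((\<lambda>h. fact (m + 2) * \<bar>h\<bar>) \<longlongrightarrow> (0::real)) (at 0)" by simp
    qed
    then show ?thesis using 3 by (simp add: DERIV_def flat_def)
  qed
qed

lemma Cinf_flat: "Cinf UNIV (flat m)"
  unfolding Cinf_def
proof
  fix k
  show "Ck_on k UNIV (flat m)"
  proof (induction k arbitrary: m)
    case 0
    show ?case
      using DERIV_isCont[OF flat_deriv[of m]] by (simp add: continuous_at_imp_continuous_on)
  next
    case (Suc k)
    let ?d = "\<lambda>x v. v * (flat (m + 2) x + (- real m) * flat (m + 1) x)"
    have "(flat m has_derivative ?d x) (at x)" for x
      using flat_deriv[of m x] by (simp add: has_field_derivative_def mult_commute_abs)
    moreover have "Ck_on k UNIV (\<lambda>x. ?d x v)" for v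
      by (intro Ck_on_bilinear[OF bounded_bilinear_mult] Ck_on_const Ck_on_add Suc)
    ultimately show ?case unfolding Ck_on.simps by (intro exI[of _ ?d]) simp
  qed
qed

text \<open>The usual smooth cutoff. Its denominator is positive since \<open>1 - t\<close> and
  \<open>t - 1/2\<close> are never both nonpositive.\<close>

definition step :: "real \<Rightarrow> real" where
  "step t = flat 0 (1 - t) * inverse (flat 0 (1 - t) + flat 0 (t - 1/2))"

lemma step_denominator_pos: "0 < flat 0 (1 - t) + flat 0 (t - 1/2)"
proof (cases "t < 1")
  case True
  then show ?thesis using flat_pos[of "1 - t" 0] flat_nonneg[of 0 "t - 1/2"] by simp
next
  case False
  then show ?thesis using flat_pos[of "t - 1/2" 0] flat_nonneg[of 0 "1 - t"] by simp
qed

lemma Cinf_step: "Cinf UNIV step"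
proof -
  have 1: "Cinf UNIV (\<lambda>t. flat 0 (1 - t))" "Cinf UNIV (\<lambda>t. flat 0 (t - 1/2))"
    by (rule Cinf_compose[OF Cinf_minus[OF Cinf_const Cinf_id] Cinf_flat], simp)
      (rule Cinf_compose[OF Cinf_minus[OF Cinf_id Cinf_const] Cinf_flat], simp)
  have "Cinf UNIV (\<lambda>t. inverse (flat 0 (1 - t) + flat 0 (t - 1/2)))"
    by (rule Cinf_compose[OF Cinf_add[OF 1] Cinf_inverse]) (use step_denominator_pos in \<open>force simp: less_le\<close>)
  from Cinf_mult[OF 1(1) this] show ?thesis by (simp add: step_def[abs_def])
qed

lemma step_nonneg: "0 \<le> step t"
  unfolding step_def using flat_nonneg step_denominator_pos by (intro mult_nonneg_nonneg) (auto simp: less_imp_le)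

lemma step_eq_1: "t \<le> 1/2 \<Longrightarrow> step t = 1"
  unfolding step_def by (simp add: flat_def)

lemma step_eq_0: "t \<ge> 1 \<Longrightarrow> step t = 0"
  unfolding step_def by (simp add: flat_def)

lemma Cinf_param_integral:
  fixes P :: "'a::euclidean_space \<times> real \<Rightarrow> 'b::banach"
  assumes "open W" "W \<times> {a..b} \<subseteq> \<Omega>" "Cinf \<Omega> P"
  shows "Cinf W (\<lambda>y. integral {a..b} (\<lambda>t. P (y, t)))"
  using assms Ck_on_param_integral unfolding Cinf_def by blast

text \<open>\<open>\<Gamma> v y\<close> is the mean of \<open>Df G\<close> in direction
  \<open>v\<close> over the segment from \<open>y0\<close> to \<open>y\<close>, which convexity
  keeps inside \<open>W\<close>; the expansion of \<open>G\<close> is the fundamental theorem of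
  calculus along that segment.\<close>

lemma Cinf_hadamard:
  fixes G :: "'a::euclidean_space \<Rightarrow> real"
  assumes W: "open W" "convex W" "y0 \<in> W" and G: "Cinf W G"
  obtains \<Gamma> where "\<And>v. Cinf W (\<Gamma> v)" "\<And>v. \<Gamma> v y0 = Df G y0 v"
    "\<And>y. y \<in> W \<Longrightarrow> linear (\<lambda>v. \<Gamma> v y)"
    "\<And>y. y \<in> W \<Longrightarrow> G y = G y0 + \<Gamma> (y - y0) y"
proof -
  define c where "c = (\<lambda>(y, t::real). y0 + t *\<^sub>R (y - y0))"
  define \<Omega> where "\<Omega> = c -` W"
  define \<Gamma> where "\<Gamma> = (\<lambda>v y. integral {0..1} (\<lambda>t. Df G (c (y, t)) v))"
  have c: "Cinf UNIV c" unfolding c_def split_beta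
    by (rule Cinf_add[OF Cinf_const Cinf_scaleR[OF Cinf_snd Cinf_minus[OF Cinf_fst Cinf_const]]])
  have sub: "W \<times> {0..1} \<subseteq> \<Omega>"
  proof clarsimp
    fix y and t :: real assume "y \<in> W" "0 \<le> t" "t \<le> 1"
    then have "(1 - t) *\<^sub>R y0 + t *\<^sub>R y \<in> W" using W by (intro convexD) auto
    moreover have "(1 - t) *\<^sub>R y0 + t *\<^sub>R y = c (y, t)" by (simp add: c_def algebra_simps)
    ultimately show "(y, t) \<in> \<Omega>" by (simp add: \<Omega>_def)
  qed
  have D: "Cinf \<Omega> (\<lambda>x. Df G (c x) v)" for v
    by (rule Cinf_compose[OF Cinf_subset[OF c] Cinf_Df[OF W(1) G]]) (auto simp: \<Omega>_def)
  have int: "(\<lambda>t. Df G (c (y, t)) v) integrable_on {0..1}" if "y \<in> W" for y v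
  proof (rule integrable_continuous_real)
    show "continuous_on {0..1} (\<lambda>t. Df G (c (y, t)) v)"
      by (rule continuous_on_compose2[OF Cinf_continuous[OF D]]) (use sub that in \<open>auto intro!: continuous_intros\<close>)
  qed
  have lin: "linear (Df G (c (y, t)))" if "y \<in> W" "t \<in> {0..1}" for y t
  proof -
    have "(y, t) \<in> \<Omega>" using sub that by blast
    then show ?thesis using Cinf_linear_Df[OF G, of "c (y, t)"] by (simp add: \<Omega>_def)
  qed
  show ?thesis
  proof (rule that[of \<Gamma>])
    show "Cinf W (\<Gamma> v)" for v
      using Cinf_param_integral[OF W(1) sub D] by (simp add: \<Gamma>_def)
    show "\<Gamma> v y0 = Df G y0 v" for v by (simp add: \<Gamma>_def c_def)
    show "linear (\<lambda>v. \<Gamma> v y)" if y: "y \<in> W" for y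
    proof (rule linearI)
      fix v w and r :: real
      have "\<Gamma> (v + w) y = integral {0..1} (\<lambda>t. Df G (c (y, t)) v + Df G (c (y, t)) w)"
        unfolding \<Gamma>_def by (rule integral_cong) (simp add: lin y linear_add)
      then show "\<Gamma> (v + w) y = \<Gamma> v y + \<Gamma> w y"
        by (simp add: \<Gamma>_def integral_add int y)
      have "\<Gamma> (r *\<^sub>R v) y = integral {0..1} (\<lambda>t. r *\<^sub>R Df G (c (y, t)) v)"
        unfolding \<Gamma>_def by (rule integral_cong) (use lin y linear_scale in blast)
      then show "\<Gamma> (r *\<^sub>R v) y = r *\<^sub>R \<Gamma> v y" by (simp add: \<Gamma>_def)
    qed
    show "G y = G y0 + \<Gamma> (y - y0) y" if y: "y \<in> W" for y
    proof -
      have "((\<lambda>t. Df G (c (y, t)) (y - y0)) has_integral (G (c (y, 1)) - G (c (y, 0)))) {0..1}"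
      proof (rule fundamental_theorem_of_calculus)
        fix t :: real assume t: "t \<in> {0..1}"
        have "(y, t) \<in> \<Omega>" using sub y t by blast
        then have cW: "c (y, t) \<in> W" by (simp add: \<Omega>_def)
        have d: "(G has_derivative Df G (c (y, t))) (at (c (y, t)))" by (rule Cinf_has_derivative[OF G cW])
        have "((\<lambda>t. c (y, t)) has_vector_derivative (y - y0)) (at t within {0..1})"
          unfolding c_def by (auto intro!: derivative_eq_intros)
        from vector_derivative_diff_chain_within[OF this has_derivative_at_withinI[OF d]]
        show "((\<lambda>t. G (c (y, t))) has_vector_derivative Df G (c (y, t)) (y - y0)) (at t within {0..1})"
          by (simp add: o_def)
      qed simp
      then show ?thesis by (simp add: \<Gamma>_def integral_unique c_def)
    qed
  qed
qed

lemma Df_eqI: "(f has_derivative f') (at x) \<Longrightarrow> Df f x v = f' v"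
  by (metis frechet_derivative_at)

lemma open_Int_vimage_Cinf:
  assumes "open W" "Cinf W G" "open S"
  shows "open (W \<inter> G -` S)"
  using continuous_open_preimage[OF Cinf_continuous[OF assms(2)] assms(1,3)] .

section \<open>Local smooth extensions\<close>

text \<open>Extension and domain are kept explicit because derivatives of \<open>G\<close> are
  computed later. Agreement is required only at points of \<open>U\<close>, and
  \<open>\<phi>\<close> may be any map, so the same notion serves charts, their restrictions to
  boundary or interior, products, and the non-injective coordinates used for the cut space.\<close>

definition local_ext ::
  "'a set \<Rightarrow> ('a \<Rightarrow> 'e::real_normed_vector) \<Rightarrow> 'a \<Rightarrow> ('a \<Rightarrow> 'b::real_normed_vector) \<Rightarrow> 'e set \<Rightarrow> ('e \<Rightarrow> 'b) \<Rightarrow> bool" where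
  "local_ext U \<phi> p g W G \<longleftrightarrow> open W \<and> \<phi> p \<in> W \<and> Cinf W G \<and> (\<forall>x\<in>U. \<phi> x \<in> W \<longrightarrow> G (\<phi> x) = g x)"

definition smooth_near :: "'a set \<Rightarrow> ('a \<Rightarrow> 'e::real_normed_vector) \<Rightarrow> 'a \<Rightarrow> ('a \<Rightarrow> 'b::real_normed_vector) \<Rightarrow> bool" where
  "smooth_near U \<phi> p g \<longleftrightarrow> (\<exists>W G. local_ext U \<phi> p g W G)"

lemma smooth_nearE:
  assumes "smooth_near U \<phi> p g"
  obtains W G where "local_ext U \<phi> p g W G"
  using assms unfolding smooth_near_def by blast

lemma local_ext_open: "local_ext U \<phi> p g W G \<Longrightarrow> open W"
  and local_ext_mem: "local_ext U \<phi> p g W G \<Longrightarrow> \<phi> p \<in> W"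
  and local_ext_Cinf: "local_ext U \<phi> p g W G \<Longrightarrow> Cinf W G"
  and local_ext_eq: "local_ext U \<phi> p g W G \<Longrightarrow> x \<in> U \<Longrightarrow> \<phi> x \<in> W \<Longrightarrow> G (\<phi> x) = g x"
  by (auto simp: local_ext_def)

lemma local_ext_mono:
  assumes "local_ext U \<phi> p g W G" "open W'" "\<phi> p \<in> W'" "W' \<subseteq> W"
    "\<And>x. x \<in> U' \<Longrightarrow> \<phi> x \<in> W' \<Longrightarrow> x \<in> U \<and> h x = g x"
  shows "local_ext U' \<phi> p h W' G"
  using assms unfolding local_ext_def by (auto intro: Cinf_subset)

lemma local_ext_smooth_near: "local_ext U \<phi> p g W G \<Longrightarrow> smooth_near U \<phi> p g"
  unfolding smooth_near_def by blast

lemma local_ext_fun: "open W \<Longrightarrow> Cinf W F \<Longrightarrow> \<phi> p \<in> W \<Longrightarrow> local_ext U \<phi> p (\<lambda>x. F (\<phi> x)) W F"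
  by (simp add: local_ext_def)

lemma local_ext_compose:
  fixes g :: "'a \<Rightarrow> 'b::euclidean_space"
  assumes g: "local_ext U \<phi> p g W G" and p: "p \<in> U" and F: "open S" "Cinf S F" "g p \<in> S"
  shows "local_ext U \<phi> p (\<lambda>x. F (g x)) (W \<inter> G -` S) (\<lambda>y. F (G y))"
  unfolding local_ext_def
proof (intro conjI ballI impI)
  have W: "open W" "Cinf W G" using g by (auto simp: local_ext_def)
  show "open (W \<inter> G -` S)" by (rule open_Int_vimage_Cinf[OF W F(1)])
  show "\<phi> p \<in> W \<inter> G -` S" using g p F unfolding local_ext_def by auto
  show "Cinf (W \<inter> G -` S) (\<lambda>y. F (G y))"
    by (rule Cinf_compose[OF Cinf_subset[OF W(2)] F(2)]) auto
  show "F (G (\<phi> x)) = F (g x)" if "x \<in> U" "\<phi> x \<in> W \<inter> G -` S" for x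
    using g that by (auto simp: local_ext_def)
qed

lemma local_ext_Pair:
  fixes g :: "'a \<Rightarrow> 'b::euclidean_space" and h :: "'a \<Rightarrow> 'c::euclidean_space"
  assumes "local_ext U \<phi> p g W G" "local_ext U \<phi> p h W' H"
  shows "local_ext U \<phi> p (\<lambda>x. (g x, h x)) (W \<inter> W') (\<lambda>y. (G y, H y))"
  using assms unfolding local_ext_def by (auto intro!: Cinf_Pair intro: Cinf_subset)

lemma smooth_near_mono:
  assumes "smooth_near U \<phi> p g" "open W" "\<phi> p \<in> W"
    "\<And>x. x \<in> U' \<Longrightarrow> \<phi> x \<in> W \<Longrightarrow> x \<in> U \<and> h x = g x"
  shows "smooth_near U' \<phi> p h"
proof -
  obtain W1 G where G: "local_ext U \<phi> p g W1 G" using assms(1) by (elim smooth_nearE)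
  have "local_ext U' \<phi> p h (W1 \<inter> W) G"
    by (rule local_ext_mono[OF G]) (use assms G in \<open>auto simp: local_ext_def\<close>)
  then show ?thesis by (rule local_ext_smooth_near)
qed

lemma smooth_near_cong: "smooth_near U \<phi> p g \<Longrightarrow> (\<And>x. x \<in> U \<Longrightarrow> g x = h x) \<Longrightarrow> smooth_near U \<phi> p h"
  by (rule smooth_near_mono[of U \<phi> p g UNIV]) auto

lemma smooth_near_const: "smooth_near U \<phi> p (\<lambda>x. c)"
  by (rule local_ext_smooth_near[OF local_ext_fun[of UNIV "\<lambda>x. c"]]) (auto intro: Cinf_const)

lemma smooth_near_compose:
  fixes g :: "'a \<Rightarrow> 'b::euclidean_space"
  assumes "smooth_near U \<phi> p g" "p \<in> U" "open S" "Cinf S F" "g p \<in> S"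
  shows "smooth_near U \<phi> p (\<lambda>x. F (g x))"
  using assms local_ext_compose local_ext_smooth_near unfolding smooth_near_def[of U \<phi> p g] by metis

lemma smooth_near_compose_UNIV:
  fixes g :: "'a \<Rightarrow> 'b::euclidean_space"
  assumes "Cinf UNIV F" "smooth_near U \<phi> p g" "p \<in> U"
  shows "smooth_near U \<phi> p (\<lambda>x. F (g x))"
  using smooth_near_compose[OF assms(2,3) open_UNIV assms(1)] by simp

lemma smooth_near_Pair:
  fixes g :: "'a \<Rightarrow> 'b::euclidean_space" and h :: "'a \<Rightarrow> 'c::euclidean_space"
  assumes "smooth_near U \<phi> p g" "smooth_near U \<phi> p h"
  shows "smooth_near U \<phi> p (\<lambda>x. (g x, h x))"
  using assms local_ext_Pair unfolding smooth_near_def by metis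

lemma smooth_near_bilinear:
  fixes g :: "'a \<Rightarrow> 'b::euclidean_space" and h :: "'a \<Rightarrow> 'c::euclidean_space"
  assumes B: "bounded_bilinear B" and "smooth_near U \<phi> p g" "smooth_near U \<phi> p h" "p \<in> U"
  shows "smooth_near U \<phi> p (\<lambda>x. B (g x) (h x))"
  using smooth_near_compose_UNIV[OF Cinf_bilinear[OF B Cinf_fst Cinf_snd] smooth_near_Pair[OF assms(2,3)] assms(4)] by simp

lemma smooth_near_mult:
  fixes g h :: "'a \<Rightarrow> 'b::{euclidean_space, real_normed_algebra}"
  shows "smooth_near U \<phi> p g \<Longrightarrow> smooth_near U \<phi> p h \<Longrightarrow> p \<in> U \<Longrightarrow> smooth_near U \<phi> p (\<lambda>x. g x * h x)"
  by (rule smooth_near_bilinear[OF bounded_bilinear_mult])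

lemma smooth_near_add:
  fixes g h :: "'a \<Rightarrow> 'b::euclidean_space"
  assumes "smooth_near U \<phi> p g" "smooth_near U \<phi> p h" "p \<in> U"
  shows "smooth_near U \<phi> p (\<lambda>x. g x + h x)"
  using smooth_near_compose_UNIV[OF Cinf_add[OF Cinf_fst Cinf_snd] smooth_near_Pair[OF assms(1,2)] assms(3)] by simp

lemma smooth_near_linear:
  fixes g :: "'a \<Rightarrow> 'b::euclidean_space"
  shows "bounded_linear F \<Longrightarrow> smooth_near U \<phi> p g \<Longrightarrow> p \<in> U \<Longrightarrow> smooth_near U \<phi> p (\<lambda>x. F (g x))"
  by (rule smooth_near_compose_UNIV[OF Cinf_linear])

section \<open>Derivatives of local extensions\<close>

text \<open>
  The derivative in direction \<open>v\<close> of a local extension of a function does not depend on the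
  extension when \<open>v\<close> is a tangent direction, in the following sense, of the image of the chart.
\<close>

definition tangent_dir :: "'e::real_normed_vector set \<Rightarrow> 'e \<Rightarrow> 'e \<Rightarrow> bool" where
  "tangent_dir S y v \<longleftrightarrow>
     (\<forall>W (K :: 'e \<Rightarrow> real). open W \<and> y \<in> W \<and> Cinf W K \<and> (\<forall>z\<in>S \<inter> W. K z = 0) \<longrightarrow> Df K y v = 0)"

lemma tangent_dirD: "tangent_dir S y v \<Longrightarrow> open W \<Longrightarrow> y \<in> W \<Longrightarrow> Cinf W (K :: _ \<Rightarrow> real) \<Longrightarrow> (\<And>z. z \<in> S \<Longrightarrow> z \<in> W \<Longrightarrow> K z = 0) \<Longrightarrow> Df K y v = 0"
  unfolding tangent_dir_def by blast

lemma tangent_dir_lincomb: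
  assumes "tangent_dir S y v" "tangent_dir S y w"
  shows "tangent_dir S y (a *\<^sub>R v + b *\<^sub>R w)"
  unfolding tangent_dir_def
proof (intro allI impI, elim conjE)
  fix W and K :: "'a \<Rightarrow> real"
  assume K: "open W" "y \<in> W" "Cinf W K" "\<forall>z\<in>S \<inter> W. K z = 0"
  then have "Df K y v = 0" "Df K y w = 0" using assms by (auto intro!: tangent_dirD)
  then show "Df K y (a *\<^sub>R v + b *\<^sub>R w) = 0"
    using Cinf_linear_Df[OF K(3,2)] by (simp add: linear_add linear_scale)
qed

lemma tangent_dir_scale: "tangent_dir S y v \<Longrightarrow> tangent_dir S y (a *\<^sub>R v)"
  using tangent_dir_lincomb[of S y v v a 0] by simp

lemma tangent_dir_mono: "tangent_dir S y v \<Longrightarrow> S \<subseteq> S' \<Longrightarrow> tangent_dir S' y v"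
  unfolding tangent_dir_def by blast

text \<open>A function vanishing on \<open>S\<close> vanishes along the curve, hence so does its
  one-sided derivative. One side is all that is available at boundary points; curves instead of rays
  are needed for the complex direction.\<close>

lemma tangent_dir_curve:
  assumes \<gamma>: "(\<gamma> has_vector_derivative v) (at 0 within {0..})" and \<epsilon>: "\<epsilon> > 0"
    and S: "\<And>t. 0 \<le> t \<Longrightarrow> t < \<epsilon> \<Longrightarrow> \<gamma> t \<in> S"
  shows "tangent_dir S (\<gamma> 0) v"
  unfolding tangent_dir_def
proof (intro allI impI, elim conjE)
  fix W and K :: "'a \<Rightarrow> real"
  assume K: "open W" "\<gamma> 0 \<in> W" "Cinf W K" "\<forall>z\<in>S \<inter> W. K z = 0"
  have "continuous (at 0 within {0..}) \<gamma>" using \<gamma> has_vector_derivative_continuous by blast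
  then have "(\<gamma> \<longlongrightarrow> \<gamma> 0) (at 0 within {0..})" by (simp add: continuous_within)
  then have "\<forall>\<^sub>F t in at 0 within {0..}. \<gamma> t \<in> W" using K topological_tendstoD by blast
  then obtain d where d: "d > 0" "\<And>t. t \<ge> 0 \<Longrightarrow> t \<noteq> 0 \<Longrightarrow> dist t 0 < d \<Longrightarrow> \<gamma> t \<in> W"
    unfolding eventually_at by auto
  have z: "(K \<circ> \<gamma>) t = 0" if "t \<in> {0..}" "dist t 0 < min d \<epsilon>" for t
  proof -
    have "\<gamma> t \<in> W" using d(2)[of t] that K by (cases "t = 0") auto
    moreover have "\<gamma> t \<in> S" using S that by auto
    ultimately show ?thesis using K by simp
  qed
  have "((K \<circ> \<gamma>) has_vector_derivative Df K (\<gamma> 0) v) (at 0 within {0..})"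
    by (rule vector_derivative_diff_chain_within[OF \<gamma>])
      (use Cinf_has_derivative[OF K(3,2)] in \<open>auto intro: has_derivative_at_withinI\<close>)
  moreover have "((K \<circ> \<gamma>) has_vector_derivative 0) (at 0 within {0..})"
    by (rule has_vector_derivative_transform_within[of "\<lambda>t. 0" _ _ _ "min d \<epsilon>"]) (use z d \<epsilon> in auto)
  moreover have "at (0::real) within {0..} \<noteq> bot" by (simp add: trivial_limit_at_right_real at_within_Ici_at_right)
  ultimately show "Df K (\<gamma> 0) v = 0" by (rule vector_derivative_unique_within[rotated])
qed

lemma tangent_dir_ray:
  assumes "\<epsilon> > 0" "\<And>t. 0 \<le> t \<Longrightarrow> t < \<epsilon> \<Longrightarrow> y + t *\<^sub>R v \<in> S"
  shows "tangent_dir S y v"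
proof -
  have "((\<lambda>t. y + t *\<^sub>R v) has_vector_derivative v) (at 0 within {0..})"
    by (auto intro!: derivative_eq_intros)
  from tangent_dir_curve[OF this assms] show ?thesis by simp
qed

lemma ray_in_open:
  fixes y v :: "'e::real_normed_vector"
  assumes "open O'" "y \<in> O'"
  obtains \<epsilon> where "\<epsilon> > 0" "\<And>t. \<bar>t\<bar> < \<epsilon> \<Longrightarrow> y + t *\<^sub>R v \<in> O'"
proof -
  have "open ((\<lambda>t. y + t *\<^sub>R v) -` O')"
    by (rule continuous_open_vimage[OF assms(1)]) (auto intro!: continuous_intros)
  moreover have "0 \<in> (\<lambda>t. y + t *\<^sub>R v) -` O'" using assms by simp
  ultimately obtain \<epsilon> where "\<epsilon> > 0" "ball 0 \<epsilon> \<subseteq> (\<lambda>t. y + t *\<^sub>R v) -` O'" using openE by blast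
  then show ?thesis by (intro that[of \<epsilon>]) auto
qed

text \<open>Vectors pointing into the half-space are velocities of rays inside \<open>S\<close>. For
  the others the opposite vector points inwards, and tangent directions are closed under
  scaling.\<close>

lemma tangent_dir_half_space:
  assumes E: "subspace E" and S: "openin (top_of_set (half_space E u)) S" and y: "y \<in> S" and v: "v \<in> E"
  shows "tangent_dir S y v"
proof -
  obtain O' where O': "open O'" "S = half_space E u \<inter> O'" using S unfolding openin_open by blast
  have *: "tangent_dir S y v" if v: "v \<in> E" "u \<bullet> v \<ge> 0" for v
  proof -
    obtain \<epsilon> where e: "\<epsilon> > 0" "\<And>t. \<bar>t\<bar> < \<epsilon> \<Longrightarrow> y + t *\<^sub>R v \<in> O'" using ray_in_open[of O' y v] O' y by auto
    show ?thesis
    proof (rule tangent_dir_ray[OF e(1)])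
      fix t :: real assume t: "0 \<le> t" "t < \<epsilon>"
      have "y \<in> E" "0 \<le> u \<bullet> y" using y O' by (auto simp: half_space_def)
      then have "y + t *\<^sub>R v \<in> half_space E u"
        using t v E by (auto simp: half_space_def inner_add_right intro: subspace_add subspace_scale)
      then show "y + t *\<^sub>R v \<in> S" using O' e(2)[of t] t by auto
    qed
  qed
  show ?thesis
  proof (cases "u \<bullet> v \<ge> 0")
    case False
    then have "tangent_dir S y (- v)" using * v E subspace_neg by force
    then show ?thesis using tangent_dir_scale[of S y "- v" "-1"] by simp
  qed (use * v in auto)
qed

definition dir_deriv :: "'a set \<Rightarrow> ('a \<Rightarrow> 'e::real_normed_vector) \<Rightarrow> 'a \<Rightarrow> 'e \<Rightarrow> ('a \<Rightarrow> real) \<Rightarrow> real" where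
  "dir_deriv U \<phi> p v g = (THE l. \<exists>W G. local_ext U \<phi> p g W G \<and> l = Df G (\<phi> p) v)"

lemma tangent_dir_Df_unique:
  fixes \<phi> :: "'a \<Rightarrow> 'e::real_normed_vector" and G H :: "'e \<Rightarrow> real"
  assumes v: "tangent_dir (\<phi> ` U) (\<phi> p) v" and G: "local_ext U \<phi> p g W G" and H: "local_ext U \<phi> p g W' H"
  shows "Df G (\<phi> p) v = Df H (\<phi> p) v"
proof -
  have "Df (\<lambda>y. G y - H y) (\<phi> p) v = 0"
    by (rule tangent_dirD[OF v, of "W \<inter> W'"])
      (use G H in \<open>auto simp: local_ext_def intro!: Cinf_minus intro: Cinf_subset\<close>)
  moreover have "Df (\<lambda>y. G y - H y) (\<phi> p) v = Df G (\<phi> p) v - Df H (\<phi> p) v"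
    by (rule Df_eqI) (use G H in \<open>auto simp: local_ext_def intro!: has_derivative_diff Cinf_has_derivative\<close>)
  ultimately show ?thesis by simp
qed

lemma dir_deriv_eq:
  assumes "tangent_dir (\<phi> ` U) (\<phi> p) v" "local_ext U \<phi> p g W G"
  shows "dir_deriv U \<phi> p v g = Df G (\<phi> p) v"
  unfolding dir_deriv_def
proof (rule the_equality)
  show "\<exists>W' G'. local_ext U \<phi> p g W' G' \<and> Df G (\<phi> p) v = Df G' (\<phi> p) v" using assms(2) by blast
next
  fix l assume "\<exists>W' G'. local_ext U \<phi> p g W' G' \<and> l = Df G' (\<phi> p) v"
  then show "l = Df G (\<phi> p) v" using tangent_dir_Df_unique[OF assms(1) _ assms(2)] by blast
qed

lemma dir_deriv_lincomb:
  assumes v: "tangent_dir (\<phi> ` U) (\<phi> p) v" and p: "p \<in> U" and "smooth_near U \<phi> p g" "smooth_near U \<phi> p h"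
  shows "dir_deriv U \<phi> p v (\<lambda>x. a * g x + b * h x) = a * dir_deriv U \<phi> p v g + b * dir_deriv U \<phi> p v h"
proof -
  obtain W G W' H where G: "local_ext U \<phi> p g W G" and H: "local_ext U \<phi> p h W' H"
    using assms unfolding smooth_near_def by blast
  have "local_ext U \<phi> p (\<lambda>x. a * g x + b * h x) (W \<inter> W') (\<lambda>y. a * G y + b * H y)"
    using G H unfolding local_ext_def by (auto intro!: Cinf_add Cinf_mult Cinf_const intro: Cinf_subset)
  from dir_deriv_eq[OF v this]
  have "dir_deriv U \<phi> p v (\<lambda>x. a * g x + b * h x) = Df (\<lambda>y. a * G y + b * H y) (\<phi> p) v" .
  also have "\<dots> = a * Df G (\<phi> p) v + b * Df H (\<phi> p) v"
    by (rule Df_eqI) (use G H in \<open>auto simp: local_ext_def intro!: derivative_intros Cinf_has_derivative\<close>)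
  finally show ?thesis using dir_deriv_eq[OF v G] dir_deriv_eq[OF v H] by simp
qed

lemma dir_deriv_mult:
  assumes v: "tangent_dir (\<phi> ` U) (\<phi> p) v" and p: "p \<in> U" and "smooth_near U \<phi> p g" "smooth_near U \<phi> p h"
  shows "dir_deriv U \<phi> p v (\<lambda>x. g x * h x) = dir_deriv U \<phi> p v g * h p + g p * dir_deriv U \<phi> p v h"
proof -
  obtain W G W' H where G: "local_ext U \<phi> p g W G" and H: "local_ext U \<phi> p h W' H"
    using assms unfolding smooth_near_def by blast
  have "local_ext U \<phi> p (\<lambda>x. g x * h x) (W \<inter> W') (\<lambda>y. G y * H y)"
    using G H unfolding local_ext_def by (auto intro!: Cinf_mult intro: Cinf_subset)
  from dir_deriv_eq[OF v this]
  have "dir_deriv U \<phi> p v (\<lambda>x. g x * h x) = Df (\<lambda>y. G y * H y) (\<phi> p) v" .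
  also have "\<dots> = G (\<phi> p) * Df H (\<phi> p) v + Df G (\<phi> p) v * H (\<phi> p)"
    by (rule Df_eqI) (use G H in \<open>auto simp: local_ext_def intro!: has_derivative_mult Cinf_has_derivative\<close>)
  finally show ?thesis using dir_deriv_eq[OF v G] dir_deriv_eq[OF v H] G H p by (simp add: local_ext_def)
qed

section \<open>Charted spaces\<close>

text \<open>Less than a manifold: images of charts and transition maps are unrestricted. This much
  is inherited by \<open>induced\<close> and \<open>prod_charted\<close>, so that one local
  criterion for smooth functions covers the interior, the boundary, the reduced space and products
  with \<open>\<complex>\<close>.\<close>

definition good_charts :: "('a, 'e::euclidean_space) charted \<Rightarrow> bool" where
  "good_charts P \<longleftrightarrow>
     (\<forall>(U, \<phi>)\<in>charts P. openin (mtop P) U \<and> inj_on \<phi> U \<and> continuous_map (subtopology (mtop P) U) euclidean \<phi>) \<and>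
     topspace (mtop P) = (\<Union>(U, \<phi>)\<in>charts P. U)"

lemma smooth_on_inv_into_iff:
  assumes "inj_on \<phi> U"
  shows "smooth_on (\<phi> ` U) (\<lambda>y. g (inv_into U \<phi> y)) \<longleftrightarrow> (\<forall>x\<in>U. smooth_near U \<phi> x g)"
proof -
  have "smooth_on (\<phi> ` U) (\<lambda>y. g (inv_into U \<phi> y)) \<longleftrightarrow>
    (\<forall>x\<in>U. \<exists>W G. open W \<and> \<phi> x \<in> W \<and> Cinf W G \<and> (\<forall>y\<in>\<phi> ` U \<inter> W. G y = g (inv_into U \<phi> y)))"
    unfolding smooth_on_def Cinf_def by simp
  also have "\<dots> \<longleftrightarrow> (\<forall>x\<in>U. smooth_near U \<phi> x g)"
    unfolding smooth_near_def local_ext_def using assms by (auto intro!: ball_cong ex_cong conj_cong simp: inv_into_f_f)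
  finally show ?thesis .
qed

text \<open>Disposes of the continuity clause in \<open>smooth_map\<close>, so that smoothness
  becomes a condition at single points.\<close>

lemma smooth_near_imp_continuous_map:
  fixes g :: "'a \<Rightarrow> 'b::euclidean_space"
  assumes P: "good_charts P" and g: "\<And>U \<phi> x. (U, \<phi>) \<in> charts P \<Longrightarrow> x \<in> U \<Longrightarrow> smooth_near U \<phi> x g"
  shows "continuous_map (mtop P) euclidean g"
  unfolding continuous_map_atin
proof
  fix x assume x: "x \<in> topspace (mtop P)"
  then obtain U \<phi> where U: "(U, \<phi>) \<in> charts P" "x \<in> U" using P unfolding good_charts_def by auto
  then have oU: "openin (mtop P) U" and c: "continuous_map (subtopology (mtop P) U) euclidean \<phi>"
    using P unfolding good_charts_def by auto
  obtain W G where G: "local_ext U \<phi> x g W G" using g U by (blast elim: smooth_nearE)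
  show "limitin euclidean g (g x) (atin (mtop P) x)"
    unfolding limitin_def
  proof (intro conjI allI impI)
    fix V assume V: "openin euclidean V \<and> g x \<in> V"
    let ?O = "W \<inter> G -` V"
    have "open ?O" using G V by (auto simp: local_ext_def intro!: open_Int_vimage_Cinf)
    then have "openin (subtopology (mtop P) U) {y \<in> topspace (subtopology (mtop P) U). \<phi> y \<in> ?O}"
      using c unfolding continuous_map_def by (metis open_openin)
    then have "openin (mtop P) {y \<in> topspace (subtopology (mtop P) U). \<phi> y \<in> ?O}"
      using oU openin_trans_full by blast
    moreover have "x \<in> {y \<in> topspace (subtopology (mtop P) U). \<phi> y \<in> ?O}"
      using G U V x by (auto simp: local_ext_def)
    moreover have "\<forall>y\<in>{y \<in> topspace (subtopology (mtop P) U). \<phi> y \<in> ?O}. g y \<in> V"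
      using G by (auto simp: local_ext_def)
    ultimately show "\<forall>\<^sub>F y in atin (mtop P) x. g y \<in> V"
      unfolding eventually_atin by blast
  qed auto
qed

lemma smooth_functions_iff:
  assumes P: "good_charts P"
  shows "g \<in> smooth_functions P \<longleftrightarrow> (\<forall>(U, \<phi>)\<in>charts P. \<forall>x\<in>U. smooth_near U \<phi> x g)"
proof -
  have "g \<in> smooth_functions P \<longleftrightarrow> continuous_map (mtop P) euclidean g \<and>
    (\<forall>(U, \<phi>)\<in>charts P. smooth_on (\<phi> ` U) (\<lambda>y. g (inv_into U \<phi> y)))"
    unfolding smooth_functions_def smooth_map_def euclid_def by simp
  also have "\<dots> \<longleftrightarrow> continuous_map (mtop P) euclidean g \<and> (\<forall>(U, \<phi>)\<in>charts P. \<forall>x\<in>U. smooth_near U \<phi> x g)"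
    using P smooth_on_inv_into_iff unfolding good_charts_def by fastforce
  also have "\<dots> \<longleftrightarrow> (\<forall>(U, \<phi>)\<in>charts P. \<forall>x\<in>U. smooth_near U \<phi> x g)"
    using smooth_near_imp_continuous_map[OF P, of g] by blast
  finally show ?thesis .
qed

lemma smooth_functionsD:
  "good_charts P \<Longrightarrow> g \<in> smooth_functions P \<Longrightarrow> (U, \<phi>) \<in> charts P \<Longrightarrow> x \<in> U \<Longrightarrow> smooth_near U \<phi> x g"
  using smooth_functions_iff by blast

lemma smooth_functionsI:
  "good_charts P \<Longrightarrow> (\<And>U \<phi> x. (U, \<phi>) \<in> charts P \<Longrightarrow> x \<in> U \<Longrightarrow> smooth_near U \<phi> x g) \<Longrightarrow> g \<in> smooth_functions P"
  using smooth_functions_iff by blast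

lemma good_charts_topspace: "good_charts P \<Longrightarrow> (U, \<phi>) \<in> charts P \<Longrightarrow> x \<in> U \<Longrightarrow> x \<in> topspace (mtop P)"
  unfolding good_charts_def by auto

lemma smooth_functions_continuous:
  "g \<in> smooth_functions P \<Longrightarrow> continuous_map (mtop P) euclidean g"
  unfolding smooth_functions_def smooth_map_def euclid_def by simp

lemma smooth_functions_cong:
  assumes "good_charts P" "g \<in> smooth_functions P" "\<And>x. x \<in> topspace (mtop P) \<Longrightarrow> g x = h x"
  shows "h \<in> smooth_functions P"
  by (rule smooth_functionsI[OF assms(1)], rule smooth_near_cong[OF smooth_functionsD[OF assms(1,2)]])
    (use assms good_charts_topspace in metis)+

lemma smooth_functions_const: "good_charts P \<Longrightarrow> (\<lambda>x. c) \<in> smooth_functions P"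
  by (auto intro!: smooth_functionsI smooth_near_const)

lemma smooth_functions_mult:
  "good_charts P \<Longrightarrow> g \<in> smooth_functions P \<Longrightarrow> h \<in> smooth_functions P \<Longrightarrow> (\<lambda>x. g x * h x) \<in> smooth_functions P"
  by (auto intro!: smooth_functionsI smooth_near_mult intro: smooth_functionsD)

lemma smooth_functions_lincomb:
  "good_charts P \<Longrightarrow> g \<in> smooth_functions P \<Longrightarrow> h \<in> smooth_functions P \<Longrightarrow> (\<lambda>x. a * g x + b * h x) \<in> smooth_functions P"
  by (auto intro!: smooth_functionsI smooth_near_add smooth_near_mult smooth_near_const intro: smooth_functionsD)

lemma smooth_functions_sum:
  assumes "good_charts P"
  shows "(\<And>i. i \<in> A \<Longrightarrow> g i \<in> smooth_functions P) \<Longrightarrow> (\<lambda>x. \<Sum>i\<in>A. g i x) \<in> smooth_functions P"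
proof (induction A rule: infinite_finite_induct)
  case (insert i A)
  then show ?case using smooth_functions_lincomb[OF assms, of "g i" "\<lambda>x. \<Sum>i\<in>A. g i x" 1 1] by simp
qed (simp_all add: smooth_functions_const assms)

lemma good_charts_induced:
  assumes "good_charts P"
  shows "good_charts (induced P S)"
proof -
  have "openin (subtopology (mtop P) S) (U \<inter> S)" "inj_on \<phi> (U \<inter> S)"
    "continuous_map (subtopology (subtopology (mtop P) S) (U \<inter> S)) euclidean \<phi>"
    if "(U, \<phi>) \<in> charts P" for U \<phi>
  proof -
    have U: "openin (mtop P) U" "inj_on \<phi> U" "continuous_map (subtopology (mtop P) U) euclidean \<phi>"
      using assms that by (auto simp: good_charts_def)
    show "openin (subtopology (mtop P) S) (U \<inter> S)" using U(1) by (auto simp: openin_subtopology)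
    show "inj_on \<phi> (U \<inter> S)" using U(2) by (auto intro: inj_on_subset)
    have "subtopology (subtopology (mtop P) S) (U \<inter> S) = subtopology (subtopology (mtop P) U) S"
      by (simp add: subtopology_subtopology Int_commute Int_assoc)
    then show "continuous_map (subtopology (subtopology (mtop P) S) (U \<inter> S)) euclidean \<phi>"
      using U(3) continuous_map_from_subtopology by metis
  qed
  moreover have "topspace (mtop P) \<inter> S = (\<Union>(U, \<phi>)\<in>charts P. U \<inter> S)"
    using assms unfolding good_charts_def by auto
  ultimately show ?thesis
    unfolding good_charts_def induced_def by auto
qed

lemma charts_induced: "(V, \<phi>) \<in> charts (induced P S) \<longleftrightarrow> (\<exists>U. V = U \<inter> S \<and> (U, \<phi>) \<in> charts P)"
  by (auto simp: induced_def)

lemma topspace_induced: "topspace (mtop (induced P S)) = topspace (mtop P) \<inter> S"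
  by (simp add: induced_def)

lemma smooth_functions_induced:
  assumes P: "good_charts P" and g: "g \<in> smooth_functions P"
  shows "g \<in> smooth_functions (induced P S)"
proof (rule smooth_functionsI[OF good_charts_induced[OF P]])
  fix V \<phi> x assume "(V, \<phi>) \<in> charts (induced P S)" "x \<in> V"
  then obtain U where U: "V = U \<inter> S" "(U, \<phi>) \<in> charts P" "x \<in> U" by (auto simp: charts_induced)
  show "smooth_near V \<phi> x g"
    by (rule smooth_near_mono[OF smooth_functionsD[OF P g U(2,3)], of UNIV]) (auto simp: U)
qed

section \<open>Tangent vectors\<close>

lemma tangent_lincomb:
  "X \<in> tangent_space P p \<Longrightarrow> g \<in> smooth_functions P \<Longrightarrow> h \<in> smooth_functions P \<Longrightarrow>
    X (\<lambda>x. a * g x + b * h x) = a * X g + b * X h"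
  and tangent_mult: "X \<in> tangent_space P p \<Longrightarrow> g \<in> smooth_functions P \<Longrightarrow> h \<in> smooth_functions P \<Longrightarrow>
    X (\<lambda>x. g x * h x) = X g * h p + g p * X h"
  and tangent_nonsmooth: "X \<in> tangent_space P p \<Longrightarrow> g \<notin> smooth_functions P \<Longrightarrow> X g = 0"
  unfolding tangent_space_def by blast+

lemma tangent_const:
  assumes P: "good_charts P" and X: "X \<in> tangent_space P p"
  shows "X (\<lambda>x. c) = 0"
proof -
  note c = smooth_functions_const[OF P]
  have "X (\<lambda>x. 1 * 1) = X (\<lambda>x. 1) * 1 + 1 * X (\<lambda>x. 1)" by (rule tangent_mult[OF X c c])
  then have "X (\<lambda>x. 1) = 0" by simp
  then show ?thesis using tangent_lincomb[OF X c c, of c 1 0 1] by simp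
qed

lemma tangent_sum:
  assumes P: "good_charts P" and X: "X \<in> tangent_space P p"
  shows "(\<And>i. i \<in> A \<Longrightarrow> g i \<in> smooth_functions P) \<Longrightarrow> X (\<lambda>x. \<Sum>i\<in>A. g i x) = (\<Sum>i\<in>A. X (g i))"
proof (induction A rule: infinite_finite_induct)
  case (insert i A)
  then show ?case
    using tangent_lincomb[OF X, of "g i" "\<lambda>x. \<Sum>i\<in>A. g i x" 1 1] smooth_functions_sum[OF P, of A g] by simp
qed (simp_all add: tangent_const[OF P X])

lemma tangent_local:
  assumes P: "good_charts P" and X: "X \<in> tangent_space P p"
    and g: "g \<in> smooth_functions P" and h: "h \<in> smooth_functions P" and r: "r \<in> smooth_functions P"
    and p: "r p = 1" "p \<in> topspace (mtop P)"
    and eq: "\<And>x. x \<in> topspace (mtop P) \<Longrightarrow> r x \<noteq> 0 \<Longrightarrow> g x = h x"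
  shows "X g = X h"
proof -
  \<comment> \<open>Functions are arbitrary outside the carrier, but \<open>X\<close> acts on
    functions of the whole type. Cutting \<open>r\<close> down to the carrier makes the product
    below vanish identically.\<close>
  define r' where "r' = (\<lambda>x. if x \<in> topspace (mtop P) then r x else 0)"
  have r': "r' \<in> smooth_functions P" by (rule smooth_functions_cong[OF P r]) (simp add: r'_def)
  define d where "d = (\<lambda>x. 1 * g x + (-1) * h x)"
  have d: "d \<in> smooth_functions P" unfolding d_def by (rule smooth_functions_lincomb[OF P g h])
  have "(\<lambda>x. r' x * d x) = (\<lambda>x. 0)" using eq by (auto simp: r'_def d_def fun_eq_iff)
  then have "X r' * d p + r' p * X d = 0"
    using tangent_mult[OF X r' d] tangent_const[OF P X, of 0] by simp
  moreover have "r' p = 1" "d p = 0" using p eq[of p] by (auto simp: r'_def d_def)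
  ultimately have "X d = 0" by simp
  moreover have "X d = 1 * X g + (-1) * X h" unfolding d_def by (rule tangent_lincomb[OF X g h])
  ultimately show ?thesis by simp
qed

lemma tangent_space_lincomb:
  assumes "good_charts P" "X \<in> tangent_space P p" "Y \<in> tangent_space P p"
  shows "(\<lambda>g. a * X g + b * Y g) \<in> tangent_space P p"
  using assms unfolding tangent_space_def by (auto simp: algebra_simps)

lemma tangent_space_zero: "(\<lambda>g. 0) \<in> tangent_space P p"
  unfolding tangent_space_def by auto

lemma push_forward_incl:
  assumes P: "good_charts P" and X: "X \<in> tangent_space (induced P S) p"
  shows "push_forward P (\<lambda>x. x) X \<in> tangent_space P p"
proof -
  note [simp] = smooth_functions_induced[OF P] smooth_functions_lincomb[OF P] smooth_functions_mult[OF P]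
    tangent_lincomb[OF X] tangent_mult[OF X]
  show ?thesis
    unfolding tangent_space_def push_forward_def by auto
qed

text \<open>The coordinates \<open>\<Psi>\<close> on \<open>U\<close> need not be injective, as \<open>dir_deriv\<close> only refers to local extensions.\<close>

definition coord_vec ::
  "('b, 'f::euclidean_space) charted \<Rightarrow> 'a set \<Rightarrow> ('a \<Rightarrow> 'e::real_normed_vector) \<Rightarrow> ('a \<Rightarrow> 'b) \<Rightarrow> 'a \<Rightarrow> 'e \<Rightarrow> 'b tvec" where
  "coord_vec N U \<Psi> F p v = (\<lambda>h. if h \<in> smooth_functions N then dir_deriv U \<Psi> p v (\<lambda>x. h (F x)) else 0)"

lemma coord_vec_tangent:
  assumes N: "good_charts N" and v: "tangent_dir (\<Psi> ` U) (\<Psi> p) v" and p: "p \<in> U"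
    and F: "\<And>h. h \<in> smooth_functions N \<Longrightarrow> smooth_near U \<Psi> p (\<lambda>x. h (F x))"
  shows "coord_vec N U \<Psi> F p v \<in> tangent_space N (F p)"
  using smooth_functions_lincomb[OF N] smooth_functions_mult[OF N] dir_deriv_lincomb[OF v p F F] dir_deriv_mult[OF v p F F]
  unfolding tangent_space_def coord_vec_def by auto

lemma coord_vec_eq:
  assumes "tangent_dir (\<Psi> ` U) (\<Psi> p) v" "h \<in> smooth_functions N" "local_ext U \<Psi> p (\<lambda>x. h (F x)) W G"
  shows "coord_vec N U \<Psi> F p v h = Df G (\<Psi> p) v"
  using dir_deriv_eq[OF assms(1,3)] assms(2) by (simp add: coord_vec_def)

lemma coord_vec_chart_tangent:
  assumes "good_charts N" "tangent_dir (\<phi> ` U) (\<phi> p) v" "p \<in> U" "(U, \<phi>) \<in> charts N"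
  shows "coord_vec N U \<phi> (\<lambda>x. x) p v \<in> tangent_space N p"
  using coord_vec_tangent[OF assms(1-3), where F = "\<lambda>x. x"] smooth_functionsD[OF assms(1) _ assms(4,3)] by simp

lemma push_forward_coord_vec_incl:
  assumes P: "good_charts P" and U: "(U, \<phi>) \<in> charts P" "p \<in> U" and v: "tangent_dir (\<phi> ` (U \<inter> S)) (\<phi> p) v"
  shows "push_forward P (\<lambda>x. x) (coord_vec (induced P S) (U \<inter> S) \<phi> (\<lambda>x. x) p v) = coord_vec P U \<phi> (\<lambda>x. x) p v"
proof
  fix g
  show "push_forward P (\<lambda>x. x) (coord_vec (induced P S) (U \<inter> S) \<phi> (\<lambda>x. x) p v) g = coord_vec P U \<phi> (\<lambda>x. x) p v g"
  proof (cases "g \<in> smooth_functions P")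
    case True
    obtain W G where G: "local_ext U \<phi> p g W G" using smooth_functionsD[OF P True U] by (blast elim: smooth_nearE)
    have G': "local_ext (U \<inter> S) \<phi> p g W G" using G by (auto simp: local_ext_def)
    have v': "tangent_dir (\<phi> ` U) (\<phi> p) v" using tangent_dir_mono[OF v] by blast
    show ?thesis
      using coord_vec_eq[OF v' True, where F = "\<lambda>x. x", OF G]
        coord_vec_eq[OF v smooth_functions_induced[OF P True], where F = "\<lambda>x. x", OF G'] True
      by (simp add: push_forward_def)
  qed (simp add: push_forward_def coord_vec_def)
qed

section \<open>Manifolds with boundary\<close>

lemma orthonormal_expansion:
  fixes E :: "'e::euclidean_space set"
  assumes "subspace E"
  obtains B where "finite B" "B \<subseteq> E" "\<And>y. y \<in> E \<Longrightarrow> y = (\<Sum>b\<in>B. (y \<bullet> b) *\<^sub>R b)"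
    "\<And>b c. b \<in> B \<Longrightarrow> c \<in> B \<Longrightarrow> b \<bullet> c = (if b = c then 1 else 0)"
proof -
  obtain B where B: "B \<subseteq> E" "pairwise orthogonal B" "\<And>x. x \<in> B \<Longrightarrow> norm x = 1"
    "independent B" "span B = E"
    using orthonormal_basis_subspace[OF assms] by metis
  have fin: "finite B" using B(4) by (rule independent_imp_finite)
  have on: "b \<bullet> c = (if b = c then 1 else 0)" if "b \<in> B" "c \<in> B" for b c
    using B(2,3) that by (auto simp: pairwise_def orthogonal_def norm_eq_1)
  have "y = (\<Sum>b\<in>B. (y \<bullet> b) *\<^sub>R b)" if "y \<in> E" for y
  proof -
    from that B(5) have "y \<in> span B" by simp
    then obtain c where y: "y = (\<Sum>b\<in>B. c b *\<^sub>R b)"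
      unfolding span_finite[OF fin] by auto
    have "y \<bullet> b = c b" if b: "b \<in> B" for b
    proof -
      have "y \<bullet> b = (\<Sum>b'\<in>B. c b' * (b' \<bullet> b))" unfolding y by (simp add: inner_sum_left)
      also have "\<dots> = (\<Sum>b'\<in>B. if b' = b then c b' else 0)"
        by (rule sum.cong) (use on b in auto)
      finally show ?thesis using fin b by simp
    qed
    then show ?thesis using y by simp
  qed
  with fin B(1) on that show ?thesis by blast
qed

lemma smooth_on_cong: "smooth_on S f \<Longrightarrow> (\<And>y. y \<in> S \<Longrightarrow> f y = g y) \<Longrightarrow> smooth_on S g"
  unfolding smooth_on_def by (metis IntD1)

definition smooth_at :: "('a, 'e::euclidean_space) charted \<Rightarrow> 'a \<Rightarrow> ('a \<Rightarrow> 'b::euclidean_space) \<Rightarrow> bool" where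
  "smooth_at M p g \<longleftrightarrow> (\<exists>(U, \<phi>)\<in>charts M. p \<in> U \<and> smooth_near U \<phi> p g)"

text \<open>Compactness of \<open>K\<close> has two uses: in a Hausdorff space \<open>K\<close> is
  closed, so products with \<open>\<rho>\<close> extend smoothly by 0; and the union of the orbits
  through \<open>K\<close> is closed as well.\<close>

definition bump_on :: "('a, 'e::euclidean_space) charted \<Rightarrow> 'a \<Rightarrow> 'a set \<Rightarrow> ('a \<Rightarrow> real) \<Rightarrow> 'a set \<Rightarrow> 'a set \<Rightarrow> bool" where
  "bump_on M p S \<rho> S' K \<longleftrightarrow>
     \<rho> \<in> smooth_functions M \<and> (\<forall>x. 0 \<le> \<rho> x) \<and> openin (mtop M) S' \<and> p \<in> S' \<and> S' \<subseteq> S \<and>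
     (\<forall>x\<in>S'. \<rho> x = 1) \<and> compactin (mtop M) K \<and> K \<subseteq> S \<and> (\<forall>x. x \<notin> K \<longrightarrow> \<rho> x = 0)"

lemma bump_onD:
  assumes "bump_on M p S \<rho> S' K"
  shows "\<rho> \<in> smooth_functions M" "\<And>x. 0 \<le> \<rho> x" "openin (mtop M) S'" "p \<in> S'" "S' \<subseteq> S"
    "\<And>x. x \<in> S' \<Longrightarrow> \<rho> x = 1" "compactin (mtop M) K" "K \<subseteq> S" "\<And>x. x \<notin> K \<Longrightarrow> \<rho> x = 0"
  using assms by (auto simp: bump_on_def)

locale mfd =
  fixes E :: "'e::euclidean_space set" and u :: 'e and M :: "('a, 'e) charted"
  assumes mwb: "manifold_with_boundary E u M"
begin

lemma subspace_E: "subspace E" and u_E: "u \<in> E" and Hausdorff: "Hausdorff_space (mtop M)"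
  using mwb by (auto simp: manifold_with_boundary_def)

lemma chart_openin: "(U, \<phi>) \<in> charts M \<Longrightarrow> openin (mtop M) U"
  and chart_image: "(U, \<phi>) \<in> charts M \<Longrightarrow> openin (top_of_set (half_space E u)) (\<phi> ` U)"
  and chart_homeo: "(U, \<phi>) \<in> charts M \<Longrightarrow> homeomorphic_map (subtopology (mtop M) U) (top_of_set (\<phi> ` U)) \<phi>"
  using mwb by (auto simp: manifold_with_boundary_def)

lemma chart_sub: "(U, \<phi>) \<in> charts M \<Longrightarrow> U \<subseteq> topspace (mtop M)"
  using chart_openin openin_subset by blast

lemma chart_inj: "(U, \<phi>) \<in> charts M \<Longrightarrow> inj_on \<phi> U"
  using chart_homeo[of U \<phi>] chart_sub[of U \<phi>]
  by (simp add: homeomorphic_eq_everything_map Int_absorb1)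

lemma chart_cont: "(U, \<phi>) \<in> charts M \<Longrightarrow> continuous_map (subtopology (mtop M) U) euclidean \<phi>"
  using homeomorphic_imp_continuous_map[OF chart_homeo] continuous_map_in_subtopology by blast

lemma good: "good_charts M"
  unfolding good_charts_def using chart_openin chart_inj chart_cont mwb
  by (auto simp: manifold_with_boundary_def)

lemma chart_ex: "p \<in> topspace (mtop M) \<Longrightarrow> \<exists>U \<phi>. (U, \<phi>) \<in> charts M \<and> p \<in> U"
  using good unfolding good_charts_def by auto

lemma chart_half_space: "(U, \<phi>) \<in> charts M \<Longrightarrow> x \<in> U \<Longrightarrow> \<phi> x \<in> half_space E u"
  using chart_image openin_subset by fastforce

lemma chart_E: "(U, \<phi>) \<in> charts M \<Longrightarrow> x \<in> U \<Longrightarrow> \<phi> x \<in> E"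
  using chart_half_space by (auto simp: half_space_def)

lemma chart_open_image:
  assumes "(U, \<phi>) \<in> charts M" "openin (mtop M) S"
  obtains \<Omega> where "open \<Omega>" "\<And>x. x \<in> U \<Longrightarrow> \<phi> x \<in> \<Omega> \<longleftrightarrow> x \<in> S"
proof -
  have "openin (subtopology (mtop M) U) (U \<inter> S)" using assms(2) by (auto simp: openin_subtopology)
  then have "openin (top_of_set (\<phi> ` U)) (\<phi> ` (U \<inter> S))"
    using homeomorphic_imp_open_map[OF chart_homeo[OF assms(1)]] unfolding open_map_def by blast
  then obtain \<Omega> where "open \<Omega>" and \<Omega>: "\<phi> ` (U \<inter> S) = \<phi> ` U \<inter> \<Omega>" unfolding openin_open by blast
  moreover have "\<phi> x \<in> \<Omega> \<longleftrightarrow> x \<in> S" if "x \<in> U" for x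
  proof -
    have "\<phi> x \<in> \<Omega> \<longleftrightarrow> \<phi> x \<in> \<phi> ` (U \<inter> S)" using \<Omega> that by blast
    also have "\<dots> \<longleftrightarrow> x \<in> S" using chart_inj[OF assms(1)] that by (auto simp: inj_on_def)
    finally show ?thesis .
  qed
  ultimately show ?thesis using that by blast
qed

lemma chart_vimage: 
  assumes "(U, \<phi>) \<in> charts M" "open \<Omega>"
  shows "openin (mtop M) {x \<in> U. \<phi> x \<in> \<Omega>}"
proof -
  have "openin (subtopology (mtop M) U) {x \<in> topspace (subtopology (mtop M) U). \<phi> x \<in> \<Omega>}"
    using chart_cont[OF assms(1)] assms(2) unfolding continuous_map_def by (metis open_openin)
  then have "openin (mtop M) {x \<in> topspace (subtopology (mtop M) U). \<phi> x \<in> \<Omega>}"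
    using chart_openin[OF assms(1)] openin_trans_full by blast
  moreover have "{x \<in> topspace (subtopology (mtop M) U). \<phi> x \<in> \<Omega>} = {x \<in> U. \<phi> x \<in> \<Omega>}"
    using chart_sub[OF assms(1)] by auto
  ultimately show ?thesis by simp
qed

lemma chart_image_open:
  assumes "(U, \<phi>) \<in> charts M" "openin (mtop M) S"
  shows "openin (top_of_set (half_space E u)) (\<phi> ` (U \<inter> S))"
proof -
  obtain \<Omega> where \<Omega>: "open \<Omega>" "\<And>x. x \<in> U \<Longrightarrow> \<phi> x \<in> \<Omega> \<longleftrightarrow> x \<in> S"
    using chart_open_image[OF assms] by blast
  have "\<phi> ` (U \<inter> S) = \<phi> ` U \<inter> \<Omega>" using \<Omega>(2) by auto
  then show ?thesis using \<Omega>(1) chart_image[OF assms(1)] openin_Int_open by metis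
qed

lemma chart_tangent_dir:
  assumes "(U, \<phi>) \<in> charts M" "openin (mtop M) S" "p \<in> U" "p \<in> S" "v \<in> E"
  shows "tangent_dir (\<phi> ` (U \<inter> S)) (\<phi> p) v"
  by (rule tangent_dir_half_space[OF subspace_E chart_image_open[OF assms(1,2)]]) (use assms in auto)

lemma chart_tangent_dir_U:
  assumes "(U, \<phi>) \<in> charts M" "p \<in> U" "v \<in> E"
  shows "tangent_dir (\<phi> ` U) (\<phi> p) v"
  using chart_tangent_dir[OF assms(1) chart_openin[OF assms(1)] assms(2,2,3)] by simp

lemma chart_cball:
  assumes "(U, \<phi>) \<in> charts M" "openin (mtop M) S" "p \<in> U" "p \<in> S"
  obtains r where "r > 0" "\<And>y. y \<in> half_space E u \<Longrightarrow> y \<in> cball (\<phi> p) r \<Longrightarrow> y \<in> \<phi> ` (U \<inter> S)"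
proof -
  obtain O' where O': "open O'" "\<phi> ` (U \<inter> S) = half_space E u \<inter> O'"
    using chart_image_open[OF assms(1,2)] unfolding openin_open by blast
  then have "\<phi> p \<in> O'" using assms by auto
  then obtain r where "r > 0" "cball (\<phi> p) r \<subseteq> O'" using O'(1) open_contains_cball by blast
  then show ?thesis using O'(2) that by blast
qed

lemma smooth_near_chart_change:
  fixes g :: "'a \<Rightarrow> 'b::euclidean_space"
  assumes U: "(U, \<phi>) \<in> charts M" "x \<in> U" and V: "(V, \<psi>) \<in> charts M" "x \<in> V" and g: "smooth_near U \<phi> x g"
  shows "smooth_near V \<psi> x g"
proof -
  obtain W G where G: "local_ext U \<phi> x g W G" using g by (elim smooth_nearE)
  have "smooth_on (\<psi> ` (V \<inter> U)) (\<lambda>y. \<phi> (inv_into V \<psi> y))"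
    using mwb U V unfolding manifold_with_boundary_def by blast
  then have "smooth_on (\<psi> ` (V \<inter> U)) (\<lambda>y. \<phi> (inv_into (V \<inter> U) \<psi> y))"
    by (rule smooth_on_cong) (use chart_inj[OF V(1)] in \<open>auto simp: inv_into_f_f inj_on_Int\<close>)
  then have "smooth_near (V \<inter> U) \<psi> x \<phi>"
    using smooth_on_inv_into_iff[of \<psi> "V \<inter> U" \<phi>] chart_inj[OF V(1)] U V by (auto simp: inj_on_Int)
  obtain W' T where T: "local_ext (V \<inter> U) \<psi> x \<phi> W' T" using \<open>smooth_near (V \<inter> U) \<psi> x \<phi>\<close> by (elim smooth_nearE)
  have c: "local_ext (V \<inter> U) \<psi> x (\<lambda>x. G (\<phi> x)) (W' \<inter> T -` W) (\<lambda>y. G (T y))"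
    by (rule local_ext_compose[OF T]) (use G U V in \<open>auto simp: local_ext_def\<close>)
  obtain \<Omega> where \<Omega>: "open \<Omega>" "\<And>y. y \<in> V \<Longrightarrow> \<psi> y \<in> \<Omega> \<longleftrightarrow> y \<in> U"
    using chart_open_image[OF V(1) chart_openin[OF U(1)]] by blast
  have "local_ext V \<psi> x g (W' \<inter> T -` W \<inter> \<Omega>) (\<lambda>y. G (T y))"
    unfolding local_ext_def
  proof (intro conjI ballI impI)
    show "open (W' \<inter> T -` W \<inter> \<Omega>)" by (intro open_Int local_ext_open[OF c] \<Omega>(1))
    show "\<psi> x \<in> W' \<inter> T -` W \<inter> \<Omega>" using local_ext_mem[OF c] \<Omega>(2)[OF V(2)] U(2) by simp
    show "Cinf (W' \<inter> T -` W \<inter> \<Omega>) (\<lambda>y. G (T y))" by (rule Cinf_subset[OF local_ext_Cinf[OF c]]) auto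
    fix y assume y: "y \<in> V" "\<psi> y \<in> W' \<inter> T -` W \<inter> \<Omega>"
    then have "y \<in> V \<inter> U" using \<Omega>(2) by auto
    then have "T (\<psi> y) = \<phi> y" by (rule local_ext_eq[OF T]) (use y in auto)
    moreover have "\<phi> y \<in> W" using y \<open>T (\<psi> y) = \<phi> y\<close> by auto
    ultimately show "G (T (\<psi> y)) = g y" using local_ext_eq[OF G, of y] \<open>y \<in> V \<inter> U\<close> by simp
  qed
  then show ?thesis by (rule local_ext_smooth_near)
qed

lemma smooth_at_chart:
  assumes "smooth_at M x g" "(U, \<phi>) \<in> charts M" "x \<in> U"
  shows "smooth_near U \<phi> x g"
proof -
  obtain V \<psi> where V: "(V, \<psi>) \<in> charts M" "x \<in> V" "smooth_near V \<psi> x g" using assms(1) unfolding smooth_at_def by blast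
  show ?thesis by (rule smooth_near_chart_change[OF V(1,2) assms(2,3) V(3)])
qed

lemma smooth_atI: "(U, \<phi>) \<in> charts M \<Longrightarrow> x \<in> U \<Longrightarrow> smooth_near U \<phi> x g \<Longrightarrow> smooth_at M x g"
  unfolding smooth_at_def by blast

lemma smooth_iff_smooth_at: "g \<in> smooth_functions M \<longleftrightarrow> (\<forall>x\<in>topspace (mtop M). smooth_at M x g)"
proof
  assume g: "g \<in> smooth_functions M"
  show "\<forall>x\<in>topspace (mtop M). smooth_at M x g"
    using chart_ex smooth_atI[OF _ _ smooth_functionsD[OF good g]] by metis
next
  assume "\<forall>x\<in>topspace (mtop M). smooth_at M x g"
  then show "g \<in> smooth_functions M"
    by (intro smooth_functionsI[OF good]) (rule smooth_at_chart, auto dest: subsetD[OF chart_sub])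
qed

lemma smooth_near_local:
  assumes "(U, \<phi>) \<in> charts M" "x \<in> U" "smooth_near (U \<inter> A) \<phi> x g" "openin (mtop M) S" "x \<in> S"
    "\<And>y. y \<in> S \<Longrightarrow> y \<in> U \<Longrightarrow> y \<in> A' \<Longrightarrow> y \<in> A \<and> h y = g y"
  shows "smooth_near (U \<inter> A') \<phi> x h"
proof -
  obtain \<Omega> where \<Omega>: "open \<Omega>" "\<And>y. y \<in> U \<Longrightarrow> \<phi> y \<in> \<Omega> \<longleftrightarrow> y \<in> S"
    using chart_open_image[OF assms(1,4)] by blast
  show ?thesis
    by (rule smooth_near_mono[OF assms(3) \<Omega>(1)]) (use \<Omega>(2) assms in auto)
qed

lemma smooth_at_local:
  assumes "smooth_at M x g" "openin (mtop M) S" "x \<in> S" "\<And>y. y \<in> S \<Longrightarrow> h y = g y"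
  shows "smooth_at M x h"
proof -
  obtain U \<phi> where U: "(U, \<phi>) \<in> charts M" "x \<in> U" "smooth_near U \<phi> x g" using assms(1) unfolding smooth_at_def by blast
  have "smooth_near (U \<inter> UNIV) \<phi> x h"
    by (rule smooth_near_local[where A = UNIV, OF U(1,2) _ assms(2,3)]) (use U assms in auto)
  then show ?thesis using U smooth_atI by simp
qed

lemma smooth_at_const: "x \<in> topspace (mtop M) \<Longrightarrow> smooth_at M x (\<lambda>x. c)"
  using chart_ex[of x] smooth_atI[OF _ _ smooth_near_const] by metis

lemma smooth_at_compose:
  fixes g :: "'a \<Rightarrow> 'b::euclidean_space"
  assumes "smooth_at M x g" "open S" "Cinf S F" "g x \<in> S"
  shows "smooth_at M x (\<lambda>x. F (g x))"
proof -
  obtain U \<phi> where U: "(U, \<phi>) \<in> charts M" "x \<in> U" "smooth_near U \<phi> x g" using assms(1) unfolding smooth_at_def by blast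
  show ?thesis by (rule smooth_atI[OF U(1,2) smooth_near_compose[OF U(3,2) assms(2-4)]])
qed

lemma smooth_at_bilinear:
  fixes g :: "'a \<Rightarrow> 'b::euclidean_space" and h :: "'a \<Rightarrow> 'c::euclidean_space"
  assumes "bounded_bilinear B" "smooth_at M x g" "smooth_at M x h"
  shows "smooth_at M x (\<lambda>x. B (g x) (h x))"
proof -
  obtain U \<phi> where U: "(U, \<phi>) \<in> charts M" "x \<in> U" "smooth_near U \<phi> x g" using assms(2) unfolding smooth_at_def by blast
  show ?thesis by (rule smooth_atI[OF U(1,2) smooth_near_bilinear[OF assms(1) U(3) smooth_at_chart[OF assms(3) U(1,2)] U(2)]])
qed

lemma smooth_at_mult:
  fixes g h :: "'a \<Rightarrow> 'b::{euclidean_space, real_normed_algebra}"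
  shows "smooth_at M x g \<Longrightarrow> smooth_at M x h \<Longrightarrow> smooth_at M x (\<lambda>x. g x * h x)"
  by (rule smooth_at_bilinear[OF bounded_bilinear_mult])

lemma smooth_at_continuous:
  fixes g :: "'a \<Rightarrow> 'b::euclidean_space"
  assumes "\<And>x. x \<in> topspace (mtop M) \<Longrightarrow> smooth_at M x g"
  shows "continuous_map (mtop M) euclidean g"
  by (rule smooth_near_imp_continuous_map[OF good]) (use assms chart_sub smooth_at_chart in blast)

lemma closed_half_space: "closed (half_space E u)"
proof -
  have "half_space E u = E \<inter> {y. u \<bullet> y \<ge> 0}" by (auto simp: half_space_def)
  then show ?thesis using closed_subspace[OF subspace_E] closed_halfspace_ge[of 0 u] by auto
qed

section \<open>Bump functions, extension of functions and locality of derivations\<close>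

lemma bump:
  assumes S: "openin (mtop M) S" and p: "p \<in> S"
  obtains \<rho> S' K where "bump_on M p S \<rho> S' K"
proof -
  have "p \<in> topspace (mtop M)" using S p openin_subset by blast
  then obtain U \<phi> where U: "(U, \<phi>) \<in> charts M" "p \<in> U" using chart_ex by blast
  obtain r where r: "r > 0" "\<And>y. y \<in> half_space E u \<Longrightarrow> y \<in> cball (\<phi> p) r \<Longrightarrow> y \<in> \<phi> ` (U \<inter> S)"
    using chart_cball[OF U(1) S U(2) p] by blast
  \<comment> \<open>The squared distance keeps \<open>F\<close> smooth at the centre. With the scale
    \<open>r^2\<close>, \<open>F\<close> is 0 from radius \<open>r\<close> on and 1 within radius
    \<open>r / 2\<close>, because (1/2)^2 is at most 1/2.\<close>
  define F where "F = (\<lambda>y. step (((y - \<phi> p) \<bullet> (y - \<phi> p)) * inverse (r^2)))"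
  have F: "Cinf UNIV F" unfolding F_def
    by (rule Cinf_compose[OF Cinf_mult[OF Cinf_inner[OF Cinf_minus[OF Cinf_id Cinf_const] Cinf_minus[OF Cinf_id Cinf_const]] Cinf_const] Cinf_step]) simp
  define \<rho> where "\<rho> = (\<lambda>x. if x \<in> U then F (\<phi> x) else 0)"
  define K where "K = {x \<in> U. \<phi> x \<in> cball (\<phi> p) r}"
  define S' where "S' = {x \<in> U. \<phi> x \<in> ball (\<phi> p) (r / 2)}"
  have KS: "K \<subseteq> S"
  proof
    fix x assume "x \<in> K"
    then have "x \<in> U" "\<phi> x \<in> \<phi> ` (U \<inter> S)" using r(2) chart_half_space[OF U(1)] by (auto simp: K_def)
    then show "x \<in> S" using chart_inj[OF U(1)] by (auto simp: inj_on_def)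
  qed
  have K: "compactin (mtop M) K"
  proof -
    let ?C = "half_space E u \<inter> cball (\<phi> p) r"
    \<comment> \<open>The model half-space is closed, so its part in a closed ball is compact even
      at a boundary point; the inverse of the chart carries it to \<open>K\<close>.\<close>
    have "compact ?C" using closed_half_space by (simp add: closed_Int_compact)
    moreover have sub: "?C \<subseteq> \<phi> ` U" using r(2) by blast
    ultimately have c: "compactin (top_of_set (\<phi> ` U)) ?C" by (simp add: compactin_subtopology)
    obtain \<psi> where \<psi>: "homeomorphic_maps (subtopology (mtop M) U) (top_of_set (\<phi> ` U)) \<phi> \<psi>"
      using chart_homeo[OF U(1)] homeomorphic_map_maps by blast
    have "compactin (subtopology (mtop M) U) (\<psi> ` ?C)"
      using image_compactin[OF c] \<psi> unfolding homeomorphic_maps_def by blast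
    moreover have "\<psi> ` ?C = K"
    proof -
      have inv: "\<psi> (\<phi> x) = x" if "x \<in> U" for x
        using \<psi> that chart_sub[OF U(1)] unfolding homeomorphic_maps_def by auto
      show ?thesis
      proof (intro set_eqI iffI)
        fix x assume "x \<in> \<psi> ` ?C"
        then obtain y where y: "y \<in> ?C" "x = \<psi> y" by blast
        then obtain z where "z \<in> U" "y = \<phi> z" using sub by blast
        then show "x \<in> K" using y inv by (auto simp: K_def)
      next
        fix x assume x: "x \<in> K"
        then have "\<phi> x \<in> ?C" "x = \<psi> (\<phi> x)" using inv chart_half_space[OF U(1)] by (auto simp: K_def)
        then show "x \<in> \<psi> ` ?C" by blast
      qed
    qed
    ultimately show ?thesis by (simp add: compactin_subtopology)
  qed
  have 0: "\<rho> x = 0" if "x \<notin> K" for x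
  proof (cases "x \<in> U")
    case True
    with that have "r < norm (\<phi> x - \<phi> p)" by (simp add: K_def dist_norm norm_minus_commute)
    then have "r^2 \<le> (norm (\<phi> x - \<phi> p))^2" using r(1) by (intro power_mono) auto
    then have "1 \<le> (\<phi> x - \<phi> p) \<bullet> (\<phi> x - \<phi> p) * inverse (r^2)"
      using r(1) by (simp add: power2_norm_eq_inner field_simps)
    then show ?thesis using True by (simp add: \<rho>_def F_def step_eq_0)
  qed (simp add: \<rho>_def)
  have "smooth_at M x \<rho>" if x: "x \<in> topspace (mtop M)" for x
  proof (cases "x \<in> U")
    case True
    have "smooth_near U \<phi> x \<rho>"
      by (rule smooth_near_cong[OF local_ext_smooth_near[OF local_ext_fun[OF open_UNIV F]]]) (auto simp: \<rho>_def)
    then show ?thesis using U True smooth_atI by blast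
  next
    case False
    have "closedin (mtop M) K" using compactin_imp_closedin[OF Hausdorff K] .
    then have "openin (mtop M) (topspace (mtop M) - K)" by blast
    moreover have "x \<in> topspace (mtop M) - K" using False x by (auto simp: K_def)
    ultimately show ?thesis
      by (rule smooth_at_local[OF smooth_at_const[OF x, of 0]]) (use 0 in auto)
  qed
  then have sm: "\<rho> \<in> smooth_functions M" using smooth_iff_smooth_at by blast
  have 1: "\<rho> x = 1" if "x \<in> S'" for x
  proof -
    have "norm (\<phi> x - \<phi> p) < r / 2" using that by (simp add: S'_def dist_norm norm_minus_commute)
    then have "(norm (\<phi> x - \<phi> p))^2 \<le> (r/2)^2" by (intro power_mono) auto
    then have "(\<phi> x - \<phi> p) \<bullet> (\<phi> x - \<phi> p) * inverse (r^2) \<le> 1/2"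
    proof -
      have "(\<phi> x - \<phi> p) \<bullet> (\<phi> x - \<phi> p) \<le> (r/2)^2"
        using \<open>(norm (\<phi> x - \<phi> p))^2 \<le> (r/2)^2\<close> by (simp only: power2_norm_eq_inner)
      also have "\<dots> \<le> r^2 / 2" by (simp add: power2_eq_square)
      finally show ?thesis using r(1) by (simp add: field_simps)
    qed
    then show ?thesis using that by (simp add: \<rho>_def F_def step_eq_1 S'_def)
  qed
  show ?thesis
  proof (rule that[of \<rho> S' K], unfold bump_on_def, intro conjI allI ballI impI)
    show "openin (mtop M) S'" unfolding S'_def by (rule chart_vimage[OF U(1)]) simp
    show "p \<in> S'" using U(2) r(1) by (simp add: S'_def)
    show "S' \<subseteq> S" using KS r(1) by (auto simp: S'_def K_def)
    show "0 \<le> \<rho> x" for x using step_nonneg by (simp add: \<rho>_def F_def)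
    show "\<rho> \<in> smooth_functions M" by (rule sm)
    show "compactin (mtop M) K" by (rule K)
    show "K \<subseteq> S" by (rule KS)
    show "\<rho> x = 1" if "x \<in> S'" for x by (rule 1[OF that])
    show "\<rho> x = 0" if "x \<notin> K" for x by (rule 0[OF that])
  qed
qed

lemma bump_mult_smooth:
  assumes \<rho>: "\<rho> \<in> smooth_functions M" and K: "compactin (mtop M) K" "K \<subseteq> S" "\<And>x. x \<notin> K \<Longrightarrow> \<rho> x = 0"
    and g: "\<And>x. x \<in> S \<Longrightarrow> x \<in> topspace (mtop M) \<Longrightarrow> smooth_at M x g"
  shows "(\<lambda>x. \<rho> x * g x) \<in> smooth_functions M"
  unfolding smooth_iff_smooth_at
proof
  fix x assume x: "x \<in> topspace (mtop M)"
  show "smooth_at M x (\<lambda>x. \<rho> x * g x)"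
  proof (cases "x \<in> S")
    case True
    have "smooth_at M x \<rho>" using \<rho> x by (simp add: smooth_iff_smooth_at)
    then show ?thesis by (rule smooth_at_mult[OF _ g[OF True x]])
  next
    case False
    have "closedin (mtop M) K" using compactin_imp_closedin[OF Hausdorff K(1)] .
    then have "openin (mtop M) (topspace (mtop M) - K)" by blast
    moreover have "x \<in> topspace (mtop M) - K" using False x K(2) by auto
    ultimately show ?thesis
      by (rule smooth_at_local[OF smooth_at_const[OF x, of 0]]) (use K(3) in auto)
  qed
qed

lemma smooth_extension:
  assumes S: "openin (mtop M) S" "p \<in> S" and g: "\<And>x. x \<in> S \<Longrightarrow> smooth_at M x g"
  obtains h S' where "h \<in> smooth_functions M" "openin (mtop M) S'" "p \<in> S'" "S' \<subseteq> S" "\<And>x. x \<in> S' \<Longrightarrow> h x = g x"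
proof -
  obtain \<rho> S' K where bump: "bump_on M p S \<rho> S' K"
    by (rule bump[OF S], rule that)
  note * = bump_onD[OF bump]
  have "(\<lambda>x. \<rho> x * g x) \<in> smooth_functions M"
    by (rule bump_mult_smooth[OF *(1,7,8,9) g])
  then show ?thesis using * by (intro that[of "\<lambda>x. \<rho> x * g x" S']) auto
qed

lemma tangent_local_M:
  assumes X: "X \<in> tangent_space M p" and g: "g \<in> smooth_functions M" "h \<in> smooth_functions M"
    and S: "openin (mtop M) S" "p \<in> S" "\<And>x. x \<in> S \<Longrightarrow> g x = h x"
  shows "X g = X h"
proof -
  obtain \<rho> S' K where bump: "bump_on M p S \<rho> S' K"
    by (rule bump[OF S(1,2)], rule that)
  note * = bump_onD[OF bump]
  show ?thesis
  proof (rule tangent_local[OF good X g *(1)])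
    show "\<rho> p = 1" using * by simp
    show "p \<in> topspace (mtop M)" using openin_subset[OF S(1)] S(2) by blast
    show "g x = h x" if "\<rho> x \<noteq> 0" for x
      using that *(8,9) S(3) by blast
  qed
qed

text \<open>Hadamard's lemma in a chart, which is valid up to the boundary since half-spaces are convex.\<close>

lemma tangent_chart_formula:
  assumes U: "(U, \<phi>) \<in> charts M" "p \<in> U" and X: "X \<in> tangent_space M p"
    and B: "finite B" "B \<subseteq> E" "\<And>y. y \<in> E \<Longrightarrow> y = (\<Sum>b\<in>B. (y \<bullet> b) *\<^sub>R b)"
    and xs: "\<And>b. b \<in> B \<Longrightarrow> xs b \<in> smooth_functions M" "openin (mtop M) S" "p \<in> S" "S \<subseteq> U"
      "\<And>b x. b \<in> B \<Longrightarrow> x \<in> S \<Longrightarrow> xs b x = \<phi> x \<bullet> b"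
    and g: "g \<in> smooth_functions M" "local_ext U \<phi> p g W G"
  shows "X g = (\<Sum>b\<in>B. X (xs b) * Df G (\<phi> p) b)"
proof -
  obtain r where r: "r > 0" "ball (\<phi> p) r \<subseteq> W" using g(2) openE unfolding local_ext_def by blast
  let ?D = "ball (\<phi> p) r"
  have GD: "Cinf ?D G" using g(2) r Cinf_subset unfolding local_ext_def by blast
  obtain \<Gamma> where \<Gamma>: "\<And>v. Cinf ?D (\<Gamma> v)" "\<And>v. \<Gamma> v (\<phi> p) = Df G (\<phi> p) v"
    "\<And>y. y \<in> ?D \<Longrightarrow> linear (\<lambda>v. \<Gamma> v y)"
    "\<And>y. y \<in> ?D \<Longrightarrow> G y = G (\<phi> p) + \<Gamma> (y - \<phi> p) y"
    by (rule Cinf_hadamard[OF open_ball convex_ball _ GD]) (use r in auto)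
  define Q where "Q = {x \<in> U. \<phi> x \<in> ?D}"
  have Q: "openin (mtop M) Q" "p \<in> Q" unfolding Q_def using chart_vimage[OF U(1) open_ball] U(2) r by simp_all
  have "\<exists>h S'. h \<in> smooth_functions M \<and> openin (mtop M) S' \<and> p \<in> S' \<and> S' \<subseteq> Q \<and> (\<forall>x\<in>S'. h x = \<Gamma> b (\<phi> x))" for b
  proof -
    have "smooth_at M x (\<lambda>x. \<Gamma> b (\<phi> x))" if "x \<in> Q" for x
      by (rule smooth_atI[OF U(1)], use that Q_def in blast, rule local_ext_smooth_near[OF local_ext_fun[OF open_ball \<Gamma>(1)]])
        (use that Q_def in blast)
    from smooth_extension[OF Q this] show ?thesis by metis
  qed
  then obtain h S' where h: "\<And>b. h b \<in> smooth_functions M" "\<And>b. openin (mtop M) (S' b)" "\<And>b. p \<in> S' b"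
    "\<And>b. S' b \<subseteq> Q" "\<And>b x. x \<in> S' b \<Longrightarrow> h b x = \<Gamma> b (\<phi> x)" by metis
  define d where "d = (\<lambda>b x. 1 * xs b x + (- (\<phi> p \<bullet> b)) * 1)"
  note c1 = smooth_functions_const[OF good, of 1]
  have d: "d b \<in> smooth_functions M" if "b \<in> B" for b
    unfolding d_def by (rule smooth_functions_lincomb[OF good xs(1)[OF that] c1])
  have Xd: "X (d b) = X (xs b)" if "b \<in> B" for b
    unfolding d_def using tangent_lincomb[OF X xs(1)[OF that] c1, of 1 "- (\<phi> p \<bullet> b)"] tangent_const[OF good X, of 1] by simp
  \<comment> \<open>Since \<open>d b\<close> vanishes at \<open>p\<close>, the Leibniz rule for
    \<open>d b * h b\<close> leaves only \<open>X (xs b)\<close> times the value of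
    \<open>h b\<close> at \<open>p\<close>.\<close>
  have dp: "d b p = 0" if "b \<in> B" for b using xs(3,5) that by (simp add: d_def)
  define H where "H = (\<lambda>x. \<Sum>b\<in>B. d b x * h b x)"
  have H: "H \<in> smooth_functions M" unfolding H_def
    by (intro smooth_functions_sum[OF good] smooth_functions_mult[OF good] d h(1))
  have "X H = (\<Sum>b\<in>B. X (\<lambda>x. d b x * h b x))" unfolding H_def
    by (intro tangent_sum[OF good X] smooth_functions_mult[OF good] d h(1))
  also have "\<dots> = (\<Sum>b\<in>B. X (xs b) * Df G (\<phi> p) b)"
  proof (rule sum.cong[OF refl])
    fix b assume b: "b \<in> B"
    have "h b p = Df G (\<phi> p) b" using h(3,5) \<Gamma>(2) by simp
    then show "X (\<lambda>x. d b x * h b x) = X (xs b) * Df G (\<phi> p) b"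
      using tangent_mult[OF X d[OF b] h(1)[of b]] Xd[OF b] dp[OF b] by simp
  qed
  finally have XH: "X H = (\<Sum>b\<in>B. X (xs b) * Df G (\<phi> p) b)" .
  define R where "R = S \<inter> Q \<inter> (\<Inter>b\<in>B. S' b)"
  have R: "openin (mtop M) R" "p \<in> R"
  proof -
    show "openin (mtop M) R"
    \<comment> \<open>\<open>B\<close> is empty in dimension 0, and the intersection over it is then
      the whole type, which need not be open in \<open>mtop M\<close>.\<close>
    proof (cases "B = {}")
      case True
      then show ?thesis using xs(2) Q(1) by (auto simp: R_def)
    next
      case False
      have "openin (mtop M) (\<Inter>b\<in>B. S' b)" by (rule openin_INT2[OF B(1) False]) (use h in auto)
      then show ?thesis using xs(2) Q(1) unfolding R_def by blast
    qed
    show "p \<in> R" using xs(3) Q(2) h(3) by (simp add: R_def)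
  qed
  have "g x = 1 * H x + g p * 1" if x: "x \<in> R" for x
  proof -
    have xU: "x \<in> U" "\<phi> x \<in> ?D" "x \<in> S" using x by (auto simp: R_def Q_def)
    have "\<phi> x - \<phi> p \<in> E" using chart_E[OF U(1)] xU(1) U(2) subspace_diff[OF subspace_E] by blast
    from B(3)[OF this] have e: "\<phi> x - \<phi> p = (\<Sum>b\<in>B. ((\<phi> x - \<phi> p) \<bullet> b) *\<^sub>R b)" .
    have "g x = G (\<phi> x)" using local_ext_eq[OF g(2) xU(1)] xU(2) r by auto
    also have "\<dots> = G (\<phi> p) + \<Gamma> (\<phi> x - \<phi> p) (\<phi> x)" using \<Gamma>(4)[OF xU(2)] .
    also have "G (\<phi> p) = g p" using local_ext_eq[OF g(2) U(2)] local_ext_mem[OF g(2)] by blast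
    also have "\<Gamma> (\<phi> x - \<phi> p) (\<phi> x) = \<Gamma> (\<Sum>b\<in>B. ((\<phi> x - \<phi> p) \<bullet> b) *\<^sub>R b) (\<phi> x)" using e by simp
    also have "\<dots> = (\<Sum>b\<in>B. ((\<phi> x - \<phi> p) \<bullet> b) * \<Gamma> b (\<phi> x))"
      by (subst linear_sum[OF \<Gamma>(3)[OF xU(2)]], subst linear_scale[OF \<Gamma>(3)[OF xU(2)]]) simp
    also have "\<dots> = H x"
      unfolding H_def
      by (rule sum.cong) (use x xs(5) xU(3) h(5) in \<open>auto simp: d_def inner_diff_left R_def\<close>)
    finally show ?thesis by simp
  qed
  from tangent_local_M[OF X g(1) smooth_functions_lincomb[OF good H c1] R this]
  have "X g = X (\<lambda>x. 1 * H x + g p * 1)" by simp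
  also have "\<dots> = X H" using tangent_lincomb[OF X H c1, of 1 "g p"] tangent_const[OF good X, of 1] by simp
  finally show ?thesis using XH by simp
qed

text \<open>Derivations act on global functions, so the chart coordinates are multiplied by a bump
  function, which changes nothing on \<open>S\<close>. The bump function is returned too, to cut off
  coordinate fields in the same way.\<close>

lemma coordinate_functions:
  assumes U: "(U, \<phi>) \<in> charts M" "p \<in> U"
  obtains \<rho> xs S K where "\<rho> \<in> smooth_functions M" "compactin (mtop M) K" "K \<subseteq> U" "\<And>x. x \<notin> K \<Longrightarrow> \<rho> x = 0"
    "openin (mtop M) S" "p \<in> S" "S \<subseteq> U" "\<And>x. x \<in> S \<Longrightarrow> \<rho> x = 1"
    "\<And>b. xs b \<in> smooth_functions M" "\<And>b x. x \<in> S \<Longrightarrow> xs b x = \<phi> x \<bullet> b"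
proof -
  obtain \<rho> S K where bump: "bump_on M p U \<rho> S K"
    by (rule bump[OF chart_openin[OF U(1)] U(2)], rule that)
  note * = bump_onD[OF bump]
  have "smooth_at M x (\<lambda>x. \<phi> x \<bullet> b)" if "x \<in> U" for x b
    by (rule smooth_atI[OF U(1) that], rule local_ext_smooth_near[OF local_ext_fun[OF open_UNIV Cinf_inner[OF Cinf_id Cinf_const]]]) simp
  then have "(\<lambda>x. \<rho> x * (\<phi> x \<bullet> b)) \<in> smooth_functions M" for b
    by (intro bump_mult_smooth[OF *(1,7,8,9)])
  then show ?thesis using * by (intro that[of \<rho> K S "\<lambda>b x. \<rho> x * (\<phi> x \<bullet> b)"]) auto
qed

end

section \<open>Continuity of differential forms\<close>

text \<open>The prefix \<open>A\<close> singles out the slot. The vector \<open>Z\<close> occurs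
  only to certify that the list has length \<open>k\<close> and that the other entries are
  tangent.\<close>

lemma form_slot_sum:
  assumes P: "good_charts P" and \<beta>: "differential_form k P \<beta>" and t: "tangent_tuple k P q (A @ Z # C)"
    and fin: "finite B" and Y: "\<And>b. b \<in> B \<Longrightarrow> Y b \<in> tangent_space P q"
  shows "\<beta> q (A @ (\<lambda>g. \<Sum>b\<in>B. c b * Y b g) # C) = (\<Sum>b\<in>B. c b * \<beta> q (A @ Y b # C))"
proof -
  have lin: "\<beta> q (A @ (\<lambda>g. a * X g + b * Y g) # C) = a * \<beta> q (A @ X # C) + b * \<beta> q (A @ Y # C)"
    if "X \<in> tangent_space P q" "Y \<in> tangent_space P q" for X Y a b
  proof -
    have k: "length A < k" using t by (auto simp: tangent_tuple_def)
    have "\<beta> q ((A @ Z # C)[length A := (\<lambda>g. a * X g + b * Y g)]) =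
        a * \<beta> q ((A @ Z # C)[length A := X]) + b * \<beta> q ((A @ Z # C)[length A := Y])"
      using \<beta> t k that unfolding differential_form_def by blast
    then show ?thesis by simp
  qed
  have "(\<lambda>g. \<Sum>b\<in>B. c b * Y b g) \<in> tangent_space P q \<and>
    \<beta> q (A @ (\<lambda>g. \<Sum>b\<in>B. c b * Y b g) # C) = (\<Sum>b\<in>B. c b * \<beta> q (A @ Y b # C))"
    using fin Y
  proof (induction B)
    case empty
    show ?case using lin[OF tangent_space_zero tangent_space_zero, of 0 0] by (simp add: tangent_space_zero)
  next
    case (insert b B)
    then have Yb: "Y b \<in> tangent_space P q" and
      IH: "(\<lambda>g. \<Sum>b\<in>B. c b * Y b g) \<in> tangent_space P q"
      "\<beta> q (A @ (\<lambda>g. \<Sum>b\<in>B. c b * Y b g) # C) = (\<Sum>b\<in>B. c b * \<beta> q (A @ Y b # C))" by auto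
    have eq: "(\<lambda>g. \<Sum>b\<in>insert b B. c b * Y b g) = (\<lambda>g. c b * Y b g + 1 * (\<Sum>b\<in>B. c b * Y b g))"
      using insert.hyps by simp
    show ?case
      unfolding eq using tangent_space_lincomb[OF P Yb IH(1), of "c b" 1] lin[OF Yb IH(1), of "c b" 1] IH(2) insert.hyps
      by simp
  qed
  then show ?thesis by blast
qed

context mfd
begin

text \<open>Smoothness of a form is tested on vector fields defined on all of \<open>M\<close>, so
  coordinate fields have to be extended by 0; the factor \<open>\<rho>\<close> makes this
  smooth.\<close>

definition frame_field :: "'a set \<Rightarrow> ('a \<Rightarrow> 'e) \<Rightarrow> ('a \<Rightarrow> real) \<Rightarrow> 'e \<Rightarrow> 'a \<Rightarrow> 'a tvec" where
  "frame_field U \<phi> \<rho> b q = (\<lambda>g. if q \<in> U then \<rho> q * coord_vec M U \<phi> (\<lambda>x. x) q b g else 0)"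

lemma vector_field_frame:
  assumes U: "(U, \<phi>) \<in> charts M" and b: "b \<in> E" and \<rho>: "\<rho> \<in> smooth_functions M"
    and K: "compactin (mtop M) K" "K \<subseteq> U" "\<And>x. x \<notin> K \<Longrightarrow> \<rho> x = 0"
  shows "vector_field M (frame_field U \<phi> \<rho> b)"
  unfolding vector_field_def
proof (intro conjI ballI)
  fix q assume q: "q \<in> topspace (mtop M)"
  show "frame_field U \<phi> \<rho> b q \<in> tangent_space M q"
  proof (cases "q \<in> U")
    case True
    have v: "coord_vec M U \<phi> (\<lambda>x. x) q b \<in> tangent_space M q"
      by (rule coord_vec_chart_tangent[OF good chart_tangent_dir_U[OF U True b] True U])
    show ?thesis using tangent_space_lincomb[OF good v tangent_space_zero, of "\<rho> q" 0] True
      by (simp add: frame_field_def)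
  next
    case False
    then show ?thesis by (simp add: frame_field_def tangent_space_zero)
  qed
next
  fix g assume g: "g \<in> smooth_functions M"
  have "smooth_at M q (\<lambda>q. dir_deriv U \<phi> q b g)" if q: "q \<in> U" for q
  proof -
    obtain W G where G: "local_ext U \<phi> q g W G" using smooth_functionsD[OF good g U q] by (elim smooth_nearE)
    have "local_ext U \<phi> q (\<lambda>q. dir_deriv U \<phi> q b g) W (\<lambda>y. Df G y b)"
      unfolding local_ext_def
    proof (intro conjI ballI impI)
      show "Cinf W (\<lambda>y. Df G y b)" by (rule Cinf_Df[OF local_ext_open[OF G] local_ext_Cinf[OF G]])
      fix x assume x: "x \<in> U" "\<phi> x \<in> W"
      have "local_ext U \<phi> x g W G" using G x by (simp add: local_ext_def)
      from dir_deriv_eq[OF chart_tangent_dir_U[OF U x(1) b] this] show "Df G (\<phi> x) b = dir_deriv U \<phi> x b g" by simp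
    qed (use G in \<open>auto simp: local_ext_def\<close>)
    then show ?thesis by (rule smooth_atI[OF U q local_ext_smooth_near])
  qed
  then have "(\<lambda>q. \<rho> q * dir_deriv U \<phi> q b g) \<in> smooth_functions M"
    by (intro bump_mult_smooth[OF \<rho> K])
  moreover have "(\<lambda>q. \<rho> q * dir_deriv U \<phi> q b g) = (\<lambda>q. frame_field U \<phi> \<rho> b q g)"
  proof
    show "\<rho> q * dir_deriv U \<phi> q b g = frame_field U \<phi> \<rho> b q g" for q
      using K g by (cases "q \<in> U") (auto simp: frame_field_def coord_vec_def)
  qed
  ultimately show "(\<lambda>q. frame_field U \<phi> \<rho> b q g) \<in> smooth_functions M" by simp
qed

lemma frame_expansion:
  assumes U: "(U, \<phi>) \<in> charts M"
    and B: "finite B" "B \<subseteq> E" "\<And>y. y \<in> E \<Longrightarrow> y = (\<Sum>b\<in>B. (y \<bullet> b) *\<^sub>R b)"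
    and S: "openin (mtop M) S" "S \<subseteq> U" "\<And>x. x \<in> S \<Longrightarrow> \<rho> x = 1"
    and xs: "\<And>b. xs b \<in> smooth_functions M" "\<And>b x. x \<in> S \<Longrightarrow> xs b x = \<phi> x \<bullet> b"
    and q: "q \<in> S" and X: "X \<in> tangent_space M q"
  shows "X = (\<lambda>g. \<Sum>b\<in>B. X (xs b) * frame_field U \<phi> \<rho> b q g)"
proof
  fix g
  have qU: "q \<in> U" using q S by blast
  show "X g = (\<Sum>b\<in>B. X (xs b) * frame_field U \<phi> \<rho> b q g)"
  proof (cases "g \<in> smooth_functions M")
    case True
    obtain W G where G: "local_ext U \<phi> q g W G" using smooth_functionsD[OF good True U qU] by (elim smooth_nearE)
    have "X g = (\<Sum>b\<in>B. X (xs b) * Df G (\<phi> q) b)"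
      by (rule tangent_chart_formula[OF U qU X B xs(1) S(1) q S(2) xs(2) True G])
    also have "\<dots> = (\<Sum>b\<in>B. X (xs b) * frame_field U \<phi> \<rho> b q g)"
    proof (rule sum.cong[OF refl])
      fix b assume "b \<in> B"
      then have "coord_vec M U \<phi> (\<lambda>x. x) q b g = Df G (\<phi> q) b"
        using coord_vec_eq[OF chart_tangent_dir_U[OF U qU] True, where F = "\<lambda>x. x", OF _ G] B(2) by blast
      then show "X (xs b) * Df G (\<phi> q) b = X (xs b) * frame_field U \<phi> \<rho> b q g"
        using qU S(3)[OF q] by (simp add: frame_field_def)
    qed
    finally show ?thesis .
  next
    case False
    then show ?thesis using tangent_nonsmooth[OF X False] qU by (simp add: frame_field_def coord_vec_def)
  qed
qed

text \<open>There is no tangent bundle in which vectors at moving base points could converge, so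
  convergence is expressed function by function. Near \<open>p\<close> each vector is a combination
  of global frame fields with coefficients \<open>X (xs b)\<close>; these converge by hypothesis,
  and the form is smooth on frame fields.\<close>

lemma form_continuous:
  assumes \<beta>: "differential_form k M \<beta>" and ps: "limitin (mtop M) ps p sequentially"
    and Xs: "\<And>n. tangent_tuple k M (ps n) (Xs n)" and Ys: "tangent_tuple k M p Ys"
    and conv: "\<And>i g. i < k \<Longrightarrow> g \<in> smooth_functions M \<Longrightarrow> (\<lambda>n. (Xs n ! i) g) \<longlonglongrightarrow> (Ys ! i) g"
  shows "(\<lambda>n. \<beta> (ps n) (Xs n)) \<longlonglongrightarrow> \<beta> p Ys"
proof -
  have p: "p \<in> topspace (mtop M)" using Ys by (simp add: tangent_tuple_def)
  then obtain U \<phi> where U: "(U, \<phi>) \<in> charts M" "p \<in> U" using chart_ex by blast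
  obtain \<rho> xs S K where c: "\<rho> \<in> smooth_functions M" "compactin (mtop M) K" "K \<subseteq> U" "\<And>x. x \<notin> K \<Longrightarrow> \<rho> x = 0"
    "openin (mtop M) S" "p \<in> S" "S \<subseteq> U" "\<And>x. x \<in> S \<Longrightarrow> \<rho> x = 1"
    "\<And>b. xs b \<in> smooth_functions M" "\<And>b x. x \<in> S \<Longrightarrow> xs b x = \<phi> x \<bullet> b"
    using coordinate_functions[OF U] by metis
  obtain B where B: "finite B" "B \<subseteq> E" "\<And>y. y \<in> E \<Longrightarrow> y = (\<Sum>b\<in>B. (y \<bullet> b) *\<^sub>R b)"
    using orthonormal_expansion[OF subspace_E] by metis
  define Z where "Z = frame_field U \<phi> \<rho>"
  have vf: "vector_field M (Z b)" if "b \<in> B" for b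
    unfolding Z_def by (rule vector_field_frame[OF U(1) _ c(1-4)]) (use that B in blast)
  have Zt: "Z b q \<in> tangent_space M q" if "b \<in> B" "q \<in> topspace (mtop M)" for b q
    using vf that unfolding vector_field_def by blast
  have expand: "X = (\<lambda>g. \<Sum>b\<in>B. X (xs b) * Z b q g)" if "q \<in> S" "X \<in> tangent_space M q" for X q
    unfolding Z_def by (rule frame_expansion[OF U(1) B c(5,7,8,9,10) that])
  have slot: "\<beta> q (A @ X # C) = (\<Sum>b\<in>B. X (xs b) * \<beta> q (A @ Z b q # C))"
    if q: "q \<in> S" and t: "tangent_tuple k M q (A @ X # C)" for q A X C
  proof -
    have X: "X \<in> tangent_space M q" and qt: "q \<in> topspace (mtop M)" using t by (auto simp: tangent_tuple_def)
    have "\<beta> q (A @ X # C) = \<beta> q (A @ (\<lambda>g. \<Sum>b\<in>B. X (xs b) * Z b q g) # C)"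
      using expand[OF q X] by simp
    also have "\<dots> = (\<Sum>b\<in>B. X (xs b) * \<beta> q (A @ Z b q # C))"
      by (rule form_slot_sum[OF good \<beta> t B(1) Zt[OF _ qt]])
    finally show ?thesis .
  qed
  have psS: "\<forall>\<^sub>F n in sequentially. ps n \<in> S" using ps c(5,6) unfolding limitin_def by blast
  \<comment> \<open>Slots are exchanged one at a time: the first \<open>j\<close> still carry the
    given vectors, the others frame fields. For \<open>j = 0\<close> this is smoothness of the form,
    for \<open>j = k\<close> the claim.\<close>
  have main: "(\<lambda>n. \<beta> (ps n) (take j (Xs n) @ map (\<lambda>Z. Z (ps n)) Zs)) \<longlonglongrightarrow> \<beta> p (take j Ys @ map (\<lambda>Z. Z p) Zs)"
    if "j \<le> k" "length Zs = k - j" "set Zs \<subseteq> Z ` B" for j Zs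
    using that
  proof (induction j arbitrary: Zs)
    case 0
    have "(\<lambda>q. \<beta> q (map (\<lambda>Z. Z q) Zs)) \<in> smooth_functions M"
    proof -
      have "length Zs = k \<and> (\<forall>Z\<in>set Zs. vector_field M Z)" using 0 vf by auto
      then show ?thesis using \<beta> unfolding differential_form_def by blast
    qed
    then have "continuous_map (mtop M) euclidean (\<lambda>q. \<beta> q (map (\<lambda>Z. Z q) Zs))"
      by (rule smooth_functions_continuous)
    from continuous_map_limit[OF this ps] show ?case by (simp add: o_def)
  next
    case (Suc j)
    have j: "j < k" "length (Xs n) = k" "length Ys = k" for n
      using Suc.prems Xs[of n] Ys by (auto simp: tangent_tuple_def)
    have tup: "tangent_tuple k M q (take j L @ (L ! j) # map (\<lambda>Z. Z q) Zs)" if L: "tangent_tuple k M q L" for q L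
    proof -
      have l: "length L = k" "set L \<subseteq> tangent_space M q" "q \<in> topspace (mtop M)" using L by (auto simp: tangent_tuple_def)
      moreover have "set (take j L) \<subseteq> set L" by (rule set_take_subset)
      moreover have "L ! j \<in> set L" using l j by simp
      moreover have "Z' q \<in> tangent_space M q" if "Z' \<in> set Zs" for Z' using that Suc.prems(3) Zt l by auto
      ultimately show ?thesis using Suc.prems(1,2) by (auto simp: tangent_tuple_def min_def)
    qed
    have eq: "\<beta> q (take (Suc j) L @ map (\<lambda>Z. Z q) Zs) =
        (\<Sum>b\<in>B. (L ! j) (xs b) * \<beta> q (take j L @ map (\<lambda>Z. Z q) (Z b # Zs)))"
      if q: "q \<in> S" and L: "tangent_tuple k M q L" for q L
      using slot[OF q tup[OF L]] j L by (simp add: tangent_tuple_def take_Suc_conv_app_nth)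
    have "(\<lambda>n. \<Sum>b\<in>B. (Xs n ! j) (xs b) * \<beta> (ps n) (take j (Xs n) @ map (\<lambda>Z. Z (ps n)) (Z b # Zs)))
      \<longlonglongrightarrow> (\<Sum>b\<in>B. (Ys ! j) (xs b) * \<beta> p (take j Ys @ map (\<lambda>Z. Z p) (Z b # Zs)))"
      by (intro tendsto_sum tendsto_mult conv j c(9) Suc.IH) (use Suc.prems in auto)
    moreover have "\<forall>\<^sub>F n in sequentially. (\<Sum>b\<in>B. (Xs n ! j) (xs b) * \<beta> (ps n) (take j (Xs n) @ map (\<lambda>Z. Z (ps n)) (Z b # Zs)))
        = \<beta> (ps n) (take (Suc j) (Xs n) @ map (\<lambda>Z. Z (ps n)) Zs)"
      using psS by eventually_elim (simp only: eq[OF _ Xs])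
    ultimately show ?case
      unfolding eq[OF c(6) Ys] by (rule Lim_transform_eventually)
  qed
  have "length (Xs n) = k" "length Ys = k" for n using Xs[of n] Ys by (auto simp: tangent_tuple_def)
  then show ?thesis using main[of k "[]"] by simp
qed

end

section \<open>Integrals of periodic functions over the circle\<close>

lemma Cinf_cis: "Cinf UNIV cis"
  unfolding Cinf_def
proof
  fix k
  \<comment> \<open>The factor \<open>c\<close> absorbs the \<open>\<i>\<close> that each
    differentiation produces.\<close>
  have "Ck_on k UNIV (\<lambda>t. c * cis t)" for c
  proof (induction k arbitrary: c)
    case 0
    show ?case by (auto intro!: continuous_intros)
  next
    case (Suc k)
    have "((\<lambda>t. c * cis t) has_derivative (\<lambda>v. v *\<^sub>R ((c * \<i>) * cis t))) (at t)" for t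
      by (auto intro!: derivative_eq_intros simp: algebra_simps)
    moreover have "Ck_on k UNIV (\<lambda>t. v *\<^sub>R ((c * \<i>) * cis t))" for v
      by (intro Ck_on_bilinear[OF bounded_bilinear_scaleR] Ck_on_const Suc)
    ultimately show ?case unfolding Ck_on.simps
      by (intro exI[of _ "\<lambda>t v. v *\<^sub>R ((c * \<i>) * cis t)"]) simp
  qed
  from this[of 1] show "Ck_on k UNIV cis" by simp
qed

lemma integral_shift_real:
  fixes f :: "real \<Rightarrow> 'b::banach"
  assumes "continuous_on UNIV f"
  shows "integral {a..b} (\<lambda>x. f (x + c)) = integral {a + c..b + c} f"
proof -
  have "f integrable_on cbox (a + c) (b + c)"
    by (rule integrable_continuous) (rule continuous_on_subset[OF assms], simp)
  then have "(f has_integral integral (cbox (a + c) (b + c)) f) (cbox (a + c) (b + c))"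
    by (rule integrable_integral)
  from has_integral_affinity[OF this, of 1 c]
  have "((\<lambda>x. f (x + c)) has_integral integral {a + c..b + c} f) ((\<lambda>x. x - c) ` {a + c..b + c})" by simp
  moreover have "(\<lambda>x. x - c) ` {a + c..b + c} = {a..b}"
    using image_add_atLeastAtMost[of "-c" "a + c" "b + c"] by simp
  ultimately show ?thesis by (simp add: integral_unique)
qed

lemma integral_periodic_shift:
  fixes f :: "real \<Rightarrow> 'b::banach"
  assumes f: "continuous_on UNIV f" and per: "\<And>x. f (x + T) = f x" and c: "0 \<le> c" "c \<le> T"
  shows "integral {0..T} (\<lambda>x. f (x + c)) = integral {0..T} f"
proof -
  have int: "f integrable_on {a..b}" for a b
    by (rule integrable_continuous_real) (rule continuous_on_subset[OF f], simp)
  have "integral {0..T} (\<lambda>x. f (x + c)) = integral {c..T + c} f"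
    using integral_shift_real[OF f, of 0 T c] by simp
  also have "\<dots> = integral {c..T} f + integral {T..T + c} f"
    using Henstock_Kurzweil_Integration.integral_combine[where a = c and c = T and b = "T + c" and f = f] c int by simp
  also have "integral {T..T + c} f = integral {0..c} f"
    using integral_shift_real[OF f, of 0 c T] per by (simp add: add.commute)
  also have "integral {c..T} f + integral {0..c} f = integral {0..T} f"
    using Henstock_Kurzweil_Integration.integral_combine[where a = 0 and c = c and b = T and f = f] c int by (simp add: add.commute)
  finally show ?thesis .
qed

section \<open>Averaging over the circle action\<close>

locale cutting = mfd E u M
  for E :: "'e::euclidean_space set" and u :: 'e and M :: "('a, 'e) charted" +
  fixes D :: "'a set" and act :: "complex \<Rightarrow> 'a \<Rightarrow> 'a" and f :: "'a \<Rightarrow> real" and N :: "('a set, 'e) charted"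
  assumes act: "free_circle_action_near_boundary u M D act"
    and bdf: "invariant_boundary_defining u M D act f"
    and cut: "is_cut_manifold E u M D act f N"
begin

sublocale N: mfd E 0 N
  using cut by unfold_locales (simp add: is_cut_manifold_def)

abbreviation "cmap \<equiv> cut_map u M act"
abbreviation "bd \<equiv> bdry u M"

text \<open>One neighbourhood with an invariant \<open>f\<close> is fixed for all later
  constructions.\<close>

definition V0 :: "'a set" where
  "V0 = (SOME V. invariant_nbhd u M D act V \<and> (\<forall>a\<in>circle. \<forall>x\<in>V. f (act a x) = f x))"

lemma V0: "invariant_nbhd u M D act V0" "\<And>a x. a \<in> circle \<Longrightarrow> x \<in> V0 \<Longrightarrow> f (act a x) = f x"
proof -
  have "\<exists>V. invariant_nbhd u M D act V \<and> (\<forall>a\<in>circle. \<forall>x\<in>V. f (act a x) = f x)"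
    using bdf by (simp add: invariant_boundary_defining_def)
  then have "invariant_nbhd u M D act V0 \<and> (\<forall>a\<in>circle. \<forall>x\<in>V0. f (act a x) = f x)"
    unfolding V0_def by (rule someI_ex)
  then show "invariant_nbhd u M D act V0" "\<And>a x. a \<in> circle \<Longrightarrow> x \<in> V0 \<Longrightarrow> f (act a x) = f x" by auto
qed

lemma V0_open: "openin (mtop M) V0" and bdry_V0: "bd \<subseteq> V0" and V0_D: "V0 \<subseteq> D"
  and act_V0: "\<And>a x. a \<in> circle \<Longrightarrow> x \<in> V0 \<Longrightarrow> act a x \<in> V0"
  using V0(1) by (auto simp: invariant_nbhd_def)

lemma V0_topspace: "x \<in> V0 \<Longrightarrow> x \<in> topspace (mtop M)"
  using V0_open openin_subset by blast

lemma D_open: "openin (mtop M) D" and act_free_action: "free_circle_action (induced M D) act"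
  using act by (auto simp: free_circle_action_near_boundary_def)

lemma topspace_D: "topspace (mtop (induced M D)) = D"
  using openin_subset[OF D_open] by (auto simp: topspace_induced)

lemma act_one: "x \<in> V0 \<Longrightarrow> act 1 x = x"
  and act_act: "a \<in> circle \<Longrightarrow> b \<in> circle \<Longrightarrow> x \<in> V0 \<Longrightarrow> act a (act b x) = act (a * b) x"
  and act_free: "a \<in> circle \<Longrightarrow> x \<in> V0 \<Longrightarrow> act a x = x \<Longrightarrow> a = 1"
proof -
  have *: "(\<forall>x\<in>D. act 1 x = x) \<and> (\<forall>a\<in>circle. \<forall>b\<in>circle. \<forall>x\<in>D. act a (act b x) = act (a * b) x) \<and>
      (\<forall>a\<in>circle. \<forall>x\<in>D. act a x = x \<longrightarrow> a = 1)"
    using act_free_action unfolding free_circle_action_def topspace_D by (elim conjE) (intro conjI)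
  show "x \<in> V0 \<Longrightarrow> act 1 x = x"
    and "a \<in> circle \<Longrightarrow> b \<in> circle \<Longrightarrow> x \<in> V0 \<Longrightarrow> act a (act b x) = act (a * b) x"
    and "a \<in> circle \<Longrightarrow> x \<in> V0 \<Longrightarrow> act a x = x \<Longrightarrow> a = 1"
    using * subsetD[OF V0_D] by metis+
qed

lemma act_smooth: "smooth_map (prod_charted (euclid circle) (induced M D)) (induced M D) (\<lambda>(a, x). act a x)"
  using act_free_action unfolding free_circle_action_def by (elim conjE)

lemma act_continuous:
  "continuous_map (prod_topology (top_of_set circle) (subtopology (mtop M) D)) (subtopology (mtop M) D) (\<lambda>(a, x). act a x)"
  using act_smooth unfolding smooth_map_def by (simp add: prod_charted_def euclid_def induced_def)

lemma f_smooth: "f \<in> smooth_functions M" and f_nonneg: "\<And>x. x \<in> topspace (mtop M) \<Longrightarrow> 0 \<le> f x"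
  and bdry_eq: "bd = {x \<in> topspace (mtop M). f x = 0}"
  and df_nonzero: "\<And>x. x \<in> bd \<Longrightarrow> \<exists>X\<in>tangent_space M x. X f \<noteq> 0"
  using bdf by (auto simp: invariant_boundary_defining_def)

lemma intr_eq: "intr u M = {x \<in> topspace (mtop M). f x > 0}"
  using f_nonneg unfolding intr_def bdry_eq by (auto simp: less_le)

lemma intr_open: "openin (mtop M) (intr u M)"
proof -
  have "openin (mtop M) {x \<in> topspace (mtop M). f x \<in> {0<..}}"
    using smooth_functions_continuous[OF f_smooth] unfolding continuous_map_def by (metis open_greaterThan open_openin)
  then show ?thesis by (simp add: intr_eq)
qed

lemma act_bdry: "a \<in> circle \<Longrightarrow> x \<in> bd \<Longrightarrow> act a x \<in> bd"
  using act_V0[of a x] V0(2)[of a x] bdry_V0 V0_topspace[of "act a x"] unfolding bdry_eq by auto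

text \<open>Smoothness of the action provides an extension that is meaningful only at pairs sent
  into \<open>V\<close>. By continuity being sent into \<open>V\<close> is an open condition, so a
  smaller \<open>W\<close> makes it automatic.\<close>

lemma act_local:
  assumes U: "(U, \<phi>) \<in> charts M" "x \<in> U" "x \<in> V0" and V: "(V, \<psi>) \<in> charts M" "act a x \<in> V" and a: "a \<in> circle"
  obtains W A where "open W" "(a, \<phi> x) \<in> W" "Cinf W A"
    "\<And>b y. b \<in> circle \<Longrightarrow> y \<in> U \<Longrightarrow> y \<in> V0 \<Longrightarrow> (b, \<phi> y) \<in> W \<Longrightarrow> act b y \<in> V \<and> A (b, \<phi> y) = \<psi> (act b y)"
proof -
  let ?F = "\<lambda>(a, x). act a x"
  let ?U = "circle \<times> (U \<inter> D)"
  let ?\<phi> = "map_prod (\<lambda>x. x) \<phi> :: complex \<times> 'a \<Rightarrow> complex \<times> 'e"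
  have inj: "inj_on ?\<phi> ?U" using chart_inj[OF U(1)] by (auto simp: inj_on_def)
  have c1: "(?U, ?\<phi>) \<in> charts (prod_charted (euclid circle) (induced M D))"
    using U(1) unfolding prod_charted_def euclid_def induced_def by auto
  have c2: "(V \<inter> D, \<psi>) \<in> charts (induced M D)"
    using V(1) unfolding induced_def by auto
  have sm: "smooth_on (?\<phi> ` {z \<in> ?U. ?F z \<in> V \<inter> D}) (\<lambda>y. \<psi> (?F (inv_into ?U ?\<phi> y)))"
    using act_smooth c1 c2 unfolding smooth_map_def by blast
  have mem: "(a, x) \<in> {z \<in> ?U. ?F z \<in> V \<inter> D}"
    using U V a V0_D act_V0[OF a U(3)] by auto
  then have "(a, \<phi> x) \<in> ?\<phi> ` {z \<in> ?U. ?F z \<in> V \<inter> D}" by force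
  from bspec[OF sm[unfolded smooth_on_def] this]
  obtain W1 A where "open W1 \<and> (a, \<phi> x) \<in> W1 \<and> (\<forall>k. Ck_on k W1 A) \<and>
    (\<forall>y\<in>?\<phi> ` {z \<in> ?U. ?F z \<in> V \<inter> D} \<inter> W1. A y = \<psi> (?F (inv_into ?U ?\<phi> y)))"
    by (elim exE)
  then have W1: "open W1" "(a, \<phi> x) \<in> W1" "\<forall>k. Ck_on k W1 A"
    and A: "\<forall>y\<in>?\<phi> ` {z \<in> ?U. ?F z \<in> V \<inter> D} \<inter> W1. A y = \<psi> (?F (inv_into ?U ?\<phi> y))"
    by simp_all
  have "openin (subtopology (mtop M) D) (V \<inter> D)" using chart_openin[OF V(1)] by (auto simp: openin_subtopology)
  let ?X = "prod_topology (top_of_set circle) (subtopology (mtop M) D)"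
  define Q where "Q = {z \<in> topspace ?X. ?F z \<in> V \<inter> D}"
  have Q: "openin ?X Q" "(a, x) \<in> Q"
    unfolding Q_def using act_continuous \<open>openin (subtopology (mtop M) D) (V \<inter> D)\<close> mem chart_sub[OF U(1)]
    by (auto simp: continuous_map_def)
  then have "\<exists>O1 O2. openin (top_of_set circle) O1 \<and> openin (subtopology (mtop M) D) O2 \<and> a \<in> O1 \<and> x \<in> O2 \<and> O1 \<times> O2 \<subseteq> Q"
    by (simp add: openin_prod_topology_alt)
  then obtain O1 O2 where O: "openin (top_of_set circle) O1" "openin (subtopology (mtop M) D) O2"
    "a \<in> O1" "x \<in> O2" "O1 \<times> O2 \<subseteq> Q" by (elim exE conjE)
  obtain O1' where O1': "open O1'" "O1 = circle \<inter> O1'" using O(1) unfolding openin_open by blast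
  have "openin (mtop M) O2" using O(2) D_open openin_trans_full by blast
  then obtain \<Omega> where \<Omega>: "open \<Omega>" "\<And>y. y \<in> U \<Longrightarrow> \<phi> y \<in> \<Omega> \<longleftrightarrow> y \<in> O2"
    using chart_open_image[OF U(1)] by blast
  show ?thesis
  proof (rule that[of "W1 \<inter> (O1' \<times> \<Omega>)" A])
    show "open (W1 \<inter> (O1' \<times> \<Omega>))" using W1 O1' \<Omega> by (intro open_Int open_Times)
    show "(a, \<phi> x) \<in> W1 \<inter> (O1' \<times> \<Omega>)" using W1(2) O(3,4) O1' \<Omega>(2)[OF U(2)] by blast
    show "Cinf (W1 \<inter> (O1' \<times> \<Omega>)) A" by (rule Cinf_subset[of W1]) (use W1(3) Cinf_def in blast)+
    fix b y assume b: "b \<in> circle" and y: "y \<in> U" "y \<in> V0" and W: "(b, \<phi> y) \<in> W1 \<inter> (O1' \<times> \<Omega>)"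
    have "b \<in> O1" "y \<in> O2" using b W O1'(2) \<Omega>(2)[OF y(1)] by auto
    then have V': "act b y \<in> V \<inter> D" using O(5) by (auto simp: Q_def)
    then have m: "(b, y) \<in> {z \<in> ?U. ?F z \<in> V \<inter> D}" using b y V0_D by auto
    then have "?\<phi> (b, y) \<in> ?\<phi> ` {z \<in> ?U. ?F z \<in> V \<inter> D} \<inter> W1" using W by (intro IntI imageI) auto
    with A have "A (?\<phi> (b, y)) = \<psi> (?F (inv_into ?U ?\<phi> (?\<phi> (b, y))))" by (rule bspec)
    moreover have "inv_into ?U ?\<phi> (?\<phi> (b, y)) = (b, y)" 
      by (rule inv_into_f_f[OF inj]) (use m in simp)
    ultimately show "act b y \<in> V \<and> A (b, \<phi> y) = \<psi> (act b y)" using V' by simp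
  qed
qed

lemma orbit_closed:
  assumes A: "A \<subseteq> circle" "compact A" and K: "compactin (mtop M) K" "K \<subseteq> V0"
  shows "closedin (mtop M) ((\<lambda>(a, x). act a x) ` (A \<times> K))"
proof -
  have "compactin (top_of_set circle) A" using A by (simp add: compactin_subtopology)
  moreover have "compactin (subtopology (mtop M) D) K" using K V0_D by (auto simp: compactin_subtopology)
  ultimately have "compactin (prod_topology (top_of_set circle) (subtopology (mtop M) D)) (A \<times> K)"
    by (simp add: compactin_Times)
  then have "compactin (subtopology (mtop M) D) ((\<lambda>(a, x). act a x) ` (A \<times> K))"
    by (rule image_compactin[OF _ act_continuous])
  then show ?thesis
    by (intro compactin_imp_closedin[OF Hausdorff]) (simp add: compactin_subtopology)
qed

text \<open>The weight \<open>cis t\<close> selects a Fourier mode along the orbit. It gives the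
  average \<open>\<zeta>\<close> the rule \<open>\<zeta> (act a x) = cnj a * \<zeta> x\<close>,
  which is what makes \<open>z * cnj (\<zeta> x)\<close> obey the rule
  \<open>H (act a x, z) = H (x, a * z)\<close> of cut functions.\<close>

definition orbit_integrand :: "('a \<Rightarrow> real) \<Rightarrow> 'a \<Rightarrow> real \<Rightarrow> complex" where
  "orbit_integrand k x t = cis t * of_real (k (act (cis t) x))"

definition orbit_average :: "('a \<Rightarrow> real) \<Rightarrow> 'a \<Rightarrow> complex" where
  "orbit_average k x = (if x \<in> V0 then integral {0..2 * pi} (orbit_integrand k x) else 0)"

lemma cis_circle: "cis t \<in> circle" by simp

lemma act_orbit_continuous:
  assumes "x \<in> V0"
  shows "continuous_map (top_of_set circle) (mtop M) (\<lambda>a. act a x)"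
proof -
  have "continuous_map (top_of_set circle) (prod_topology (top_of_set circle) (subtopology (mtop M) D)) (\<lambda>a. (a, x))"
    using assms V0_D V0_topspace by (auto simp: continuous_map_paired continuous_map_const)
  from continuous_map_compose[OF this act_continuous]
  have "continuous_map (top_of_set circle) (subtopology (mtop M) D) (\<lambda>a. act a x)" by (simp add: o_def)
  then show ?thesis using continuous_map_in_subtopology by blast
qed

lemma orbit_integrand_continuous:
  assumes k: "k \<in> smooth_functions M" and x: "x \<in> V0"
  shows "continuous_on UNIV (orbit_integrand k x)"
proof -
  have "continuous_map (top_of_set circle) euclidean (k \<circ> (\<lambda>a. act a x))"
    by (rule continuous_map_compose[OF act_orbit_continuous[OF x] smooth_functions_continuous[OF k]])
  then have "continuous_on circle (\<lambda>a. k (act a x))" by (simp add: o_def)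
  then have "continuous_on UNIV (\<lambda>t. k (act (cis t) x))"
    by (rule continuous_on_compose2[of circle _ UNIV cis]) (auto intro!: continuous_intros)
  then show ?thesis unfolding orbit_integrand_def by (intro continuous_intros)
qed

text \<open>An orbit need not fit into one chart, so the integrand has a smooth extension in
  coordinates only over short arcs. \<open>Bolzano\<close> assembles the interval: arcs around each
  \<open>t\<close> suffice, since integrals over adjacent intervals add.\<close>

lemma orbit_integral_smooth_near:
  assumes k: "k \<in> smooth_functions M" and U: "(U, \<phi>) \<in> charts M" "x \<in> U" "x \<in> V0" and ab: "a \<le> b"
  shows "smooth_near (U \<inter> V0) \<phi> x (\<lambda>y. integral {a..b} (orbit_integrand k y))"
  using ab
proof (induction rule: Bolzano)
  case (trans a b d)
  have xU: "x \<in> U \<inter> V0" using U by blast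
  have "integral {a..b} (orbit_integrand k y) + integral {b..d} (orbit_integrand k y) = integral {a..d} (orbit_integrand k y)"
    if "y \<in> U \<inter> V0" for y
    using that trans orbit_integrand_continuous[OF k, of y]
    by (intro Henstock_Kurzweil_Integration.integral_combine integrable_continuous_real) (auto intro: continuous_on_subset)
  with smooth_near_add[OF trans(1,2) xU] show ?case by (rule smooth_near_cong)
next
  case (local t)
  have tc: "act (cis t) x \<in> V0" by (rule act_V0[OF cis_circle U(3)])
  then obtain V \<psi> where V: "(V, \<psi>) \<in> charts M" "act (cis t) x \<in> V" using chart_ex V0_topspace by blast
  obtain W A where A: "open W" "(cis t, \<phi> x) \<in> W" "Cinf W A"
    "\<And>b y. b \<in> circle \<Longrightarrow> y \<in> U \<Longrightarrow> y \<in> V0 \<Longrightarrow> (b, \<phi> y) \<in> W \<Longrightarrow> act b y \<in> V \<and> A (b, \<phi> y) = \<psi> (act b y)"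
    using act_local[OF U V cis_circle] by metis
  obtain W2 K where K: "local_ext V \<psi> (act (cis t) x) k W2 K"
    using smooth_functionsD[OF good k V] by (elim smooth_nearE)
  define g where "g = (\<lambda>z::'e \<times> real. (cis (snd z), fst z))"
  have g: "Cinf UNIV g" unfolding g_def
    by (intro Cinf_Pair Cinf_fst Cinf_compose[OF Cinf_snd Cinf_cis]) auto
  define \<Omega>1 where "\<Omega>1 = g -` W"
  have \<Omega>1: "open \<Omega>1" using open_Int_vimage_Cinf[OF open_UNIV g A(1)] by (simp add: \<Omega>1_def)
  have Ag: "Cinf \<Omega>1 (\<lambda>z. A (g z))"
    by (rule Cinf_compose[OF Cinf_subset[OF g] A(3)]) (auto simp: \<Omega>1_def)
  define \<Omega> where "\<Omega> = \<Omega>1 \<inter> (\<lambda>z. A (g z)) -` W2"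
  have \<Omega>: "open \<Omega>" unfolding \<Omega>_def by (rule open_Int_vimage_Cinf[OF \<Omega>1 Ag local_ext_open[OF K]])
  define P where "P = (\<lambda>z. cis (snd z) * of_real (K (A (g z))))"
  have KA: "Cinf \<Omega> (\<lambda>z. K (A (g z)))"
    by (rule Cinf_compose[OF Cinf_subset[OF Ag] local_ext_Cinf[OF K]]) (auto simp: \<Omega>_def)
  have P: "Cinf \<Omega> P" unfolding P_def
    by (intro Cinf_mult Cinf_linear_comp[OF bounded_linear_of_real KA] Cinf_compose[OF Cinf_snd Cinf_cis]) auto
  have m: "(\<phi> x, t) \<in> \<Omega>"
    using A(2) A(4)[OF cis_circle U(2,3) A(2)] local_ext_mem[OF K] by (simp add: \<Omega>_def \<Omega>1_def g_def)
  obtain S T where S: "open S" "open T" "(\<phi> x, t) \<in> S \<times> T" "S \<times> T \<subseteq> \<Omega>"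
    by (rule open_prod_elim[OF \<Omega> m], rule that)
  then have ST: "open S" "open T" "\<phi> x \<in> S" "t \<in> T" "S \<times> T \<subseteq> \<Omega>" by simp_all
  obtain d where d: "d > 0" "ball t d \<subseteq> T" using ST(2,4) openE by blast
  have "smooth_near (U \<inter> V0) \<phi> x (\<lambda>y. integral {a..b} (orbit_integrand k y))" if ab: "a \<le> t" "t \<le> b" "b - a < d" for a b
  proof -
    have "{a..b} \<subseteq> ball t d" using ab by (auto simp: dist_real_def)
    then have sub: "S \<times> {a..b} \<subseteq> \<Omega>" using ST(5) d(2) by blast
    have "local_ext (U \<inter> V0) \<phi> x (\<lambda>y. integral {a..b} (orbit_integrand k y)) S (\<lambda>y. integral {a..b} (\<lambda>t. P (y, t)))"
      unfolding local_ext_def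
    proof (intro conjI ballI impI ST(1,3) Cinf_param_integral[OF ST(1) sub P])
      fix y assume y: "y \<in> U \<inter> V0" "\<phi> y \<in> S"
      show "integral {a..b} (\<lambda>t. P (\<phi> y, t)) = integral {a..b} (orbit_integrand k y)"
      proof (rule integral_cong)
        fix s assume "s \<in> {a..b}"
        then have s: "(\<phi> y, s) \<in> \<Omega>" using sub y by blast
        then have W: "(cis s, \<phi> y) \<in> W" by (simp add: \<Omega>_def \<Omega>1_def g_def)
        have "act (cis s) y \<in> V" "A (cis s, \<phi> y) = \<psi> (act (cis s) y)" using A(4)[OF cis_circle _ _ W] y by auto
        moreover have "A (cis s, \<phi> y) \<in> W2" using s by (simp add: \<Omega>_def g_def)
        ultimately show "P (\<phi> y, s) = orbit_integrand k y s"
          using local_ext_eq[OF K, of "act (cis s) y"] by (simp add: P_def g_def orbit_integrand_def)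
      qed
    qed
    then show ?thesis by (rule local_ext_smooth_near)
  qed
  then show ?case using d(1) by blast
qed

text \<open>The value 0 outside \<open>V0\<close> joins smoothly: the average vanishes off the union
  of the orbits through \<open>K\<close>, and this union is compact, hence closed, and contained in
  \<open>V0\<close>.\<close>

lemma orbit_average_smooth_at:
  assumes k: "k \<in> smooth_functions M" and K: "compactin (mtop M) K" "K \<subseteq> V0" "\<And>x. x \<notin> K \<Longrightarrow> k x = 0"
    and x: "x \<in> topspace (mtop M)"
  shows "smooth_at M x (orbit_average k)"
proof (cases "x \<in> V0")
  case True
  obtain U \<phi> where U: "(U, \<phi>) \<in> charts M" "x \<in> U" using chart_ex x by blast
  have l: "smooth_near (U \<inter> V0) \<phi> x (\<lambda>y. integral {0..2 * pi} (orbit_integrand k y))"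
    by (rule orbit_integral_smooth_near[OF k U True]) simp
  have "smooth_near (U \<inter> UNIV) \<phi> x (orbit_average k)"
    by (rule smooth_near_local[OF U l V0_open True]) (auto simp: orbit_average_def)
  then show ?thesis using smooth_atI[OF U] by simp
next
  case False
  let ?C = "(\<lambda>(a, x). act a x) ` (circle \<times> K)"
  have C: "closedin (mtop M) ?C" by (rule orbit_closed[OF _ _ K(1,2)]) auto
  then have "openin (mtop M) (topspace (mtop M) - ?C)" by blast
  moreover have "?C \<subseteq> V0" using act_V0 K(2) by auto
  then have "x \<in> topspace (mtop M) - ?C" using False x by blast
  moreover have "orbit_average k y = 0" if "y \<notin> ?C" for y
  proof (cases "y \<in> V0")
    case True
    have "k (act (cis t) y) = 0" for t
    proof (rule K(3), rule notI)
      assume "act (cis t) y \<in> K"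
      then have "act (cis (-t)) (act (cis t) y) \<in> ?C" by force
      moreover have "act (cis (-t)) (act (cis t) y) = y"
        using act_act[OF cis_circle cis_circle True, of "-t" t] act_one[OF True] by (simp add: cis_mult)
      ultimately show False using that by simp
    qed
    then have "orbit_integrand k y = (\<lambda>t. 0)" by (simp add: orbit_integrand_def fun_eq_iff)
    then show ?thesis by (simp add: orbit_average_def)
  qed (simp add: orbit_average_def)
  ultimately show ?thesis
    by (intro smooth_at_local[OF smooth_at_const[OF x, of 0]]) auto
qed

lemma circle_cis:
  assumes "a \<in> circle"
  obtains t where "0 \<le> t" "t \<le> 2 * pi" "a = cis t"
proof -
  have "norm a = 1" using assms by simp
  then obtain t where "0 \<le> t" "t < 2 * pi" "a = Complex (cos t) (sin t)" by (rule complex_unimodular_polar)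
  then show ?thesis by (intro that[of t]) (auto simp: cis.ctr)
qed

text \<open>Moving along the orbit by the angle of \<open>a\<close> shifts the parameter; the weight
  contributes the constant factor, and periodicity makes the integral insensitive to the
  shift.\<close>

lemma orbit_average_equivariant:
  assumes k: "k \<in> smooth_functions M" and a: "a \<in> circle" and x: "x \<in> V0"
  shows "orbit_average k (act a x) = cnj a * orbit_average k x"
proof -
  obtain \<alpha> where \<alpha>: "0 \<le> \<alpha>" "\<alpha> \<le> 2 * pi" "a = cis \<alpha>" using circle_cis[OF a] by blast
  let ?J = "orbit_integrand k x"
  have J: "continuous_on UNIV ?J" by (rule orbit_integrand_continuous[OF k x])
  have "orbit_integrand k (act a x) t = cis (- \<alpha>) * ?J (t + \<alpha>)" for t
  proof -
    have "act (cis t) (act a x) = act (cis (t + \<alpha>)) x"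
      using act_act[OF cis_circle a x, of t] \<alpha>(3) by (simp add: cis_mult)
    moreover have "cis t = cis (- \<alpha>) * cis (t + \<alpha>)" by (simp add: cis_mult)
    ultimately show ?thesis unfolding orbit_integrand_def by (simp only: mult.assoc)
  qed
  then have "orbit_integrand k (act a x) = (\<lambda>t. cis (- \<alpha>) * ?J (t + \<alpha>))" by (rule ext)
  then have "orbit_average k (act a x) = integral {0..2 * pi} (\<lambda>t. cis (- \<alpha>) * ?J (t + \<alpha>))"
    using act_V0[OF a x] by (simp add: orbit_average_def)
  also have "\<dots> = cis (- \<alpha>) * integral {0..2 * pi} (\<lambda>t. ?J (t + \<alpha>))"
    by (rule integral_mult_right)
  also have "integral {0..2 * pi} (\<lambda>t. ?J (t + \<alpha>)) = integral {0..2 * pi} ?J"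
    by (rule integral_periodic_shift[OF J _ \<alpha>(1,2)]) (simp add: orbit_integrand_def cis_mult[symmetric])
  finally show ?thesis using x \<alpha>(3) by (simp add: orbit_average_def cis_cnj)
qed

text \<open>
  Since the action is free, a bump function at \<open>p\<close> with small support only sees the part of the
  orbit where \<open>cos > 0\<close>, so that its weighted average does not vanish at \<open>p\<close>.
\<close>

lemma equivariant_function:
  assumes p: "p \<in> V0"
  obtains \<zeta> :: "'a \<Rightarrow> complex" where "\<And>x. x \<in> topspace (mtop M) \<Longrightarrow> smooth_at M x \<zeta>" "\<And>x. x \<notin> V0 \<Longrightarrow> \<zeta> x = 0"
    "\<And>a x. a \<in> circle \<Longrightarrow> x \<in> V0 \<Longrightarrow> \<zeta> (act a x) = cnj a * \<zeta> x" "\<zeta> p \<noteq> 0"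
proof -
  \<comment> \<open>The half of the circle where the weight has nonpositive real part. By freeness
    the corresponding part of the orbit misses \<open>p\<close>; being closed, it can be kept away
    from the support of the bump function.\<close>
  let ?A = "{a \<in> circle. Re a \<le> 0}"
  let ?C = "(\<lambda>(a, x). act a x) ` (?A \<times> {p})"
  have "?A = circle \<inter> {a. Re a \<le> 0}" by auto
  then have "compact ?A" using closed_halfspace_Re_le[of 0] by (simp add: compact_Int_closed)
  moreover have "compactin (mtop M) {p}" using V0_topspace[OF p] by (simp add: finite_imp_compactin)
  ultimately have C: "closedin (mtop M) ?C" by (intro orbit_closed) (use p in auto)
  have pC: "p \<notin> ?C"
  proof
    assume "p \<in> ?C"
    then obtain a where a: "a \<in> circle" "Re a \<le> 0" "act a p = p" by auto
    then have "a = 1" using act_free[OF _ p] by blast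
    then show False using a by simp
  qed
  have S: "openin (mtop M) (V0 - ?C)" "p \<in> V0 - ?C" using V0_open C p pC by auto
  obtain \<rho> S' K where bump: "bump_on M p (V0 - ?C) \<rho> S' K"
    by (rule bump[OF S], rule that)
  note * = bump_onD[OF bump]
  have J: "continuous_on UNIV (orbit_integrand \<rho> p)" by (rule orbit_integrand_continuous[OF *(1) p])
  let ?R = "\<lambda>t. Re (orbit_integrand \<rho> p t)"
  have cR: "continuous_on {0..2 * pi} ?R"
    by (rule continuous_on_subset[of UNIV]) (intro continuous_intros J, simp)
  have pos: "0 \<le> ?R t" for t
  proof (cases "act (cis t) p \<in> K")
    case True
    have "cis t \<notin> ?A"
    proof
      assume "cis t \<in> ?A"
      then have "act (cis t) p \<in> ?C" by force
      then show False using True *(8) by blast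
    qed
    then have "cos t > 0" by simp
    then show ?thesis using *(2) by (simp add: orbit_integrand_def)
  next
    case False
    then show ?thesis using *(9) by (simp add: orbit_integrand_def)
  qed
  \<comment> \<open>If the average vanished, the continuous nonnegative real part of the integrand
    would have integral 0 and so vanish at \<open>t = 0\<close>, where its value is
    \<open>\<rho> p = 1\<close>.\<close>
  have "orbit_average \<rho> p \<noteq> 0"
  proof
    assume "orbit_average \<rho> p = 0"
    then have "(orbit_integrand \<rho> p has_integral 0) {0..2 * pi}"
      using integrable_integral[OF integrable_continuous_real[OF continuous_on_subset[OF J]]] p
      by (metis orbit_average_def subset_UNIV)
    then have "(?R has_integral 0) (cbox 0 (2 * pi))"
      using has_integral_linear[OF _ bounded_linear_Re, of "orbit_integrand \<rho> p" 0] by (simp add: o_def)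
    then have "?R 0 = 0"
      by (intro has_integral_0_cbox_imp_0[of 0 "2 * pi" ?R]) (use cR pos pi_gt_zero in \<open>auto simp: not_le\<close>)
    moreover have "\<rho> (act 1 p) = 1" using *(4,6) act_one[OF p] by simp
    ultimately show False by (simp add: orbit_integrand_def)
  qed
  moreover have "K \<subseteq> V0" using *(8) by blast
  ultimately show ?thesis
    using that[of "orbit_average \<rho>"] orbit_average_smooth_at[OF *(1,7) _ *(9)] orbit_average_equivariant[OF *(1)]
    by (simp add: orbit_average_def)
qed

end

section \<open>Smooth functions on the cut space\<close>

lemma good_charts_euclid: "good_charts (euclid S)"
  by (auto simp: good_charts_def euclid_def subtopology_subtopology)

lemma good_charts_prod:
  assumes P: "good_charts P" and Q: "good_charts Q"
  shows "good_charts (prod_charted P Q)"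
proof -
  have 1: "openin (prod_topology (mtop P) (mtop Q)) (U \<times> V) \<and> inj_on (map_prod \<phi> \<psi>) (U \<times> V) \<and>
      continuous_map (subtopology (prod_topology (mtop P) (mtop Q)) (U \<times> V)) euclidean (map_prod \<phi> \<psi>)"
    if U: "(U, \<phi>) \<in> charts P" and V: "(V, \<psi>) \<in> charts Q" for U \<phi> V \<psi>
  proof (intro conjI)
    have u: "openin (mtop P) U" "inj_on \<phi> U" "continuous_map (subtopology (mtop P) U) euclidean \<phi>"
      and v: "openin (mtop Q) V" "inj_on \<psi> V" "continuous_map (subtopology (mtop Q) V) euclidean \<psi>"
      using P Q U V by (auto simp: good_charts_def)
    show "openin (prod_topology (mtop P) (mtop Q)) (U \<times> V)" using u v by (simp add: openin_prod_Times_iff)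
    show "inj_on (map_prod \<phi> \<psi>) (U \<times> V)" using u v by (auto simp: inj_on_def)
    have "continuous_map (prod_topology (subtopology (mtop P) U) (subtopology (mtop Q) V))
        (prod_topology euclidean euclidean) (\<lambda>z. (\<phi> (fst z), \<psi> (snd z)))"
      unfolding continuous_map_paired
      using continuous_map_compose[OF continuous_map_fst u(3), unfolded o_def]
        continuous_map_compose[OF continuous_map_snd v(3), unfolded o_def] by blast
    moreover have "(\<lambda>z. (\<phi> (fst z), \<psi> (snd z))) = map_prod \<phi> \<psi>" by (auto simp: fun_eq_iff)
    ultimately show "continuous_map (subtopology (prod_topology (mtop P) (mtop Q)) (U \<times> V)) euclidean (map_prod \<phi> \<psi>)"
      by (simp add: subtopology_Times euclidean_product_topology)
  qed
  have "topspace (mtop P) \<times> topspace (mtop Q) = (\<Union>(U, \<phi>)\<in>charts P. U) \<times> (\<Union>(V, \<psi>)\<in>charts Q. V)"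
    using P Q by (simp add: good_charts_def)
  moreover have "(\<Union>(U, \<phi>)\<in>charts P. U) \<times> (\<Union>(V, \<psi>)\<in>charts Q. V) = (\<Union>(W, \<theta>)\<in>charts (prod_charted P Q). W)"
  proof
    show "(\<Union>(W, \<theta>)\<in>charts (prod_charted P Q). W) \<subseteq> (\<Union>(U, \<phi>)\<in>charts P. U) \<times> (\<Union>(V, \<psi>)\<in>charts Q. V)"
      by (auto simp: prod_charted_def)
    show "(\<Union>(U, \<phi>)\<in>charts P. U) \<times> (\<Union>(V, \<psi>)\<in>charts Q. V) \<subseteq> (\<Union>(W, \<theta>)\<in>charts (prod_charted P Q). W)"
    proof
      fix w assume "w \<in> (\<Union>(U, \<phi>)\<in>charts P. U) \<times> (\<Union>(V, \<psi>)\<in>charts Q. V)"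
      then obtain U \<phi> V \<psi> where "(U, \<phi>) \<in> charts P" "(V, \<psi>) \<in> charts Q" "w \<in> U \<times> V" by auto
      then have "(U \<times> V, map_prod \<phi> \<psi>) \<in> charts (prod_charted P Q)" "w \<in> U \<times> V" by (auto simp: prod_charted_def)
      then show "w \<in> (\<Union>(W, \<theta>)\<in>charts (prod_charted P Q). W)" by (intro UN_I) auto
    qed
  qed
  moreover have "topspace (mtop (prod_charted P Q)) = topspace (mtop P) \<times> topspace (mtop Q)"
    by (simp add: prod_charted_def)
  ultimately have 2: "topspace (mtop (prod_charted P Q)) = (\<Union>(W, \<theta>)\<in>charts (prod_charted P Q). W)" by simp
  show ?thesis
    unfolding good_charts_def
  proof (intro conjI 2)
    show "\<forall>(W, \<theta>)\<in>charts (prod_charted P Q). openin (mtop (prod_charted P Q)) W \<and> inj_on \<theta> W \<and>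
        continuous_map (subtopology (mtop (prod_charted P Q)) W) euclidean \<theta>"
      unfolding prod_charted_def using 1 by auto
  qed
qed

lemma smooth_near_prod_fst:
  fixes \<phi> :: "'a \<Rightarrow> 'e::euclidean_space" and \<psi> :: "'b \<Rightarrow> 'f::euclidean_space" and g :: "'a \<Rightarrow> 'c::euclidean_space"
  assumes "smooth_near U \<phi> x g"
  shows "smooth_near (U \<times> V) (map_prod \<phi> \<psi>) (x, z) (\<lambda>w. g (fst w))"
proof -
  obtain W G where G: "local_ext U \<phi> x g W G" using assms by (elim smooth_nearE)
  have "local_ext (U \<times> V) (map_prod \<phi> \<psi>) (x, z) (\<lambda>w. g (fst w)) (W \<times> UNIV) (\<lambda>y. G (fst y))"
    unfolding local_ext_def
  proof (intro conjI ballI impI)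
    show "open (W \<times> (UNIV :: 'f set))" using local_ext_open[OF G] by (simp add: open_Times)
    show "Cinf (W \<times> (UNIV :: 'f set)) (\<lambda>y. G (fst y))"
      by (rule Cinf_compose[OF Cinf_fst local_ext_Cinf[OF G]]) auto
  qed (use G in \<open>auto simp: local_ext_def\<close>)
  then show ?thesis by (rule local_ext_smooth_near)
qed

lemma smooth_near_prod_snd:
  fixes \<phi> :: "'a \<Rightarrow> 'e::euclidean_space" and V :: "'f::euclidean_space set"
  shows "smooth_near (U \<times> V) (map_prod \<phi> (\<lambda>x. x)) w snd"
proof -
  have "local_ext (U \<times> V) (map_prod \<phi> (\<lambda>x. x)) w (\<lambda>w. snd (map_prod \<phi> (\<lambda>x. x) w)) UNIV snd"
    by (rule local_ext_fun) (auto intro: Cinf_snd)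
  then show ?thesis by (auto intro: local_ext_smooth_near)
qed

context cutting
begin

lemma smooth_N: "smooth_functions N = cut_functions u M D act f"
  and quot: "quotient_map (mtop M) (mtop N) cmap"
  using cut by (auto simp: is_cut_manifold_def)

lemma cmap_continuous: "continuous_map (mtop M) (mtop N) cmap"
  using quot quotient_imp_continuous_map by blast

lemma cmap_surj: "cmap ` topspace (mtop M) = topspace (mtop N)"
  using quot quotient_imp_surjective_map by blast

lemma cmap_refl: "x \<in> topspace (mtop M) \<Longrightarrow> x \<in> cmap x"
  by (simp add: cut_map_def cut_rel_def)

lemma cmap_memD: "y \<in> cmap x \<Longrightarrow> y = x \<or> x \<in> bd \<and> (\<exists>a\<in>circle. y = act a x)"
  by (auto simp: cut_map_def cut_rel_def)

lemma circle_mult: "a \<in> circle \<Longrightarrow> b \<in> circle \<Longrightarrow> a * b \<in> circle"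
  by (simp add: norm_mult)

lemma circle_cnj: "a \<in> circle \<Longrightarrow> cnj a \<in> circle"
  by simp

lemma circle_mult_cnj: "a \<in> circle \<Longrightarrow> cnj a * a = 1"
  by (simp add: complex_norm_square[symmetric] mult.commute)

text \<open>The means of constructing smooth functions on \<open>N\<close>: by
  \<open>smooth_N\<close> a function on \<open>M\<close> together with a suitable \<open>H\<close>
  determines one. That \<open>g\<close> is constant on boundary orbits comes from the equivariance
  of \<open>H\<close> at \<open>z = 0\<close>.\<close>

lemma cut_function_descend:
  assumes g: "\<And>x. x \<in> topspace (mtop M) \<Longrightarrow> 0 < f x \<Longrightarrow> smooth_at M x g"
    and H: "\<And>U \<phi> x z. (U, \<phi>) \<in> charts M \<Longrightarrow> x \<in> U \<Longrightarrow> x \<in> V0 \<Longrightarrow>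
      smooth_near ((U \<inter> V0) \<times> UNIV) (map_prod \<phi> (\<lambda>x. x)) (x, z :: complex) H"
    and inv: "\<And>a x z. a \<in> circle \<Longrightarrow> x \<in> V0 \<Longrightarrow> H (act a x, z) = H (x, a * z)"
    and gH: "\<And>x. x \<in> V0 \<Longrightarrow> g x = H (x, complex_of_real (sqrt (f x)))"
  obtains h where "h \<in> smooth_functions N" "\<And>x. x \<in> topspace (mtop M) \<Longrightarrow> h (cmap x) = g x"
proof -
  \<comment> \<open>Points of \<open>N\<close> are equivalence classes, so a representative is
    chosen inside the class; \<open>cmap_memD\<close> confines the choice to \<open>x\<close> itself
    or, on the boundary, to its orbit.\<close>
  define h where "h = (\<lambda>A. g (SOME x. x \<in> A))"
  have h: "h (cmap x) = g x" if x: "x \<in> topspace (mtop M)" for x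
  proof -
    have "(SOME y. y \<in> cmap x) \<in> cmap x" using cmap_refl[OF x] by (rule someI)
    then have "(SOME y. y \<in> cmap x) = x \<or> x \<in> bd \<and> (\<exists>a\<in>circle. (SOME y. y \<in> cmap x) = act a x)"
      by (rule cmap_memD)
    moreover have "g (act a x) = g x" if a: "a \<in> circle" and xb: "x \<in> bd" for a
    proof -
      have V: "x \<in> V0" "act a x \<in> V0" "f x = 0" "f (act a x) = 0"
        using xb bdry_V0 act_bdry[OF a xb] bdry_eq by auto
      show ?thesis using gH[OF V(1)] gH[OF V(2)] inv[OF a V(1), of 0] V(3,4) by simp
    qed
    ultimately show ?thesis unfolding h_def by auto
  qed
  have "h \<circ> cmap \<in> smooth_functions (induced M (intr u M))"
  proof (rule smooth_functionsI[OF good_charts_induced[OF good]])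
    fix V \<phi> x assume "(V, \<phi>) \<in> charts (induced M (intr u M))" "x \<in> V"
    then obtain U where U: "V = U \<inter> intr u M" "(U, \<phi>) \<in> charts M" "x \<in> U" "x \<in> intr u M"
      by (auto simp: charts_induced)
    have "smooth_near U \<phi> x g" by (rule smooth_at_chart[OF g U(2,3)]) (use U(4) in \<open>auto simp: intr_eq\<close>)
    then show "smooth_near V \<phi> x (h \<circ> cmap)"
      by (rule smooth_near_mono[of U \<phi> x g UNIV]) (use U h in \<open>auto simp: intr_eq\<close>)
  qed
  moreover have "H \<in> smooth_functions (prod_charted (induced M V0) (euclid (UNIV :: complex set)))"
  proof (rule smooth_functionsI[OF good_charts_prod[OF good_charts_induced[OF good] good_charts_euclid]])
    fix W \<theta> w assume "(W, \<theta>) \<in> charts (prod_charted (induced M V0) (euclid (UNIV :: complex set)))" "w \<in> W"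
    then obtain U \<phi> where U: "(U, \<phi>) \<in> charts M" "W = (U \<inter> V0) \<times> UNIV" "\<theta> = map_prod \<phi> (\<lambda>x. x)" "w \<in> W"
      by (auto simp: prod_charted_def euclid_def charts_induced)
    then show "smooth_near W \<theta> w H" using H[OF U(1), of "fst w" "snd w"] by auto
  qed
  ultimately have "h \<in> cut_functions u M D act f"
    unfolding cut_functions_def using V0(1) inv gH h V0_topspace by (intro CollectI conjI exI[of _ V0] exI[of _ H]) auto
  then show ?thesis using that h smooth_N by blast
qed

text \<open>Moving the factor \<open>a\<close> from the second argument of \<open>H\<close> to the
  first gives the value at \<open>act a x\<close>, because \<open>f\<close> is invariant on
  \<open>V0\<close>. The neighbourhood \<open>V\<close> depends on \<open>h\<close>; shrinking
  \<open>W\<close> confines everything to \<open>V \<inter> V0\<close>.\<close>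

lemma cut_function_boundary:
  assumes h: "h \<in> smooth_functions N" and U: "(U, \<phi>) \<in> charts M" "p \<in> U" "p \<in> bd"
  obtains W G where "open W" "(\<phi> p, 0) \<in> W" "Cinf W G"
    "\<And>a x. a \<in> circle \<Longrightarrow> x \<in> U \<Longrightarrow> (\<phi> x, a * complex_of_real (sqrt (f x))) \<in> W \<Longrightarrow>
      x \<in> V0 \<and> G (\<phi> x, a * complex_of_real (sqrt (f x))) = h (cmap (act a x))"
proof -
  obtain V H where V: "invariant_nbhd u M D act V"
    and H: "H \<in> smooth_functions (prod_charted (induced M V) (euclid (UNIV :: complex set)))"
    and inv: "\<forall>a\<in>circle. \<forall>x\<in>V. \<forall>z. H (act a x, z) = H (x, a * z)"
    and hH: "\<forall>x\<in>V. (h \<circ> cmap) x = H (x, complex_of_real (sqrt (f x)))"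
    using h unfolding smooth_N cut_functions_def by blast
  have pV: "p \<in> V" using V U unfolding invariant_nbhd_def by blast
  have "((U \<inter> V) \<times> UNIV, map_prod \<phi> (\<lambda>x. x)) \<in> charts (prod_charted (induced M V) (euclid (UNIV :: complex set)))"
    using U(1) by (auto simp: prod_charted_def euclid_def charts_induced)
  then have "smooth_near ((U \<inter> V) \<times> UNIV) (map_prod \<phi> (\<lambda>x. x)) (p, 0 :: complex) H"
    by (rule smooth_functionsD[OF good_charts_prod[OF good_charts_induced[OF good] good_charts_euclid] H])
      (use U pV in auto)
  then obtain W G where G: "local_ext ((U \<inter> V) \<times> UNIV) (map_prod \<phi> (\<lambda>x. x)) (p, 0 :: complex) H W G"
    by (elim smooth_nearE)
  have "openin (mtop M) (V \<inter> V0)" using V V0_open unfolding invariant_nbhd_def by blast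
  then obtain \<Omega> where \<Omega>: "open \<Omega>" "\<And>x. x \<in> U \<Longrightarrow> \<phi> x \<in> \<Omega> \<longleftrightarrow> x \<in> V \<inter> V0"
    using chart_open_image[OF U(1)] by blast
  show ?thesis
  proof (rule that[of "W \<inter> (\<Omega> \<times> UNIV)" G])
    show "open (W \<inter> (\<Omega> \<times> UNIV))" using local_ext_open[OF G] \<Omega>(1) by (intro open_Int open_Times) auto
    show "(\<phi> p, 0) \<in> W \<inter> (\<Omega> \<times> UNIV)" using local_ext_mem[OF G] \<Omega>(2)[OF U(2)] pV U(3) bdry_V0 by auto
    show "Cinf (W \<inter> (\<Omega> \<times> UNIV)) G" by (rule Cinf_subset[OF local_ext_Cinf[OF G]]) auto
    fix a x assume a: "a \<in> circle" and x: "x \<in> U" and W: "(\<phi> x, a * complex_of_real (sqrt (f x))) \<in> W \<inter> (\<Omega> \<times> UNIV)"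
    have xV: "x \<in> V" "x \<in> V0" using W \<Omega>(2)[OF x] by auto
    have aV: "act a x \<in> V" using V a xV(1) unfolding invariant_nbhd_def by blast
    have "G (\<phi> x, a * complex_of_real (sqrt (f x))) = H (x, a * complex_of_real (sqrt (f x)))"
      using local_ext_eq[OF G, of "(x, a * complex_of_real (sqrt (f x)))"] x xV W by auto
    also have "\<dots> = H (act a x, complex_of_real (sqrt (f x)))" using inv a xV(1) by simp
    also have "\<dots> = h (cmap (act a x))" using hH[rule_format, OF aV] V0(2)[OF a xV(2)] by simp
    finally show "x \<in> V0 \<and> G (\<phi> x, a * complex_of_real (sqrt (f x))) = h (cmap (act a x))" using xV(2) by blast
  qed
qed

end

section \<open>Derivatives of cut functions at a boundary point\<close>

lemma Cinf_ray_derivative: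
  fixes F :: "'e::real_normed_vector \<Rightarrow> real"
  assumes F: "Cinf W F" "y \<in> W"
  shows "((\<lambda>t. F (y + t *\<^sub>R v)) has_real_derivative Df F y v) (at 0)"
proof -
  have 1: "((\<lambda>t. y + t *\<^sub>R v) has_derivative (\<lambda>t. t *\<^sub>R v)) (at 0)" by (auto intro!: derivative_eq_intros)
  have 2: "(F has_derivative Df F y) (at (y + 0 *\<^sub>R v))" using Cinf_has_derivative[OF F] by simp
  have "(\<lambda>t. Df F y (t *\<^sub>R v)) = (*) (Df F y v)"
    using linear_scale[OF Cinf_linear_Df[OF F]] by (simp add: fun_eq_iff mult.commute)
  with has_derivative_compose[OF 1 2] show ?thesis by (simp add: has_field_derivative_def)
qed

text \<open>Membership in \<open>bdry\<close> promises \<open>u \<bullet> \<phi> p = 0\<close> in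
  some chart only; the chart fixed here is such a witness.\<close>

locale cutting_pt = cutting E u M D act f N
  for E :: "'e::euclidean_space set" and u :: 'e and M :: "('a, 'e) charted"
    and D :: "'a set" and act :: "complex \<Rightarrow> 'a \<Rightarrow> 'a" and f :: "'a \<Rightarrow> real" and N :: "('a set, 'e) charted" +
  fixes p :: 'a and U :: "'a set" and \<phi> :: "'a \<Rightarrow> 'e"
  assumes p_bd: "p \<in> bd" and U: "(U, \<phi>) \<in> charts M" "p \<in> U" and u0: "u \<noteq> 0" and up: "u \<bullet> \<phi> p = 0"
begin

lemma p_V0: "p \<in> V0" and p_top: "p \<in> topspace (mtop M)" and fp: "f p = 0"
  using p_bd bdry_V0 bdry_eq by auto

lemma bdry_chart: "x \<in> U \<Longrightarrow> u \<bullet> \<phi> x = 0 \<Longrightarrow> x \<in> bd"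
  using U(1) u0 unfolding bdry_def by blast

lemma ray_chart:
  assumes v: "v \<in> E" "u \<bullet> v \<ge> 0"
  obtains \<epsilon> where "\<epsilon> > 0" "\<And>t. 0 \<le> t \<Longrightarrow> t < \<epsilon> \<Longrightarrow> \<exists>x\<in>U \<inter> V0. \<phi> x = \<phi> p + t *\<^sub>R v"
proof -
  obtain r where r: "r > 0" "\<And>y. y \<in> half_space E u \<Longrightarrow> y \<in> cball (\<phi> p) r \<Longrightarrow> y \<in> \<phi> ` (U \<inter> V0)"
    using chart_cball[OF U(1) V0_open U(2) p_V0] by blast
  obtain \<epsilon> where e: "\<epsilon> > 0" "\<And>t. \<bar>t\<bar> < \<epsilon> \<Longrightarrow> \<phi> p + t *\<^sub>R v \<in> ball (\<phi> p) r"
    using ray_in_open[of "ball (\<phi> p) r" "\<phi> p" v] r(1) by auto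
  have "\<exists>x\<in>U \<inter> V0. \<phi> x = \<phi> p + t *\<^sub>R v" if t: "0 \<le> t" "t < \<epsilon>" for t
  proof -
    have "\<phi> p + t *\<^sub>R v \<in> half_space E u"
      using chart_E[OF U] v t up subspace_E
      by (auto simp: half_space_def inner_add_right intro: subspace_add subspace_scale)
    moreover have "\<phi> p + t *\<^sub>R v \<in> cball (\<phi> p) r" using e(2)[of t] t ball_subset_cball by auto
    ultimately have "\<phi> p + t *\<^sub>R v \<in> \<phi> ` (U \<inter> V0)" by (rule r(2))
    then show ?thesis by force
  qed
  with e(1) show ?thesis by (rule that)
qed

lemma tangent_dir_bdry:
  assumes v: "v \<in> E" "u \<bullet> v = 0"
  shows "tangent_dir (\<phi> ` (U \<inter> bd)) (\<phi> p) v"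
proof -
  obtain \<epsilon> where e: "\<epsilon> > 0" "\<And>t. 0 \<le> t \<Longrightarrow> t < \<epsilon> \<Longrightarrow> \<exists>x\<in>U \<inter> V0. \<phi> x = \<phi> p + t *\<^sub>R v"
    using ray_chart[of v] v by auto
  show ?thesis
  proof (rule tangent_dir_ray[OF e(1)])
    fix t :: real assume "0 \<le> t" "t < \<epsilon>"
    then obtain x where x: "x \<in> U \<inter> V0" "\<phi> x = \<phi> p + t *\<^sub>R v" using e(2) by blast
    have "u \<bullet> \<phi> x = 0" using x(2) up v by (simp add: inner_add_right)
    then have "x \<in> bd" using bdry_chart x by blast
    then show "\<phi> p + t *\<^sub>R v \<in> \<phi> ` (U \<inter> bd)" using x by (metis IntD1 IntI imageI)
  qed
qed

text \<open>\<open>Df F\<close> kills the boundary directions because \<open>f\<close> vanishes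
  along them. If it killed \<open>u\<close> too, it would vanish on \<open>E\<close> and every
  derivation at \<open>p\<close> would annihilate \<open>f\<close>, against the nonvanishing of
  \<open>df\<close>. The sign comes from \<open>f \<ge> 0\<close> along the inward ray.\<close>

lemma f_extension:
  obtains W F where "local_ext U \<phi> p f W F" "0 < Df F (\<phi> p) u" "\<And>v. v \<in> E \<Longrightarrow> u \<bullet> v = 0 \<Longrightarrow> Df F (\<phi> p) v = 0"
proof -
  obtain W F where F: "local_ext U \<phi> p f W F" using smooth_functionsD[OF good f_smooth U] by (elim smooth_nearE)
  have K: "Df F (\<phi> p) v = 0" if v: "v \<in> E" "u \<bullet> v = 0" for v
  proof (rule tangent_dirD[OF tangent_dir_bdry[OF v] local_ext_open[OF F] local_ext_mem[OF F] local_ext_Cinf[OF F]])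
    fix z assume "z \<in> \<phi> ` (U \<inter> bd)" "z \<in> W"
    then show "F z = 0" using F bdry_eq by (auto simp: local_ext_def)
  qed
  have lin: "linear (Df F (\<phi> p))" by (rule Cinf_linear_Df[OF local_ext_Cinf[OF F] local_ext_mem[OF F]])
  have ne: "Df F (\<phi> p) u \<noteq> 0"
  proof
    assume z: "Df F (\<phi> p) u = 0"
    have zE: "Df F (\<phi> p) w = 0" if w: "w \<in> E" for w
    proof -
      let ?c = "(u \<bullet> w) / (u \<bullet> u)"
      have "w - ?c *\<^sub>R u \<in> E" using w u_E subspace_E by (intro subspace_diff subspace_scale)
      moreover have "u \<bullet> (w - ?c *\<^sub>R u) = 0" using u0 by (simp add: inner_diff_right)
      ultimately have "Df F (\<phi> p) (w - ?c *\<^sub>R u) = 0" by (rule K)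
      then show ?thesis using z lin by (simp add: linear_diff linear_scale)
    qed
    obtain X where X: "X \<in> tangent_space M p" "X f \<noteq> 0" using df_nonzero[OF p_bd] by blast
    obtain \<rho> xs S C where c: "\<rho> \<in> smooth_functions M" "compactin (mtop M) C" "C \<subseteq> U" "\<And>x. x \<notin> C \<Longrightarrow> \<rho> x = 0"
      "openin (mtop M) S" "p \<in> S" "S \<subseteq> U" "\<And>x. x \<in> S \<Longrightarrow> \<rho> x = 1"
      "\<And>b. xs b \<in> smooth_functions M" "\<And>b x. x \<in> S \<Longrightarrow> xs b x = \<phi> x \<bullet> b"
      using coordinate_functions[OF U] by metis
    obtain B where B: "finite B" "B \<subseteq> E" "\<And>y. y \<in> E \<Longrightarrow> y = (\<Sum>b\<in>B. (y \<bullet> b) *\<^sub>R b)"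
      using orthonormal_expansion[OF subspace_E] by metis
    have "X f = (\<Sum>b\<in>B. X (xs b) * Df F (\<phi> p) b)"
      by (rule tangent_chart_formula[OF U X(1) B c(9,5,6,7,10) f_smooth F])
    also have "\<dots> = 0" using zE B(2) by (intro sum.neutral) auto
    finally show False using X(2) by simp
  qed
  have "\<not> Df F (\<phi> p) u < 0"
  proof
    assume neg: "Df F (\<phi> p) u < 0"
    have Fp: "F (\<phi> p) = 0" using F U(2) fp by (auto simp: local_ext_def)
    have "((\<lambda>t. F (\<phi> p + t *\<^sub>R u)) has_real_derivative Df F (\<phi> p) u) (at 0)"
      by (rule Cinf_ray_derivative[OF local_ext_Cinf[OF F] local_ext_mem[OF F]])
    from has_real_derivative_neg_dec_right[OF this neg]
    obtain d where d: "d > 0" "\<And>h. 0 < h \<Longrightarrow> h < d \<Longrightarrow> F (\<phi> p + h *\<^sub>R u) < 0" using Fp by auto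
    obtain \<epsilon> where e: "\<epsilon> > 0" "\<And>t. 0 \<le> t \<Longrightarrow> t < \<epsilon> \<Longrightarrow> \<exists>x\<in>U \<inter> V0. \<phi> x = \<phi> p + t *\<^sub>R u"
      using ray_chart[OF u_E] by auto
    obtain \<delta> where \<delta>: "\<delta> > 0" "\<And>t. \<bar>t\<bar> < \<delta> \<Longrightarrow> \<phi> p + t *\<^sub>R u \<in> W"
      using ray_in_open[OF local_ext_open[OF F] local_ext_mem[OF F], of u] by blast
    define t where "t = min d (min \<epsilon> \<delta>) / 2"
    have t: "0 < t" "t < d" "t < \<epsilon>" "t < \<delta>" using d e \<delta> by (auto simp: t_def)
    obtain x where x: "x \<in> U \<inter> V0" "\<phi> x = \<phi> p + t *\<^sub>R u" using e(2)[of t] t by auto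
    have "f x = F (\<phi> p + t *\<^sub>R u)" using local_ext_eq[OF F, of x] x \<delta>(2)[of t] t by auto
    then show False using d(2)[OF t(1,2)] f_nonneg[of x] x V0_topspace by auto
  qed
  then have "0 < Df F (\<phi> p) u" using ne by linarith
  with F K show ?thesis using that by blast
qed

text \<open>
  A function on the cut space with lift \<open>x \<mapsto> H (x, \<surd>f x)\<close> takes the value \<open>H (x, a \<surd>f x)\<close> at the class
  of \<open>a \<cdot> x\<close>, by equivariance of \<open>H\<close>. The pair \<open>(a, x)\<close> stands for this class, with coordinates \<open>\<Psi>\<close>; the
  two values of \<open>a\<close> suffice to reach all complex directions.
\<close>

definition UU :: "(complex \<times> 'a) set" where "UU = {1, \<i>} \<times> (U \<inter> V0)"

definition \<Psi> :: "complex \<times> 'a \<Rightarrow> 'e \<times> complex" where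
  "\<Psi> w = (\<phi> (snd w), fst w * complex_of_real (sqrt (f (snd w))))"

definition FF :: "complex \<times> 'a \<Rightarrow> 'a set" where "FF w = cmap (act (fst w) (snd w))"

definition Phi :: "'e \<Rightarrow> complex \<Rightarrow> 'a set tvec" where
  "Phi v z = coord_vec N UU \<Psi> FF (1, p) (v, z)"

lemma pt_UU: "(1, p) \<in> UU" and \<Psi>_pt: "\<Psi> (1, p) = (\<phi> p, 0)" and FF_pt: "FF (1, p) = cmap p"
  using U(2) p_V0 fp act_one[OF p_V0] by (auto simp: UU_def \<Psi>_def FF_def)

lemma tangent_dir_\<Psi>_fst:
  assumes v: "v \<in> E" "u \<bullet> v = 0"
  shows "tangent_dir (\<Psi> ` UU) (\<Psi> (1, p)) (v, 0)"
proof -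
  obtain \<epsilon> where e: "\<epsilon> > 0" "\<And>t. 0 \<le> t \<Longrightarrow> t < \<epsilon> \<Longrightarrow> \<exists>x\<in>U \<inter> V0. \<phi> x = \<phi> p + t *\<^sub>R v"
    using ray_chart[of v] v by auto
  show ?thesis unfolding \<Psi>_pt
  proof (rule tangent_dir_ray[OF e(1)])
    fix t :: real assume "0 \<le> t" "t < \<epsilon>"
    then obtain x where x: "x \<in> U \<inter> V0" "\<phi> x = \<phi> p + t *\<^sub>R v" using e(2) by blast
    have "u \<bullet> \<phi> x = 0" using x(2) up v by (simp add: inner_add_right)
    then have "f x = 0" using bdry_chart x bdry_eq by auto
    then have "(\<phi> p, 0) + t *\<^sub>R (v, 0) = \<Psi> (1, x)" using x by (simp add: \<Psi>_def)
    moreover have "(1, x) \<in> UU" using x by (simp add: UU_def)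
    ultimately show "(\<phi> p, 0) + t *\<^sub>R (v, 0) \<in> \<Psi> ` UU" by (rule image_eqI)
  qed
qed

text \<open>
  The curve \<open>t \<mapsto> (\<phi> p + t\<^sup>2 u, a \<surd>f)\<close> in the image of \<open>\<Psi>\<close> has a velocity in the complex
  direction, because \<open>f\<close> vanishes to first order at the boundary.
\<close>

lemma tangent_dir_\<Psi>_snd_unit:
  assumes a: "a \<in> {1, \<i>}"
  shows "tangent_dir (\<Psi> ` UU) (\<Psi> (1, p)) (0, a)"
proof -
  obtain W F where F: "local_ext U \<phi> p f W F" "0 < Df F (\<phi> p) u" using f_extension by metis
  let ?d = "Df F (\<phi> p) u"
  obtain \<epsilon>1 where e1: "\<epsilon>1 > 0" "\<And>t. 0 \<le> t \<Longrightarrow> t < \<epsilon>1 \<Longrightarrow> \<exists>x\<in>U \<inter> V0. \<phi> x = \<phi> p + t *\<^sub>R u"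
    using ray_chart[OF u_E] by auto
  obtain \<delta> where \<delta>: "\<delta> > 0" "\<And>t. \<bar>t\<bar> < \<delta> \<Longrightarrow> \<phi> p + t *\<^sub>R u \<in> W"
    using ray_in_open[OF local_ext_open[OF F(1)] local_ext_mem[OF F(1)], of u] by blast
  have Fp: "F (\<phi> p) = 0" using F(1) U(2) fp by (auto simp: local_ext_def)
  have "((\<lambda>t. F (\<phi> p + t *\<^sub>R u)) has_real_derivative ?d) (at 0)"
    by (rule Cinf_ray_derivative[OF local_ext_Cinf[OF F(1)] local_ext_mem[OF F(1)]])
  then have L: "((\<lambda>s. F (\<phi> p + s *\<^sub>R u) / s) \<longlongrightarrow> ?d) (at 0)" using Fp by (simp add: DERIV_def)
  have "filterlim (\<lambda>t::real. t\<^sup>2) (at 0) (at 0 within {0..})"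
    by (rule filterlim_atI) (auto intro!: tendsto_eq_intros simp: eventually_at_filter)
  from filterlim_compose[OF L this]
  have "((\<lambda>t. F (\<phi> p + t\<^sup>2 *\<^sub>R u) / t\<^sup>2) \<longlongrightarrow> ?d) (at 0 within {0..})" .
  then have "((\<lambda>t. sqrt (F (\<phi> p + t\<^sup>2 *\<^sub>R u) / t\<^sup>2)) \<longlongrightarrow> sqrt ?d) (at 0 within {0..})"
    by (rule tendsto_real_sqrt)
  \<comment> \<open>For \<open>t > 0\<close> the root of \<open>F / t^2\<close> is
    \<open>sqrt F / t\<close>, the difference quotient of \<open>sqrt F\<close> along the curve; for
    negative \<open>t\<close> the sign would be wrong, hence the one-sided filter.\<close>
  then have "((\<lambda>t. (sqrt (F (\<phi> p + t\<^sup>2 *\<^sub>R u)) - sqrt (F (\<phi> p + 0\<^sup>2 *\<^sub>R u))) / (t - 0)) \<longlongrightarrow> sqrt ?d) (at 0 within {0..})"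
    by (rule Lim_transform_eventually) (auto simp: Fp real_sqrt_divide eventually_at_filter)
  then have dr: "((\<lambda>t. sqrt (F (\<phi> p + t\<^sup>2 *\<^sub>R u))) has_real_derivative sqrt ?d) (at 0 within {0..})"
    by (simp only: has_field_derivative_iff)
  define \<gamma> where "\<gamma> = (\<lambda>t. (\<phi> p + t\<^sup>2 *\<^sub>R u, a * complex_of_real (sqrt (F (\<phi> p + t\<^sup>2 *\<^sub>R u)))))"
  have "((\<lambda>t. \<phi> p + t\<^sup>2 *\<^sub>R u) has_vector_derivative 0) (at 0 within {0..})"
    by (auto intro!: derivative_eq_intros)
  moreover have "((\<lambda>t. a * complex_of_real (sqrt (F (\<phi> p + t\<^sup>2 *\<^sub>R u)))) has_vector_derivative a * complex_of_real (sqrt ?d)) (at 0 within {0..})"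
    by (intro has_vector_derivative_mult_right has_vector_derivative_of_real dr)
  ultimately have \<gamma>: "(\<gamma> has_vector_derivative (0, a * complex_of_real (sqrt ?d))) (at 0 within {0..})"
    unfolding \<gamma>_def by (rule has_vector_derivative_Pair)
  define \<epsilon> where "\<epsilon> = sqrt (min \<epsilon>1 \<delta>)"
  have \<epsilon>: "\<epsilon> > 0" using e1 \<delta> by (simp add: \<epsilon>_def)
  have "tangent_dir (\<Psi> ` UU) (\<gamma> 0) (0, a * complex_of_real (sqrt ?d))"
  proof (rule tangent_dir_curve[OF \<gamma> \<epsilon>])
    fix t :: real assume t: "0 \<le> t" "t < \<epsilon>"
    then have "t\<^sup>2 < \<epsilon>\<^sup>2" by (intro power_strict_mono) auto
    then have t2: "t\<^sup>2 < \<epsilon>1" "t\<^sup>2 < \<delta>" using e1 \<delta> by (auto simp: \<epsilon>_def)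
    obtain x where x: "x \<in> U \<inter> V0" "\<phi> x = \<phi> p + t\<^sup>2 *\<^sub>R u" using e1(2)[of "t\<^sup>2"] t2 by auto
    have "f x = F (\<phi> p + t\<^sup>2 *\<^sub>R u)" using local_ext_eq[OF F(1), of x] x \<delta>(2)[of "t\<^sup>2"] t2 by auto
    then have "\<gamma> t = \<Psi> (a, x)" using x by (simp add: \<gamma>_def \<Psi>_def)
    moreover have "(a, x) \<in> UU" using x a by (simp add: UU_def)
    ultimately show "\<gamma> t \<in> \<Psi> ` UU" by (rule image_eqI)
  qed
  moreover have "\<gamma> 0 = \<Psi> (1, p)" by (simp add: \<gamma>_def \<Psi>_pt Fp)
  ultimately have "tangent_dir (\<Psi> ` UU) (\<Psi> (1, p)) (inverse (sqrt ?d) *\<^sub>R (0, a * complex_of_real (sqrt ?d)))"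
    by (intro tangent_dir_scale) simp
  moreover have "inverse (sqrt ?d) *\<^sub>R (a * complex_of_real (sqrt ?d)) = a"
    using F(2) by (simp add: scaleR_conv_of_real)
  ultimately show ?thesis by (simp only: scaleR_Pair scaleR_zero_right)
qed

lemma tangent_dir_\<Psi>:
  assumes v: "v \<in> E" "u \<bullet> v = 0"
  shows "tangent_dir (\<Psi> ` UU) (\<Psi> (1, p)) (v, z)"
proof -
  have "tangent_dir (\<Psi> ` UU) (\<Psi> (1, p)) (Re z *\<^sub>R (0, 1) + Im z *\<^sub>R (0, \<i>))"
    by (intro tangent_dir_lincomb tangent_dir_\<Psi>_snd_unit) auto
  from tangent_dir_lincomb[OF tangent_dir_\<Psi>_fst[OF v] this, of 1 1]
  have "tangent_dir (\<Psi> ` UU) (\<Psi> (1, p)) ((v, 0) + (0, Re z *\<^sub>R 1 + Im z *\<^sub>R \<i>))" by simp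
  moreover have "Re z *\<^sub>R 1 + Im z *\<^sub>R \<i> = z" by (simp add: complex_eq_iff)
  ultimately show ?thesis by simp
qed

lemma smooth_N_local_ext:
  assumes h: "h \<in> smooth_functions N"
  obtains W G where "local_ext UU \<Psi> (1, p) (\<lambda>w. h (FF w)) W G"
proof -
  obtain W G where G: "open W" "(\<phi> p, 0) \<in> W" "Cinf W G"
    "\<And>a x. a \<in> circle \<Longrightarrow> x \<in> U \<Longrightarrow> (\<phi> x, a * complex_of_real (sqrt (f x))) \<in> W \<Longrightarrow>
      x \<in> V0 \<and> G (\<phi> x, a * complex_of_real (sqrt (f x))) = h (cmap (act a x))"
    by (rule cut_function_boundary[OF h U p_bd], rule that) blast+
  have "local_ext UU \<Psi> (1, p) (\<lambda>w. h (FF w)) W G"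
    unfolding local_ext_def
  proof (intro conjI ballI impI)
    show "\<Psi> (1, p) \<in> W" using G(2) by (simp add: \<Psi>_pt)
    fix w assume "w \<in> UU" "\<Psi> w \<in> W"
    then show "G (\<Psi> w) = h (FF w)" using G(4)[of "fst w" "snd w"] by (auto simp: UU_def \<Psi>_def FF_def)
  qed (fact G)+
  then show ?thesis by (rule that)
qed

lemma Phi_tangent:
  assumes v: "v \<in> E" "u \<bullet> v = 0"
  shows "Phi v z \<in> tangent_space N (cmap p)"
proof -
  have "smooth_near UU \<Psi> (1, p) (\<lambda>x. h (FF x))" if h: "h \<in> smooth_functions N" for h
    using smooth_N_local_ext[OF h] local_ext_smooth_near by metis
  from coord_vec_tangent[OF N.good tangent_dir_\<Psi>[OF v] pt_UU this]
  show ?thesis by (simp add: Phi_def FF_pt)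
qed

lemma Phi_eq:
  assumes "v \<in> E" "u \<bullet> v = 0" "h \<in> smooth_functions N" "local_ext UU \<Psi> (1, p) (\<lambda>w. h (FF w)) W G"
  shows "Phi v z h = Df G (\<phi> p, 0) (v, z)"
  using coord_vec_eq[OF tangent_dir_\<Psi>[OF assms(1,2)] assms(3,4)] by (simp add: Phi_def \<Psi>_pt)

text \<open>The witness \<open>H (x, z) = R (z * cnj (\<zeta> x))\<close> is equivariant by the rule
  for \<open>\<zeta>\<close>. It vanishes at \<open>z = 0\<close>, hence on the reduced space, and
  to first order at \<open>(p, 0)\<close> it sees \<open>z\<close> alone. Taking \<open>Re\<close>
  and \<open>Im\<close> for \<open>R\<close> recovers \<open>z\<close> as soon as
  \<open>\<zeta> p \<noteq> 0\<close>.\<close>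

lemma normal_coordinate:
  assumes \<zeta>: "\<And>x. x \<in> topspace (mtop M) \<Longrightarrow> smooth_at M x (\<zeta> :: 'a \<Rightarrow> complex)"
    "\<And>a x. a \<in> circle \<Longrightarrow> x \<in> V0 \<Longrightarrow> \<zeta> (act a x) = cnj a * \<zeta> x"
    and R: "bounded_linear (R :: complex \<Rightarrow> real)"
  obtains h where "h \<in> smooth_functions N"
    "\<And>x. x \<in> bd \<Longrightarrow> h (cmap x) = 0"
    "\<And>v z. v \<in> E \<Longrightarrow> u \<bullet> v = 0 \<Longrightarrow> Phi v z h = R (z * cnj (\<zeta> p))"
proof -
  define g where "g = (\<lambda>x. R (complex_of_real (sqrt (f x)) * cnj (\<zeta> x)))"
  define H where "H = (\<lambda>w. R (snd w * cnj (\<zeta> (fst w))))"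
  have g: "smooth_at M x g" if x: "x \<in> topspace (mtop M)" "0 < f x" for x
  proof -
    have "smooth_at M x f" using f_smooth x smooth_iff_smooth_at by blast
    then have "smooth_at M x (\<lambda>x. sqrt (f x))"
      by (rule smooth_at_compose[OF _ open_greaterThan[of 0]]) (use Cinf_sqrt x in \<open>simp_all add: greaterThan_def\<close>)
    then have "smooth_at M x (\<lambda>x. complex_of_real (sqrt (f x)))"
      by (rule smooth_at_compose[OF _ open_UNIV Cinf_linear[OF bounded_linear_of_real]]) simp
    moreover have "smooth_at M x (\<lambda>x. cnj (\<zeta> x))"
      by (rule smooth_at_compose[OF \<zeta>(1)[OF x(1)] open_UNIV Cinf_linear[OF bounded_linear_cnj]]) simp
    ultimately have "smooth_at M x (\<lambda>x. complex_of_real (sqrt (f x)) * cnj (\<zeta> x))" by (rule smooth_at_mult)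
    then show ?thesis unfolding g_def
      by (rule smooth_at_compose[OF _ open_UNIV Cinf_linear[OF R]]) simp
  qed
  have H: "smooth_near ((U' \<inter> V0) \<times> UNIV) (map_prod \<phi>' (\<lambda>x. x)) (x, z :: complex) H"
    if U': "(U', \<phi>') \<in> charts M" "x \<in> U'" "x \<in> V0" for U' \<phi>' x z
  proof -
    have m: "(x, z) \<in> (U' \<inter> V0) \<times> UNIV" using U' by simp
    have "smooth_near (U' \<inter> V0) \<phi>' x \<zeta>"
      by (rule smooth_near_mono[OF smooth_at_chart[OF \<zeta>(1)[OF V0_topspace[OF U'(3)]] U'(1,2)] open_UNIV]) auto
    then have "smooth_near ((U' \<inter> V0) \<times> UNIV) (map_prod \<phi>' (\<lambda>x. x)) (x, z :: complex) (\<lambda>w. \<zeta> (fst w))"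
      by (rule smooth_near_prod_fst)
    from smooth_near_linear[OF R smooth_near_mult[OF smooth_near_prod_snd smooth_near_linear[OF bounded_linear_cnj this m] m] m]
    show ?thesis by (simp add: H_def)
  qed
  have inv: "H (act a x, z) = H (x, a * z)" if "a \<in> circle" "x \<in> V0" for a x z
    using \<zeta>(2)[OF that] by (simp add: H_def ac_simps)
  have gH: "g x = H (x, complex_of_real (sqrt (f x)))" for x by (simp add: g_def H_def)
  obtain h where h: "h \<in> smooth_functions N" "\<And>x. x \<in> topspace (mtop M) \<Longrightarrow> h (cmap x) = g x"
    by (rule cut_function_descend[OF g H inv gH], assumption+) blast
  have lin: "linear R" using R bounded_linear.linear by blast
  show ?thesis
  proof (rule that[OF h(1)])
    show "h (cmap x) = 0" if "x \<in> bd" for x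
      using h(2)[of x] that bdry_eq lin by (auto simp: g_def linear_0)
    fix v z assume v: "v \<in> E" "u \<bullet> v = 0"
    obtain W Z where Z: "local_ext U \<phi> p \<zeta> W Z" using smooth_at_chart[OF \<zeta>(1)[OF p_top] U] by (elim smooth_nearE)
    have CZ: "Cinf (W \<times> (UNIV :: complex set)) (\<lambda>y. Z (fst y))"
      by (rule Cinf_compose[OF Cinf_fst local_ext_Cinf[OF Z]]) auto
    let ?G = "\<lambda>y::'e \<times> complex. R (snd y * cnj (Z (fst y)))"
    have G: "local_ext UU \<Psi> (1, p) (\<lambda>w. h (FF w)) (W \<times> UNIV) ?G"
      unfolding local_ext_def
    proof (intro conjI ballI impI)
      show "open (W \<times> (UNIV :: complex set))" using local_ext_open[OF Z] by (simp add: open_Times)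
      show "\<Psi> (1, p) \<in> W \<times> UNIV" using local_ext_mem[OF Z] by (simp add: \<Psi>_pt)
      show "Cinf (W \<times> UNIV) ?G"
        by (rule Cinf_linear_comp[OF R Cinf_mult[OF Cinf_snd Cinf_linear_comp[OF bounded_linear_cnj CZ]]])
      fix w assume w: "w \<in> UU" "\<Psi> w \<in> W \<times> UNIV"
      obtain a x where ax: "w = (a, x)" "a \<in> circle" "x \<in> U" "x \<in> V0" using w(1) by (auto simp: UU_def)
      have "h (FF w) = g (act a x)" using h(2)[OF V0_topspace[OF act_V0[OF ax(2,4)]]] ax by (simp add: FF_def)
      also have "\<dots> = R (complex_of_real (sqrt (f x)) * cnj (cnj a * \<zeta> x))"
        using V0(2)[OF ax(2,4)] \<zeta>(2)[OF ax(2,4)] by (simp add: g_def)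
      also have "\<zeta> x = Z (\<phi> x)" using local_ext_eq[OF Z ax(3)] w(2) ax by (auto simp: \<Psi>_def)
      finally show "?G (\<Psi> w) = h (FF w)" using ax by (simp add: \<Psi>_def ac_simps)
    qed
    \<comment> \<open>In the product rule the term with the derivative of \<open>\<zeta>\<close>
      carries the second coordinate of \<open>(\<phi> p, 0)\<close> as a factor, so \<open>v\<close>
      drops out.\<close>
    have "((\<lambda>y. cnj (Z (fst y))) has_derivative Df (\<lambda>y. cnj (Z (fst y))) (\<phi> p, 0)) (at (\<phi> p, 0 :: complex))"
      by (rule Cinf_has_derivative[OF Cinf_linear_comp[OF bounded_linear_cnj CZ]]) (use local_ext_mem[OF Z] in auto)
    from bounded_linear.has_derivative[OF R has_derivative_mult[OF has_derivative_snd[OF has_derivative_ident] this]]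
    have "(?G has_derivative (\<lambda>k. R (snd k * cnj (Z (\<phi> p))))) (at (\<phi> p, 0))" by simp
    from Df_eqI[OF this, of "(v, z)"] have "Df ?G (\<phi> p, 0) (v, z) = R (z * cnj (Z (\<phi> p)))" by simp
    moreover have "Z (\<phi> p) = \<zeta> p" using local_ext_eq[OF Z U(2) local_ext_mem[OF Z]] .
    ultimately show "Phi v z h = R (z * cnj (\<zeta> p))" using Phi_eq[OF v h(1) G] by simp
  qed
qed

end

section \<open>Tangent spaces of the cut space\<close>

lemma dim_hyperplane_section:
  fixes S :: "'e::euclidean_space set"
  assumes S: "subspace S"
  shows "dim S \<le> dim {w \<in> S. a \<bullet> w = 0} + 1"
proof (cases "\<exists>e\<in>S. a \<bullet> e \<noteq> 0")
  case True
  then obtain e where e: "e \<in> S" "a \<bullet> e \<noteq> 0" by blast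
  let ?K = "{w \<in> S. a \<bullet> w = 0}"
  have "S \<subseteq> span (insert e ?K)"
  proof
    fix w assume w: "w \<in> S"
    let ?c = "(a \<bullet> w) / (a \<bullet> e)"
    have "w - ?c *\<^sub>R e \<in> ?K"
      using w e S by (auto simp: inner_diff_right intro: subspace_diff subspace_scale)
    then have "w - ?c *\<^sub>R e \<in> span (insert e ?K)" by (intro span_base) blast
    moreover have "?c *\<^sub>R e \<in> span (insert e ?K)" by (intro span_scale span_base) blast
    ultimately have "(w - ?c *\<^sub>R e) + ?c *\<^sub>R e \<in> span (insert e ?K)" by (rule span_add)
    then show "w \<in> span (insert e ?K)" by simp
  qed
  then have "dim S \<le> dim (insert e ?K)" by (rule dim_mono)
  also have "\<dots> \<le> dim ?K + 1" by (simp add: dim_insert)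
  finally show ?thesis .
next
  case False
  then have "{w \<in> S. a \<bullet> w = 0} = S" by blast
  then show ?thesis by simp
qed

text \<open>The direction of \<open>w\<close> relative to that of \<open>w0\<close>, that is
  \<open>w * cnj w0\<close> divided by its modulus. Inner products replace norms so that smoothness
  off 0 can be read from \<open>Cinf_sqrt\<close> and \<open>Cinf_inverse\<close>.\<close>

definition phase :: "complex \<Rightarrow> complex \<Rightarrow> complex" where
  "phase w0 w = (w * cnj w0) * of_real (inverse (sqrt ((w \<bullet> w) * (w0 \<bullet> w0))))"

lemma Cinf_phase:
  assumes "w0 \<noteq> 0"
  shows "Cinf {w. w \<noteq> 0} (phase w0)"
proof -
  have 1: "Cinf {w. w \<noteq> 0} (\<lambda>w::complex. (w \<bullet> w) * (w0 \<bullet> w0))"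
    by (intro Cinf_mult Cinf_inner Cinf_id Cinf_const)
  have 2: "Cinf {w. w \<noteq> 0} (\<lambda>w::complex. sqrt ((w \<bullet> w) * (w0 \<bullet> w0)))"
    by (rule Cinf_compose[OF 1 Cinf_sqrt]) (use assms in auto)
  have 3: "Cinf {w. w \<noteq> 0} (\<lambda>w::complex. inverse (sqrt ((w \<bullet> w) * (w0 \<bullet> w0))))"
    by (rule Cinf_compose[OF 2 Cinf_inverse]) (use assms in auto)
  show ?thesis unfolding phase_def[abs_def]
    by (rule Cinf_mult[OF Cinf_mult[OF Cinf_id Cinf_const] Cinf_linear_comp[OF bounded_linear_of_real 3]])
qed

lemma phase_circle: "w0 \<noteq> 0 \<Longrightarrow> w \<noteq> 0 \<Longrightarrow> phase w0 w \<in> circle"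
  by (simp add: phase_def norm_mult norm_inverse dot_square_norm real_sqrt_mult) (simp add: field_simps)

lemma phase_mult: "a \<in> circle \<Longrightarrow> phase w0 (a * w) = a * phase w0 w"
  by (simp add: phase_def dot_square_norm norm_mult)

lemma phase_self: "w0 \<noteq> 0 \<Longrightarrow> phase w0 w0 = 1"
proof -
  assume w0: "w0 \<noteq> 0"
  have "w0 * cnj w0 = of_real (w0 \<bullet> w0)" by (simp only: complex_norm_square[symmetric] dot_square_norm of_real_power)
  moreover have "sqrt ((w0 \<bullet> w0) * (w0 \<bullet> w0)) = w0 \<bullet> w0" by simp
  ultimately have "phase w0 w0 = of_real ((w0 \<bullet> w0) * inverse (w0 \<bullet> w0))"
    unfolding phase_def by (simp only: of_real_mult)
  then show ?thesis using w0 by simp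
qed

section \<open>Composition with the action of a circle-valued function\<close>

context cutting
begin

text \<open>The formula \<open>K (A (T y, y))\<close> is part of the conclusion because
  \<open>Phi_kernel\<close> computes its derivative; smoothness alone would not be enough
  there.\<close>

lemma act_compose_local_ext:
  fixes \<psi> :: "'a \<Rightarrow> 'e" and k :: "'a \<Rightarrow> real"
  assumes U: "(U, \<phi>) \<in> charts M" "x \<in> U" and S: "x \<in> S" "S \<subseteq> V0" "\<And>y. y \<in> S \<Longrightarrow> \<tau> y \<in> circle"
    and T: "local_ext U \<phi> x \<tau> W1 T"
    and A: "open W" "(\<tau> x, \<phi> x) \<in> W" "Cinf W A"
      "\<And>b y. b \<in> circle \<Longrightarrow> y \<in> U \<Longrightarrow> y \<in> V0 \<Longrightarrow> (b, \<phi> y) \<in> W \<Longrightarrow> act b y \<in> V \<and> A (b, \<phi> y) = \<psi> (act b y)"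
    and K: "local_ext V \<psi> (act (\<tau> x) x) k W2 K"
  obtains W' where "local_ext (U \<inter> S) \<phi> x (\<lambda>y. k (act (\<tau> y) y)) W' (\<lambda>y. K (A (T y, y)))" "W' \<subseteq> W1"
proof -
  have g: "Cinf W1 (\<lambda>y. (T y, y))" by (rule Cinf_Pair[OF local_ext_Cinf[OF T] Cinf_id])
  define W3 where "W3 = W1 \<inter> (\<lambda>y. (T y, y)) -` W"
  have W3: "open W3" unfolding W3_def by (rule open_Int_vimage_Cinf[OF local_ext_open[OF T] g A(1)])
  have Ag: "Cinf W3 (\<lambda>y. A (T y, y))"
    by (rule Cinf_compose[OF Cinf_subset[OF g] A(3)]) (auto simp: W3_def)
  define W4 where "W4 = W3 \<inter> (\<lambda>y. A (T y, y)) -` W2"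
  have W4: "open W4" unfolding W4_def by (rule open_Int_vimage_Cinf[OF W3 Ag local_ext_open[OF K]])
  have Tx: "T (\<phi> x) = \<tau> x" by (rule local_ext_eq[OF T U(2) local_ext_mem[OF T]])
  have xV: "x \<in> V0" using S by blast
  have Ax: "A (\<tau> x, \<phi> x) = \<psi> (act (\<tau> x) x)" using A(4)[OF S(3)[OF S(1)] U(2) xV A(2)] by blast
  have "local_ext (U \<inter> S) \<phi> x (\<lambda>y. k (act (\<tau> y) y)) W4 (\<lambda>y. K (A (T y, y)))"
    unfolding local_ext_def
  proof (intro conjI ballI impI W4)
    show "\<phi> x \<in> W4" using local_ext_mem[OF T] Tx A(2) Ax local_ext_mem[OF K] by (simp add: W4_def W3_def)
    show "Cinf W4 (\<lambda>y. K (A (T y, y)))"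
      by (rule Cinf_compose[OF Cinf_subset[OF Ag] local_ext_Cinf[OF K]]) (auto simp: W4_def)
    fix y assume y: "y \<in> U \<inter> S" "\<phi> y \<in> W4"
    have yU: "y \<in> U" "y \<in> S" "y \<in> V0" using y S by auto
    have m: "\<phi> y \<in> W1" "(T (\<phi> y), \<phi> y) \<in> W" "A (T (\<phi> y), \<phi> y) \<in> W2" using y(2) by (simp_all add: W4_def W3_def)
    have Ty: "T (\<phi> y) = \<tau> y" by (rule local_ext_eq[OF T yU(1) m(1)])
    have "act (\<tau> y) y \<in> V \<and> A (\<tau> y, \<phi> y) = \<psi> (act (\<tau> y) y)"
      by (rule A(4)[OF S(3)[OF yU(2)] yU(1,3)]) (use m Ty in simp)
    then show "K (A (T (\<phi> y), \<phi> y)) = k (act (\<tau> y) y)"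
      using local_ext_eq[OF K, of "act (\<tau> y) y"] m(3) Ty by simp
  qed
  then show ?thesis by (rule that) (auto simp: W4_def W3_def)
qed

lemma act_compose_smooth_at:
  assumes k: "k \<in> smooth_functions M" and \<tau>: "smooth_at M x \<tau>"
    and S: "openin (mtop M) S" "x \<in> S" "S \<subseteq> V0" "\<And>y. y \<in> S \<Longrightarrow> \<tau> y \<in> circle"
  shows "smooth_at M x (\<lambda>y. k (act (\<tau> y) y))"
proof -
  have xV: "x \<in> V0" using S by blast
  obtain U \<phi> where U: "(U, \<phi>) \<in> charts M" "x \<in> U" using chart_ex[OF V0_topspace[OF xV]] by blast
  obtain W1 T where T: "local_ext U \<phi> x \<tau> W1 T" using smooth_at_chart[OF \<tau> U] by (elim smooth_nearE)
  have "act (\<tau> x) x \<in> topspace (mtop M)" by (rule V0_topspace[OF act_V0[OF S(4)[OF S(2)] xV]])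
  then obtain V \<psi> where V: "(V, \<psi>) \<in> charts M" "act (\<tau> x) x \<in> V" using chart_ex by blast
  obtain W A where A: "open W" "(\<tau> x, \<phi> x) \<in> W" "Cinf W A"
    "\<And>b y. b \<in> circle \<Longrightarrow> y \<in> U \<Longrightarrow> y \<in> V0 \<Longrightarrow> (b, \<phi> y) \<in> W \<Longrightarrow> act b y \<in> V \<and> A (b, \<phi> y) = \<psi> (act b y)"
    using act_local[OF U xV V S(4)[OF S(2)]] by metis
  obtain W2 K where K: "local_ext V \<psi> (act (\<tau> x) x) k W2 K"
    using smooth_functionsD[OF good k V] by (elim smooth_nearE)
  obtain W' where "local_ext (U \<inter> S) \<phi> x (\<lambda>y. k (act (\<tau> y) y)) W' (\<lambda>y. K (A (T y, y)))"
    by (rule act_compose_local_ext[OF U S(2-4) T A K])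
  then have "smooth_near (U \<inter> S) \<phi> x (\<lambda>y. k (act (\<tau> y) y))" by (rule local_ext_smooth_near)
  then have "smooth_near (U \<inter> UNIV) \<phi> x (\<lambda>y. k (act (\<tau> y) y))" by (rule smooth_near_local[OF U _ S(1,2)]) auto
  then show ?thesis using smooth_atI[OF U] by simp
qed

end

context cutting_pt
begin

text \<open>
  If \<open>\<tau>\<close> is equivariant with values in the circle, then \<open>x \<mapsto> \<tau>(x) \<cdot> x\<close> retracts a neighbourhood of
  the orbit of \<open>p\<close> onto the slice \<open>\<tau> = 1\<close>; pulling functions back along it produces sufficiently
  many invariant functions.
\<close>

lemma Phi_kernel:
  obtains \<xi> where "\<And>v z. v \<in> E \<Longrightarrow> u \<bullet> v = 0 \<Longrightarrow> (\<And>h. h \<in> smooth_functions N \<Longrightarrow> Phi v z h = 0) \<Longrightarrow>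
    z = 0 \<and> (\<exists>s. v = s *\<^sub>R \<xi>)"
proof -
  obtain \<zeta> :: "'a \<Rightarrow> complex" where \<zeta>: "\<And>x. x \<in> topspace (mtop M) \<Longrightarrow> smooth_at M x \<zeta>" "\<And>x. x \<notin> V0 \<Longrightarrow> \<zeta> x = 0"
    "\<And>a x. a \<in> circle \<Longrightarrow> x \<in> V0 \<Longrightarrow> \<zeta> (act a x) = cnj a * \<zeta> x" "\<zeta> p \<noteq> 0"
    using equivariant_function[OF p_V0] by metis
  have z0: "z = 0" if v: "v \<in> E" "u \<bullet> v = 0" and ker: "\<And>h. h \<in> smooth_functions N \<Longrightarrow> Phi v z h = 0" for v z
  proof -
    obtain h1 where "h1 \<in> smooth_functions N" "Phi v z h1 = Re (z * cnj (\<zeta> p))"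
      using normal_coordinate[OF \<zeta>(1,3) bounded_linear_Re] v by metis
    moreover obtain h2 where "h2 \<in> smooth_functions N" "Phi v z h2 = Im (z * cnj (\<zeta> p))"
      using normal_coordinate[OF \<zeta>(1,3) bounded_linear_Im] v by metis
    ultimately have "z * cnj (\<zeta> p) = 0" using ker by (auto simp: complex_eq_iff)
    then show ?thesis using \<zeta>(4) by simp
  qed
  define w0 where "w0 = \<zeta> p"
  have w0: "w0 \<noteq> 0" using \<zeta>(4) by (simp add: w0_def)
  \<comment> \<open>By the rule for \<open>\<zeta>\<close>,
    \<open>\<tau> (act a x) = cnj a * \<tau> x\<close> undoes the motion by \<open>a\<close> where
    \<open>\<zeta> x \<noteq> 0\<close>: the point \<open>act (\<tau> x) x\<close> depends only on
    the orbit of \<open>x\<close>, and for \<open>x = p\<close> it is \<open>p\<close>.\<close>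
  define \<tau> where "\<tau> = (\<lambda>x. phase w0 (\<zeta> x))"
  \<comment> \<open>Where \<open>\<zeta>\<close> vanishes there is no phase. The cutoff
    \<open>\<sigma>\<close> is invariant, 0 for \<open>4 * |\<zeta>|^2 \<le> |w0|^2\<close> and 1
    for \<open>2 * |\<zeta>|^2 \<ge> |w0|^2\<close>, in particular on \<open>S\<close>; multiplied
    by it, functions of \<open>act (\<tau> x) x\<close> become smooth on all of
    \<open>M\<close>.\<close>
  define \<sigma> where "\<sigma> = (\<lambda>x. 1 - step (2 * inverse (w0 \<bullet> w0) * (\<zeta> x \<bullet> \<zeta> x)))"
  have cont: "continuous_map (mtop M) euclidean \<zeta>" by (rule smooth_at_continuous[OF \<zeta>(1)])
  have op: "openin (mtop M) {x \<in> topspace (mtop M). \<zeta> x \<in> Q}" if "open Q" for Q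
    using cont that unfolding continuous_map_def by (metis open_openin)
  define S where "S = {x \<in> topspace (mtop M). \<zeta> x \<in> {w. w0 \<bullet> w0 < 2 * (w \<bullet> w)}}"
  have S_open: "openin (mtop M) S" unfolding S_def
    by (rule op) (intro open_Collect_less continuous_intros)
  have pS: "p \<in> S" using w0 p_top by (simp add: S_def w0_def)
  have \<zeta>S: "\<zeta> x \<noteq> 0" if "x \<in> S" for x
  proof
    assume "\<zeta> x = 0"
    then have "w0 \<bullet> w0 < 0" using that by (simp add: S_def)
    then show False using inner_ge_zero[of w0] by linarith
  qed
  then have SV: "S \<subseteq> V0" using \<zeta>(2) by blast
  have \<tau>S: "\<tau> x \<in> circle" if "x \<in> S" for x unfolding \<tau>_def by (rule phase_circle[OF w0 \<zeta>S[OF that]])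
  have \<sigma>S: "\<sigma> x = 1" if "x \<in> S" for x
    using that w0 by (auto simp: \<sigma>_def S_def field_simps intro!: step_eq_0)
  have \<tau>p: "\<tau> p = 1" using phase_self[OF w0] by (simp add: \<tau>_def w0_def)
  have \<sigma>_sm: "smooth_at M x \<sigma>" if "x \<in> topspace (mtop M)" for x
  proof -
    have "Cinf UNIV (\<lambda>w::complex. 2 * inverse (w0 \<bullet> w0) * (w \<bullet> w))"
      by (intro Cinf_mult Cinf_const Cinf_inner Cinf_id)
    then have "Cinf UNIV (\<lambda>w::complex. step (2 * inverse (w0 \<bullet> w0) * (w \<bullet> w)))"
      by (rule Cinf_compose[OF _ Cinf_step]) simp
    from Cinf_minus[OF Cinf_const this] show ?thesis unfolding \<sigma>_def
      by (rule smooth_at_compose[OF \<zeta>(1)[OF that] open_UNIV]) simp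
  qed
  obtain \<rho> xs S0 C where c: "\<rho> \<in> smooth_functions M" "compactin (mtop M) C" "C \<subseteq> U" "\<And>x. x \<notin> C \<Longrightarrow> \<rho> x = 0"
    "openin (mtop M) S0" "p \<in> S0" "S0 \<subseteq> U" "\<And>x. x \<in> S0 \<Longrightarrow> \<rho> x = 1"
    "\<And>b. xs b \<in> smooth_functions M" "\<And>b x. x \<in> S0 \<Longrightarrow> xs b x = \<phi> x \<bullet> b"
    using coordinate_functions[OF U] by metis
  obtain B where B: "finite B" "B \<subseteq> E" "\<And>y. y \<in> E \<Longrightarrow> y = (\<Sum>b\<in>B. (y \<bullet> b) *\<^sub>R b)"
    using orthonormal_expansion[OF subspace_E] by metis
  obtain W A where A: "open W" "(1, \<phi> p) \<in> W" "Cinf W A"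
    "\<And>b y. b \<in> circle \<Longrightarrow> y \<in> U \<Longrightarrow> y \<in> V0 \<Longrightarrow> (b, \<phi> y) \<in> W \<Longrightarrow> act b y \<in> U \<and> A (b, \<phi> y) = \<phi> (act b y)"
    using act_local[OF U p_V0 U(1), of 1] act_one[OF p_V0] U(2) by auto
  obtain W1 T where T: "local_ext U \<phi> p \<tau> W1 T"
  proof -
    have "smooth_at M p \<tau>" unfolding \<tau>_def
      by (rule smooth_at_compose[OF \<zeta>(1)[OF p_top] _ Cinf_phase[OF w0]]) (use \<zeta>(4) in \<open>auto simp: open_Collect_neq\<close>)
    then show ?thesis using smooth_at_chart[OF _ U] that by (blast elim: smooth_nearE)
  qed
  have Tp: "T (\<phi> p) = 1" using local_ext_eq[OF T U(2) local_ext_mem[OF T]] \<tau>p by simp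
  obtain \<Omega>0 where \<Omega>0: "open \<Omega>0" "\<And>x. x \<in> U \<Longrightarrow> \<phi> x \<in> \<Omega>0 \<longleftrightarrow> x \<in> S0"
    using chart_open_image[OF U(1) c(5)] by blast
  obtain \<Omega>S where \<Omega>S: "open \<Omega>S" "\<And>x. x \<in> U \<Longrightarrow> \<phi> x \<in> \<Omega>S \<longleftrightarrow> x \<in> S"
    using chart_open_image[OF U(1) S_open] by blast
  let ?DA = "Df A (1, \<phi> p)"
  let ?DT = "Df T (\<phi> p)"
  have linA: "linear ?DA" by (rule Cinf_linear_Df[OF A(3,2)])
  \<comment> \<open>\<open>?DA (\<i>, 0)\<close> is the velocity at \<open>p\<close> of the orbit,
    read in the chart; forming the sum over \<open>B\<close> puts it into \<open>E\<close> by
    construction.\<close>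
  define \<xi> where "\<xi> = (\<Sum>b\<in>B. (?DA (\<i>, 0) \<bullet> b) *\<^sub>R b)"
  \<comment> \<open>The coordinates of \<open>act (\<tau> x) x\<close>, times
    \<open>\<sigma>\<close>, are invariant functions on \<open>M\<close> and so descend to
    \<open>N\<close>. A vector in the kernel annihilates all of them, hence also the differential
    \<open>?DA (?DT v, v)\<close> of the retraction at \<open>p\<close> vanishes on it.\<close>
  have DAT: "?DA (?DT v, v) \<bullet> b = 0"
    if v: "v \<in> E" "u \<bullet> v = 0" and ker: "\<And>h. h \<in> smooth_functions N \<Longrightarrow> Phi v 0 h = 0" for v b
  proof -
    define g where "g = (\<lambda>x. \<sigma> x * xs b (act (\<tau> x) x))"
    have K: "local_ext U \<phi> (act (\<tau> p) p) (xs b) \<Omega>0 (\<lambda>y. y \<bullet> b)"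
      using \<Omega>0 c(6,10) U(2) by (auto simp: local_ext_def \<tau>p act_one[OF p_V0] intro!: Cinf_inner Cinf_id Cinf_const)
    have A2: "(\<tau> p, \<phi> p) \<in> W" using A(2) \<tau>p by simp
    obtain W' where W': "local_ext (U \<inter> S) \<phi> p (\<lambda>y. xs b (act (\<tau> y) y)) W' (\<lambda>y. A (T y, y) \<bullet> b)"
      by (rule act_compose_local_ext[OF U pS SV \<tau>S T A(1) A2 A(3,4) K])
    have g_sm: "smooth_at M x g" if x: "x \<in> topspace (mtop M)" for x
    proof (cases "\<zeta> x = 0")
      case True
      let ?S = "{x \<in> topspace (mtop M). \<zeta> x \<in> {w. 4 * (w \<bullet> w) < w0 \<bullet> w0}}"
      have "openin (mtop M) ?S" by (rule op) (intro open_Collect_less continuous_intros)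
      moreover have "x \<in> ?S" using True x w0 by simp
      moreover have "g y = 0" if "y \<in> ?S" for y
        using that w0 by (auto simp: g_def \<sigma>_def field_simps intro!: step_eq_1)
      ultimately show ?thesis by (intro smooth_at_local[OF smooth_at_const[OF x, of 0]])
    next
      case False
      let ?S = "{x \<in> topspace (mtop M). \<zeta> x \<in> {w. w \<noteq> 0}}"
      have o: "openin (mtop M) ?S" by (rule op) (simp add: open_Collect_neq)
      have m: "x \<in> ?S" using False x by simp
      have s: "?S \<subseteq> V0" using \<zeta>(2) by auto
      have t: "\<tau> y \<in> circle" if "y \<in> ?S" for y unfolding \<tau>_def by (rule phase_circle[OF w0]) (use that in auto)
      have "smooth_at M x \<tau>" unfolding \<tau>_def
        by (rule smooth_at_compose[OF \<zeta>(1)[OF x] _ Cinf_phase[OF w0]]) (use False in \<open>auto simp: open_Collect_neq\<close>)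
      from smooth_at_mult[OF \<sigma>_sm[OF x] act_compose_smooth_at[OF c(9) this o m s t]]
      show ?thesis by (simp add: g_def)
    qed
    have g_inv: "g (act a x) = g x" if a: "a \<in> circle" and x: "x \<in> V0" for a x
    proof -
      have e: "\<zeta> (act a x) = cnj a * \<zeta> x" by (rule \<zeta>(3)[OF a x])
      have "\<zeta> (act a x) \<bullet> \<zeta> (act a x) = \<zeta> x \<bullet> \<zeta> x"
        using a unfolding e by (simp add: dot_square_norm norm_mult)
      then have s: "\<sigma> (act a x) = \<sigma> x" by (simp add: \<sigma>_def)
      show ?thesis
      proof (cases "\<zeta> x = 0")
        case True
        then have "\<sigma> x = 0" by (simp add: \<sigma>_def step_eq_1)
        then show ?thesis using s by (simp add: g_def)
      next
        case False
        have t: "\<tau> x \<in> circle" unfolding \<tau>_def by (rule phase_circle[OF w0 False])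
        have ta: "\<tau> (act a x) = cnj a * \<tau> x" unfolding \<tau>_def e by (rule phase_mult[OF circle_cnj[OF a]])
        have "act (cnj a * \<tau> x) (act a x) = act ((cnj a * \<tau> x) * a) x"
          by (rule act_act[OF circle_mult[OF circle_cnj[OF a] t] a x])
        also have "(cnj a * \<tau> x) * a = (cnj a * a) * \<tau> x" by (simp only: ac_simps)
        also have "\<dots> = \<tau> x" using circle_mult_cnj[OF a] by simp
        finally show ?thesis using s ta by (simp add: g_def)
      qed
    qed
    obtain h where h: "h \<in> smooth_functions N" "\<And>x. x \<in> topspace (mtop M) \<Longrightarrow> h (cmap x) = g x"
    proof (rule cut_function_descend[of g "\<lambda>w. g (fst w)"])
      show "smooth_at M x g" if "x \<in> topspace (mtop M)" for x by (rule g_sm[OF that])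
      show "smooth_near ((U' \<inter> V0) \<times> UNIV) (map_prod \<phi>' (\<lambda>x. x)) (x, z :: complex) (\<lambda>w. g (fst w))"
        if U': "(U', \<phi>') \<in> charts M" "x \<in> U'" "x \<in> V0" for U' \<phi>' x z
        by (rule smooth_near_prod_fst, rule smooth_near_mono[OF smooth_at_chart[OF g_sm[OF V0_topspace[OF U'(3)]] U'(1,2)] open_UNIV]) auto
      show "g (fst (act a x, z :: complex)) = g (fst (x, a * z))" if "a \<in> circle" "x \<in> V0" for a x z
        using g_inv[OF that] by simp
    qed auto
    have G: "local_ext UU \<Psi> (1, p) (\<lambda>w. h (FF w)) ((W' \<inter> \<Omega>S) \<times> UNIV) (\<lambda>y. A (T (fst y), fst y) \<bullet> b)"
      unfolding local_ext_def
    proof (intro conjI ballI impI)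
      show "open ((W' \<inter> \<Omega>S) \<times> (UNIV :: complex set))" using local_ext_open[OF W'] \<Omega>S(1) by (intro open_Times) auto
      show "\<Psi> (1, p) \<in> (W' \<inter> \<Omega>S) \<times> UNIV" using local_ext_mem[OF W'] \<Omega>S(2)[OF U(2)] pS by (simp add: \<Psi>_pt)
      show "Cinf ((W' \<inter> \<Omega>S) \<times> (UNIV :: complex set)) (\<lambda>y. A (T (fst y), fst y) \<bullet> b)"
        by (rule Cinf_compose[OF Cinf_fst local_ext_Cinf[OF W']]) auto
      fix w assume w: "w \<in> UU" "\<Psi> w \<in> (W' \<inter> \<Omega>S) \<times> UNIV"
      obtain a x where ax: "w = (a, x)" "a \<in> circle" "x \<in> U" "x \<in> V0" using w(1) by (auto simp: UU_def)
      have xS: "x \<in> S" "\<phi> x \<in> W'" using w(2) \<Omega>S(2)[OF ax(3)] ax by (auto simp: \<Psi>_def)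
      have "h (FF w) = g (act a x)" using h(2)[OF V0_topspace[OF act_V0[OF ax(2,4)]]] ax by (simp add: FF_def)
      also have "\<dots> = xs b (act (\<tau> x) x)" using g_inv[OF ax(2,4)] \<sigma>S[OF xS(1)] by (simp add: g_def)
      also have "\<dots> = A (T (\<phi> x), \<phi> x) \<bullet> b" using local_ext_eq[OF W', of x] ax xS by simp
      finally show "A (T (fst (\<Psi> w)), fst (\<Psi> w)) \<bullet> b = h (FF w)" using ax by (simp add: \<Psi>_def)
    qed
    have dT: "((\<lambda>y. (T (fst y), fst y)) has_derivative (\<lambda>k. (?DT (fst k), fst k))) (at (\<phi> p, 0 :: complex))"
    proof -
      have "(T has_derivative ?DT) (at (fst (\<phi> p, 0 :: complex)))"
        using Cinf_has_derivative[OF local_ext_Cinf[OF T] local_ext_mem[OF T]] by simp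
      from has_derivative_compose[OF has_derivative_fst[OF has_derivative_ident] this]
      show ?thesis by (intro has_derivative_Pair has_derivative_fst has_derivative_ident)
    qed
    have dA: "(A has_derivative ?DA) (at ((\<lambda>y. (T (fst y), fst y)) (\<phi> p, 0 :: complex)))"
      using Cinf_has_derivative[OF A(3,2)] Tp by simp
    have "((\<lambda>y. A (T (fst y), fst y) \<bullet> b) has_derivative (\<lambda>k. ?DA (?DT (fst k), fst k) \<bullet> b)) (at (\<phi> p, 0 :: complex))"
      by (rule has_derivative_inner_left[OF has_derivative_compose[OF dT dA]])
    from Df_eqI[OF this, of "(v, 0)"] Phi_eq[OF v h(1) G] ker[OF h(1)]
    show ?thesis by simp
  qed
  \<comment> \<open>On the image of \<open>U \<inter> V0\<close> the map \<open>A (1, y)\<close> is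
    the identity since \<open>act 1 x = x\<close>, and vectors of \<open>E\<close> are tangent
    directions there.\<close>
  have id: "?DA (0, v) \<bullet> b = v \<bullet> b" if v: "v \<in> E" for v b
  proof -
    let ?W = "(\<lambda>y. (1, y)) -` W :: 'e set"
    have oW: "open ?W" using open_Int_vimage_Cinf[OF open_UNIV Cinf_Pair[OF Cinf_const Cinf_id] A(1), of 1] by simp
    have cA: "Cinf ?W (\<lambda>y. A (1, y))"
      by (rule Cinf_compose[OF Cinf_Pair[OF Cinf_const Cinf_id] A(3)]) auto
    have "Df (\<lambda>y. A (1, y) \<bullet> b - y \<bullet> b) (\<phi> p) v = 0"
    proof (rule tangent_dirD[OF chart_tangent_dir[OF U(1) V0_open U(2) p_V0 v] oW])
      show "\<phi> p \<in> ?W" using A(2) by simp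
      show "Cinf ?W (\<lambda>y. A (1, y) \<bullet> b - y \<bullet> b)"
        by (rule Cinf_minus[OF Cinf_inner[OF cA Cinf_const] Cinf_inner[OF Cinf_id Cinf_const]])
      fix z assume "z \<in> \<phi> ` (U \<inter> V0)" "z \<in> ?W"
      then obtain x where x: "x \<in> U" "x \<in> V0" "z = \<phi> x" "(1, \<phi> x) \<in> W" by auto
      then show "A (1, z) \<bullet> b - z \<bullet> b = 0" using A(4)[of 1 x] act_one[of x] by simp
    qed
    moreover have "Df (\<lambda>y. A (1, y) \<bullet> b - y \<bullet> b) (\<phi> p) v = ?DA (0, v) \<bullet> b - v \<bullet> b"
    proof -
      have "((\<lambda>y. (1 :: complex, y)) has_derivative (\<lambda>k. (0, k))) (at (\<phi> p))" by (auto intro!: derivative_eq_intros)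
      from has_derivative_compose[OF this Cinf_has_derivative[OF A(3,2)]]
      have "((\<lambda>y. A (1, y)) has_derivative (\<lambda>k. ?DA (0, k))) (at (\<phi> p))" .
      from has_derivative_diff[OF has_derivative_inner_left[OF this] has_derivative_inner_left[OF has_derivative_ident]]
      show ?thesis by (rule Df_eqI)
    qed
    ultimately show ?thesis by simp
  qed
  \<comment> \<open>\<open>\<tau>\<close> takes values in the unit circle on \<open>S\<close> and is
    1 at \<open>p\<close>, so its derivative is tangent to the circle at 1.\<close>
  have DT_imag: "Re (?DT v) = 0" if v: "v \<in> E" for v
  proof -
    have "Df (\<lambda>y. T y \<bullet> T y - 1) (\<phi> p) v = 0"
    proof (rule tangent_dirD[OF chart_tangent_dir[OF U(1) S_open U(2) pS v] local_ext_open[OF T] local_ext_mem[OF T]])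
      show "Cinf W1 (\<lambda>y. T y \<bullet> T y - 1)"
        by (rule Cinf_minus[OF Cinf_inner[OF local_ext_Cinf[OF T] local_ext_Cinf[OF T]] Cinf_const])
      fix z assume "z \<in> \<phi> ` (U \<inter> S)" "z \<in> W1"
      then obtain x where x: "x \<in> U" "x \<in> S" "z = \<phi> x" "\<phi> x \<in> W1" by auto
      then show "T z \<bullet> T z - 1 = 0" using local_ext_eq[OF T x(1,4)] \<tau>S[OF x(2)] by (simp add: dot_square_norm)
    qed
    moreover have "Df (\<lambda>y. T y \<bullet> T y - 1) (\<phi> p) v = T (\<phi> p) \<bullet> ?DT v + ?DT v \<bullet> T (\<phi> p)"
    proof -
      note d = Cinf_has_derivative[OF local_ext_Cinf[OF T] local_ext_mem[OF T]]
      from Df_eqI[OF has_derivative_diff[OF has_derivative_inner[OF d d] has_derivative_const], of 1 v]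
      show ?thesis by simp
    qed
    ultimately show ?thesis using Tp by (simp add: inner_complex_def)
  qed
  show ?thesis
  proof (rule that[of \<xi>])
    fix v z assume v: "v \<in> E" "u \<bullet> v = 0" and ker: "\<And>h. h \<in> smooth_functions N \<Longrightarrow> Phi v z h = 0"
    have z: "z = 0" by (rule z0[OF v ker])
    define s where "s = Im (?DT v)"
    have "?DT v = s *\<^sub>R \<i>" using DT_imag[OF v(1)] by (simp add: s_def complex_eq_iff)
    then have "(?DT v, v) = s *\<^sub>R (\<i>, 0) + (0, v)" by simp
    then have e: "?DA (?DT v, v) = s *\<^sub>R ?DA (\<i>, 0) + ?DA (0, v)"
      using linear_add[OF linA] linear_scale[OF linA] by metis
    \<comment> \<open>The vanishing differential of the retraction now says that \<open>v\<close>
      plus \<open>s\<close> times the orbit velocity is 0.\<close>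
    have "v \<bullet> b = - s * (?DA (\<i>, 0) \<bullet> b)" for b
      using DAT[OF v, of b] ker id[OF v(1), of b] unfolding z e by (simp add: inner_add_left)
    then have "v = (\<Sum>b\<in>B. (- s * (?DA (\<i>, 0) \<bullet> b)) *\<^sub>R b)" using B(3)[OF v(1)] by simp
    also have "\<dots> = (- s) *\<^sub>R \<xi>" by (simp add: \<xi>_def scaleR_sum_right sum_negf)
    finally show "z = 0 \<and> (\<exists>s. v = s *\<^sub>R \<xi>)" using z by blast
  qed
qed

text \<open>
  Dimension count: the domain of \<open>Phi\<close> has dimension \<open>dim E - 1 + 2\<close>, its kernel lies in a line,
  and the tangent space of \<open>N\<close> has dimension \<open>dim E\<close>.
\<close>

lemma Phi_surj:
  assumes X: "X \<in> tangent_space N (cmap p)"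
  obtains v z where "v \<in> E" "u \<bullet> v = 0" "X = Phi v z"
proof -
  have q: "cmap p \<in> topspace (mtop N)" using cmap_surj p_top by blast
  then obtain U' \<phi>' where U': "(U', \<phi>') \<in> charts N" "cmap p \<in> U'" using N.chart_ex by blast
  obtain \<rho> ys S C where c: "\<rho> \<in> smooth_functions N" "compactin (mtop N) C" "C \<subseteq> U'" "\<And>x. x \<notin> C \<Longrightarrow> \<rho> x = 0"
    "openin (mtop N) S" "cmap p \<in> S" "S \<subseteq> U'" "\<And>x. x \<in> S \<Longrightarrow> \<rho> x = 1"
    "\<And>b. ys b \<in> smooth_functions N" "\<And>b x. x \<in> S \<Longrightarrow> ys b x = \<phi>' x \<bullet> b"
    using N.coordinate_functions[OF U'] by metis
  obtain B where B: "finite B" "B \<subseteq> E" "\<And>y. y \<in> E \<Longrightarrow> y = (\<Sum>b\<in>B. (y \<bullet> b) *\<^sub>R b)"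
    "\<And>b c. b \<in> B \<Longrightarrow> c \<in> B \<Longrightarrow> b \<bullet> c = (if b = c then 1 else 0)"
    using orthonormal_expansion[OF subspace_E] by metis
  \<comment> \<open>By the chart formula a derivation is determined by its values on coordinate
    functions. This is the bound \<open>dim E\<close> on the tangent space of \<open>N\<close>, in a
    form that also tests equality of tangent vectors.\<close>
  have determined: "Y = Z" if Y: "Y \<in> tangent_space N (cmap p)" and Z: "Z \<in> tangent_space N (cmap p)"
    and eq: "\<And>b. b \<in> B \<Longrightarrow> Y (ys b) = Z (ys b)" for Y Z
  proof
    fix g
    show "Y g = Z g"
    proof (cases "g \<in> smooth_functions N")
      case True
      obtain W G where G: "local_ext U' \<phi>' (cmap p) g W G" using smooth_functionsD[OF N.good True U'] by (elim smooth_nearE)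
      have "Y g = (\<Sum>b\<in>B. Y (ys b) * Df G (\<phi>' (cmap p)) b)"
        by (rule N.tangent_chart_formula[OF U' Y B(1-3) c(9,5,6,7,10) True G])
      also have "\<dots> = (\<Sum>b\<in>B. Z (ys b) * Df G (\<phi>' (cmap p)) b)" by (rule sum.cong) (simp_all add: eq)
      also have "\<dots> = Z g"
        by (rule N.tangent_chart_formula[OF U' Z B(1-3) c(9,5,6,7,10) True G, symmetric])
      finally show ?thesis .
    next
      case False
      then show ?thesis using tangent_nonsmooth[OF Y] tangent_nonsmooth[OF Z] by simp
    qed
  qed
  have "\<exists>G. \<exists>W. local_ext UU \<Psi> (1, p) (\<lambda>w. ys b (FF w)) W G" for b
    using smooth_N_local_ext[OF c(9)[of b]] by blast
  then obtain G where "\<And>b. \<exists>W. local_ext UU \<Psi> (1, p) (\<lambda>w. ys b (FF w)) W (G b)" by metis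
  then obtain W where G: "\<And>b. local_ext UU \<Psi> (1, p) (\<lambda>w. ys b (FF w)) (W b) (G b)" by metis
  \<comment> \<open>\<open>Phi\<close> written in the chart of \<open>N\<close>: the components of
    \<open>L (v, z)\<close> are the values on the coordinate functions \<open>ys b\<close>. Using
    the extensions \<open>G b\<close> makes \<open>L\<close> linear on the whole type.\<close>
  define L where "L = (\<lambda>w. \<Sum>b\<in>B. Df (G b) (\<phi> p, 0) w *\<^sub>R b)"
  have linG: "linear (Df (G b) (\<phi> p, 0))" for b
    using Cinf_linear_Df[OF local_ext_Cinf[OF G] local_ext_mem[OF G]] by (simp add: \<Psi>_pt)
  have lin: "linear L" unfolding L_def
    by (rule linearI) (simp_all add: linear_add[OF linG] linear_scale[OF linG] scaleR_left_distrib sum.distrib scaleR_sum_right)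
  have Lb: "L w \<bullet> b = Df (G b) (\<phi> p, 0) w" if b: "b \<in> B" for w b
  proof -
    have "L w \<bullet> b = (\<Sum>b'\<in>B. Df (G b') (\<phi> p, 0) w * (b' \<bullet> b))" by (simp add: L_def inner_sum_left)
    also have "\<dots> = (\<Sum>b'\<in>B. if b' = b then Df (G b') (\<phi> p, 0) w else 0)"
      by (rule sum.cong) (use B(4) b in auto)
    finally show ?thesis using B(1) b by simp
  qed
  have LE: "L w \<in> E" for w unfolding L_def
    using B(2) subspace_E by (intro subspace_sum subspace_scale) auto
  have Phi_ys: "Phi v z (ys b) = L (v, z) \<bullet> b" if "v \<in> E" "u \<bullet> v = 0" "b \<in> B" for v z b
    using Phi_eq[OF that(1,2) c(9) G] Lb[OF that(3)] by simp
  obtain \<xi> where \<xi>: "\<And>v z. v \<in> E \<Longrightarrow> u \<bullet> v = 0 \<Longrightarrow> (\<And>h. h \<in> smooth_functions N \<Longrightarrow> Phi v z h = 0) \<Longrightarrow>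
    z = 0 \<and> (\<exists>s. v = s *\<^sub>R \<xi>)"
    using Phi_kernel by metis
  define K where "K = {v \<in> E. u \<bullet> v = 0}"
  have K: "subspace K" unfolding K_def using subspace_E
    by (auto simp: subspace_def inner_add_right)
  define Q where "Q = K \<times> (UNIV :: complex set)"
  have Q: "subspace Q" unfolding Q_def by (rule subspace_Times[OF K subspace_UNIV])
  \<comment> \<open>Removes the line containing the kernel: a vector
    \<open>(s *\<^sub>R \<xi>, 0)\<close> orthogonal to \<open>(\<xi>, 0)\<close> is 0.\<close>
  define Q0 where "Q0 = {w \<in> Q. (\<xi>, 0) \<bullet> w = 0}"
  have Q0: "subspace Q0" unfolding Q0_def using Q by (auto simp: subspace_def inner_add_right)
  \<comment> \<open>Passing from \<open>E\<close> to \<open>K\<close> loses at most one dimension,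
    \<open>\<complex>\<close> contributes two, and orthogonality costs at most one:
    \<open>Q0\<close> is at least as large as \<open>E\<close>, so an injective linear map from
    \<open>Q0\<close> into \<open>E\<close> is onto.\<close>
  have "dim E \<le> dim K + 1" unfolding K_def by (rule dim_hyperplane_section[OF subspace_E])
  moreover have "dim Q = dim K + 2" unfolding Q_def using dim_Times[OF K subspace_UNIV[where 'a = complex]] by simp
  moreover have "dim Q \<le> dim Q0 + 1" unfolding Q0_def by (rule dim_hyperplane_section[OF Q])
  ultimately have d: "dim E \<le> dim Q0" by linarith
  have inj: "w = 0" if w: "w \<in> Q0" "L w = 0" for w
  proof -
    obtain v z where vz: "w = (v, z)" by (cases w)
    have v: "v \<in> E" "u \<bullet> v = 0" using w vz by (auto simp: Q0_def Q_def K_def)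
    have "Phi v z = (\<lambda>g. 0)"
      by (rule determined[OF Phi_tangent[OF v] tangent_space_zero]) (use Phi_ys[OF v] w vz in simp)
    then have "z = 0 \<and> (\<exists>s. v = s *\<^sub>R \<xi>)" by (intro \<xi>[OF v]) simp
    then obtain s where s: "z = 0" "v = s *\<^sub>R \<xi>" by blast
    have "\<xi> \<bullet> v = 0" using w vz by (simp add: Q0_def)
    then have "v = 0" using s by (auto simp: inner_scaleR_right)
    then show ?thesis using \<open>v = 0\<close> s(1) vz by (simp add: zero_prod_def)
  qed
  have "span Q0 = Q0" using Q0 by (simp only: span_eq_iff)
  moreover have "inj_on L Q0" using linear_injective_on_subspace_0[OF lin Q0] inj by blast
  ultimately have "inj_on L (span Q0)" by (simp only:)
  then have "dim (L ` Q0) = dim Q0" by (rule dim_image_eq[OF lin])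
  then have "L ` Q0 = E"
    using d LE by (intro subspace_dim_equal linear_subspace_image[OF lin Q0] subspace_E) auto
  moreover have "(\<Sum>b\<in>B. X (ys b) *\<^sub>R b) \<in> E"
    using B(2) subspace_E by (intro subspace_sum subspace_scale) auto
  ultimately obtain w where w: "w \<in> Q0" "L w = (\<Sum>b\<in>B. X (ys b) *\<^sub>R b)" by (metis imageE)
  obtain v z where vz: "w = (v, z)" by (cases w)
  have v: "v \<in> E" "u \<bullet> v = 0" using w vz by (auto simp: Q0_def Q_def K_def)
  have "X = Phi v z"
  proof (rule determined[OF X Phi_tangent[OF v]])
    fix b assume b: "b \<in> B"
    have "Phi v z (ys b) = (\<Sum>b'\<in>B. X (ys b') *\<^sub>R b') \<bullet> b" using Phi_ys[OF v b] w(2) vz by simp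
    also have "\<dots> = (\<Sum>b'\<in>B. X (ys b') * (b' \<bullet> b))" by (simp add: inner_sum_left)
    also have "\<dots> = (\<Sum>b'\<in>B. if b' = b then X (ys b') else 0)"
      by (rule sum.cong) (use B(4) b in auto)
    finally show "X (ys b) = Phi v z (ys b)" using B(1) b by simp
  qed
  with v show ?thesis by (rule that)
qed

end

section \<open>The reduced space\<close>

lemma push_forward_tangent:
  assumes Q: "good_charts Q" and X: "X \<in> tangent_space P p"
    and F: "\<And>h. h \<in> smooth_functions Q \<Longrightarrow> (\<lambda>x. h (F x)) \<in> smooth_functions P"
  shows "push_forward Q F X \<in> tangent_space Q (F p)"
proof -
  note [simp] = F smooth_functions_lincomb[OF Q] smooth_functions_mult[OF Q] tangent_lincomb[OF X] tangent_mult[OF X]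
  show ?thesis
    unfolding tangent_space_def push_forward_def by auto
qed

context cutting
begin

abbreviation "red \<equiv> induced N (cmap ` bd)"

lemma topspace_red: "topspace (mtop red) = cmap ` bd"
  using cmap_surj bdry_V0 V0_topspace by (fastforce simp: topspace_induced)

text \<open>A function smooth for the induced structure extends to \<open>N\<close> only within a
  chart. Damping makes the extension a global element of \<open>smooth_functions N\<close>, to which
  the description by \<open>H\<close> applies; agreement near \<open>cmap p\<close> suffices for
  derivations.\<close>

lemma red_extension:
  assumes g: "g \<in> smooth_functions red" and p: "p \<in> bd"
  obtains h S where "h \<in> smooth_functions N" "openin (mtop N) S" "cmap p \<in> S"
    "\<And>q. q \<in> S \<Longrightarrow> q \<in> cmap ` bd \<Longrightarrow> h q = g q"
proof -
  have q: "cmap p \<in> cmap ` bd" "cmap p \<in> topspace (mtop N)"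
    using p cmap_surj bdry_V0 V0_topspace by auto
  then obtain U' \<phi>' where U': "(U', \<phi>') \<in> charts N" "cmap p \<in> U'" using N.chart_ex by blast
  have "smooth_near (U' \<inter> cmap ` bd) \<phi>' (cmap p) g"
    by (rule smooth_functionsD[OF good_charts_induced[OF N.good] g]) (use U' q in \<open>auto simp: charts_induced\<close>)
  then obtain W G where G: "local_ext (U' \<inter> cmap ` bd) \<phi>' (cmap p) g W G" by (elim smooth_nearE)
  let ?Q = "{x \<in> U'. \<phi>' x \<in> W}"
  have o: "openin (mtop N) ?Q" by (rule N.chart_vimage[OF U'(1) local_ext_open[OF G]])
  have m: "cmap p \<in> ?Q" using U'(2) local_ext_mem[OF G] by blast
  have lG: "smooth_at N x (\<lambda>x. G (\<phi>' x))" if x: "x \<in> ?Q" for x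
    by (rule N.smooth_atI[OF U'(1) _ local_ext_smooth_near[OF local_ext_fun[OF local_ext_open[OF G] local_ext_Cinf[OF G]]]]) (use x in auto)
  show ?thesis
  proof (rule N.smooth_extension[OF o m lG])
    fix h S
    assume h: "h \<in> smooth_functions N" "openin (mtop N) S" "cmap p \<in> S" "S \<subseteq> ?Q"
      and hG: "\<And>x. x \<in> S \<Longrightarrow> h x = G (\<phi>' x)"
    show ?thesis
    proof (rule that[OF h(1-3)])
      fix q assume q: "q \<in> S" "q \<in> cmap ` bd"
      then have "q \<in> U' \<inter> cmap ` bd" "\<phi>' q \<in> W" using h(4) by auto
      then show "h q = g q" using local_ext_eq[OF G, of q] hG[OF q(1)] by simp
    qed
  qed
qed

text \<open>On the boundary \<open>sqrt f\<close> is identically 0, so the lift reduces to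
  \<open>G (\<phi> x, 0)\<close>: restricted to \<open>bd\<close> the quotient map has no singular
  factor.\<close>

lemma cmap_boundary_smooth:
  assumes h: "h \<in> smooth_functions N" and U: "(U, \<phi>) \<in> charts M" "p \<in> U" "p \<in> bd"
  shows "smooth_near (U \<inter> bd) \<phi> p (\<lambda>x. h (cmap x))"
proof -
  obtain W G where G: "open W" "(\<phi> p, 0) \<in> W" "Cinf W G"
    "\<And>a x. a \<in> circle \<Longrightarrow> x \<in> U \<Longrightarrow> (\<phi> x, a * complex_of_real (sqrt (f x))) \<in> W \<Longrightarrow>
      x \<in> V0 \<and> G (\<phi> x, a * complex_of_real (sqrt (f x))) = h (cmap (act a x))"
    by (rule cut_function_boundary[OF h U], rule that) blast+
  let ?W = "(\<lambda>y. (y, 0 :: complex)) -` W"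
  have 1: "Cinf UNIV (\<lambda>y::'e. (y, 0 :: complex))" by (rule Cinf_Pair[OF Cinf_id Cinf_const])
  have "local_ext (U \<inter> bd) \<phi> p (\<lambda>x. h (cmap x)) ?W (\<lambda>y. G (y, 0))"
    unfolding local_ext_def
  proof (intro conjI ballI impI)
    show "open ?W" using open_Int_vimage_Cinf[OF open_UNIV 1 G(1)] by simp
    show "\<phi> p \<in> ?W" using G(2) by simp
    show "Cinf ?W (\<lambda>y. G (y, 0))" by (rule Cinf_compose[OF Cinf_subset[OF 1] G(3)]) auto
    fix x assume x: "x \<in> U \<inter> bd" "\<phi> x \<in> ?W"
    then have "f x = 0" "x \<in> V0" using bdry_eq bdry_V0 by auto
    then show "G (\<phi> x, 0) = h (cmap x)" using G(4)[of 1 x] x act_one by simp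
  qed
  then show ?thesis by (rule local_ext_smooth_near)
qed

lemma red_pullback_smooth:
  assumes g: "g \<in> smooth_functions red"
  shows "(\<lambda>x. g (cmap x)) \<in> smooth_functions (induced M bd)"
proof (rule smooth_functionsI[OF good_charts_induced[OF good]])
  fix V \<phi> x assume "(V, \<phi>) \<in> charts (induced M bd)" "x \<in> V"
  then obtain U where U: "V = U \<inter> bd" "(U, \<phi>) \<in> charts M" "x \<in> U" "x \<in> bd" by (auto simp: charts_induced)
  obtain h S where h: "h \<in> smooth_functions N" "openin (mtop N) S" "cmap x \<in> S"
    "\<And>q. q \<in> S \<Longrightarrow> q \<in> cmap ` bd \<Longrightarrow> h q = g q"
    using red_extension[OF g U(4)] by metis
  have o: "openin (mtop M) {y \<in> topspace (mtop M). cmap y \<in> S}"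
    using cmap_continuous h(2) unfolding continuous_map_def by blast
  show "smooth_near V \<phi> x (\<lambda>x. g (cmap x))" unfolding U(1)
    by (rule smooth_near_local[OF U(2,3) cmap_boundary_smooth[OF h(1) U(2-4)] o])
      (use h U chart_sub in \<open>auto simp: bdry_eq\<close>)
qed

text \<open>Of the reduced space only \<open>good_charts\<close> is known; locality of its
  derivations is obtained by restricting bump functions of \<open>N\<close>.\<close>

lemma tangent_red_local:
  assumes Y: "Y \<in> tangent_space red (cmap p)" and p: "p \<in> bd" and g: "g \<in> smooth_functions red"
    and h: "h \<in> smooth_functions N" and S: "openin (mtop N) S" "cmap p \<in> S"
    "\<And>q. q \<in> S \<Longrightarrow> q \<in> cmap ` bd \<Longrightarrow> h q = g q"
  shows "Y g = Y h"
proof -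
  obtain \<rho> S' K where bump: "bump_on N (cmap p) S \<rho> S' K"
    by (rule N.bump[OF S(1,2)], rule that)
  note * = bump_onD[OF bump]
  show ?thesis
  proof (rule tangent_local[OF good_charts_induced[OF N.good] Y g smooth_functions_induced[OF N.good h]
        smooth_functions_induced[OF N.good *(1)]])
    show "\<rho> (cmap p) = 1" using * by simp
    show "cmap p \<in> topspace (mtop red)" using p by (simp add: topspace_red)
    fix x assume x: "x \<in> topspace (mtop red)" "\<rho> x \<noteq> 0"
    have "x \<in> K" using x(2) *(9)[of x] by (rule contrapos_np)
    then have "x \<in> S" using *(8) by (rule rev_subsetD)
    moreover have "x \<in> cmap ` bd" using x(1) by (simp only: topspace_red)
    ultimately show "g x = h x" by (rule S(3)[symmetric])
  qed
qed

end

section \<open>Lifting vectors of the reduced space, and the limit from the interior\<close>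

context cutting_pt
begin

text \<open>Pushed into \<open>N\<close>, the vector is some \<open>Phi v z\<close>. Normal
  coordinates vanish on the reduced space, so \<open>Y\<close> annihilates them and
  \<open>z = 0\<close>. Then \<open>v\<close>, as a vector along \<open>bd\<close>, maps to
  \<open>Y\<close> because both act through the same derivative
  \<open>Df G (\<phi> p, 0) (v, 0)\<close>.\<close>

lemma tangent_red_lift:
  assumes Y: "Y \<in> tangent_space red (cmap p)"
  obtains v where "v \<in> E" "u \<bullet> v = 0" "push_forward N (\<lambda>q. q) Y = Phi v 0"
    "push_forward red cmap (coord_vec (induced M bd) (U \<inter> bd) \<phi> (\<lambda>x. x) p v) = Y"
proof -
  have "push_forward N (\<lambda>q. q) Y \<in> tangent_space N (cmap p)" by (rule push_forward_incl[OF N.good Y])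
  then obtain v z where v: "v \<in> E" "u \<bullet> v = 0" and eq: "push_forward N (\<lambda>q. q) Y = Phi v z"
    using Phi_surj by metis
  obtain \<zeta> :: "'a \<Rightarrow> complex" where \<zeta>: "\<And>x. x \<in> topspace (mtop M) \<Longrightarrow> smooth_at M x \<zeta>"
    "\<And>a x. a \<in> circle \<Longrightarrow> x \<in> V0 \<Longrightarrow> \<zeta> (act a x) = cnj a * \<zeta> x" "\<zeta> p \<noteq> 0"
    using equivariant_function[OF p_V0] by metis
  have R: "R (z * cnj (\<zeta> p)) = 0" if R: "bounded_linear R" for R :: "complex \<Rightarrow> real"
  proof -
    obtain h where h: "h \<in> smooth_functions N" "\<And>x. x \<in> bd \<Longrightarrow> h (cmap x) = 0"
      "Phi v z h = R (z * cnj (\<zeta> p))"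
      using normal_coordinate[OF \<zeta>(1,2) R] v by metis
    have "Y (\<lambda>x. 0) = Y h"
      by (rule tangent_red_local[OF Y p_bd smooth_functions_const[OF good_charts_induced[OF N.good]] h(1)
            openin_topspace]) (use h(2) p_bd topspace_red[unfolded topspace_induced] in auto)
    then have "Y h = 0" using tangent_const[OF good_charts_induced[OF N.good] Y, of 0] by simp
    moreover have "Phi v z h = Y h" using fun_cong[OF eq, of h] h(1) by (simp add: push_forward_def)
    ultimately show ?thesis using h(3) by simp
  qed
  have "z * cnj (\<zeta> p) = 0" using R[OF bounded_linear_Re] R[OF bounded_linear_Im] by (simp only: complex_eq_iff zero_complex.sel)
  then have z: "z = 0" using \<zeta>(3) by simp
  have "push_forward red cmap (coord_vec (induced M bd) (U \<inter> bd) \<phi> (\<lambda>x. x) p v) g = Y g" for g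
  proof (cases "g \<in> smooth_functions red")
    case True
    obtain h S where h: "h \<in> smooth_functions N" "openin (mtop N) S" "cmap p \<in> S"
      "\<And>q. q \<in> S \<Longrightarrow> q \<in> cmap ` bd \<Longrightarrow> h q = g q"
      using red_extension[OF True p_bd] by metis
    have "openin (mtop M) {y \<in> topspace (mtop M). cmap y \<in> S}"
      using cmap_continuous h(2) unfolding continuous_map_def by blast
    then obtain \<Omega> where \<Omega>: "open \<Omega>" "\<And>x. x \<in> U \<Longrightarrow> \<phi> x \<in> \<Omega> \<longleftrightarrow> x \<in> {y \<in> topspace (mtop M). cmap y \<in> S}"
      using chart_open_image[OF U(1)] by blast
    obtain W G where G: "local_ext UU \<Psi> (1, p) (\<lambda>w. h (FF w)) W G" using smooth_N_local_ext[OF h(1)] by metis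
    let ?W = "(\<lambda>y. (y, 0 :: complex)) -` W \<inter> \<Omega>"
    have 1: "Cinf UNIV (\<lambda>y::'e. (y, 0 :: complex))" by (rule Cinf_Pair[OF Cinf_id Cinf_const])
    have l: "local_ext (U \<inter> bd) \<phi> p (\<lambda>x. g (cmap x)) ?W (\<lambda>y. G (y, 0))"
      unfolding local_ext_def
    proof (intro conjI ballI impI)
      show "open ?W" using open_Int_vimage_Cinf[OF open_UNIV 1 local_ext_open[OF G]] \<Omega>(1) by auto
      show "\<phi> p \<in> ?W" using local_ext_mem[OF G] \<Omega>(2)[OF U(2)] p_top h(3) by (simp add: \<Psi>_pt)
      show "Cinf ?W (\<lambda>y. G (y, 0))" by (rule Cinf_compose[OF Cinf_subset[OF 1] local_ext_Cinf[OF G]]) auto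
      fix x assume x: "x \<in> U \<inter> bd" "\<phi> x \<in> ?W"
      then have fx: "f x = 0" "x \<in> V0" using bdry_eq bdry_V0 by auto
      have "\<Psi> (1, x) = (\<phi> x, 0)" "(1, x) \<in> UU" "FF (1, x) = cmap x"
        using x fx act_one[OF fx(2)] by (auto simp: \<Psi>_def UU_def FF_def)
      then have "G (\<phi> x, 0) = h (cmap x)" using local_ext_eq[OF G, of "(1, x)"] x(2) by simp
      also have "\<dots> = g (cmap x)" by (rule h(4)) (use x \<Omega>(2)[of x] in auto)
      finally show "G (\<phi> x, 0) = g (cmap x)" .
    qed
    have "push_forward red cmap (coord_vec (induced M bd) (U \<inter> bd) \<phi> (\<lambda>x. x) p v) g = Df (\<lambda>y. G (y, 0)) (\<phi> p) v"
      using True coord_vec_eq[OF tangent_dir_bdry[OF v] red_pullback_smooth[OF True], where F = "\<lambda>x. x", OF l]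
      by (simp add: push_forward_def)
    also have "\<dots> = Df G (\<phi> p, 0) (v, 0)"
    proof -
      have 1: "((\<lambda>y. (y, 0 :: complex)) has_derivative (\<lambda>k. (k, 0))) (at (\<phi> p))" by (auto intro!: derivative_eq_intros)
      have 2: "(G has_derivative Df G (\<phi> p, 0)) (at (\<phi> p, 0))"
        using Cinf_has_derivative[OF local_ext_Cinf[OF G] local_ext_mem[OF G]] by (simp add: \<Psi>_pt)
      show ?thesis by (rule Df_eqI[OF has_derivative_compose[OF 1 2]])
    qed
    also have "\<dots> = Phi v 0 h" by (rule Phi_eq[OF v h(1) G, symmetric])
    also have "\<dots> = Y h" using fun_cong[OF eq, of h] h(1) z by (simp add: push_forward_def)
    also have "\<dots> = Y g" by (rule tangent_red_local[OF Y p_bd True h, symmetric])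
    finally show ?thesis .
  next
    case False
    then show ?thesis using tangent_nonsmooth[OF Y] by (simp add: push_forward_def)
  qed
  then have "push_forward red cmap (coord_vec (induced M bd) (U \<inter> bd) \<phi> (\<lambda>x. x) p v) = Y" by (rule ext)
  with v eq z show ?thesis using that by blast
qed

text \<open>The points lie on the inward ray in direction \<open>u\<close>, where \<open>f\<close>
  is positive by its first-order growth. Positivity of \<open>Df F\<close> along \<open>u\<close> at
  these points is recorded because it becomes a denominator.\<close>

lemma interior_sequence:
  obtains ps :: "nat \<Rightarrow> 'a" and W F where "local_ext U \<phi> p f W F" "0 < Df F (\<phi> p) u"
    "\<And>v. v \<in> E \<Longrightarrow> u \<bullet> v = 0 \<Longrightarrow> Df F (\<phi> p) v = 0"
    "\<And>n. ps n \<in> U" "\<And>n. ps n \<in> V0" "\<And>n. \<phi> (ps n) \<in> W" "\<And>n. 0 < f (ps n)" "\<And>n. 0 < Df F (\<phi> (ps n)) u"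
    "(\<lambda>n. \<phi> (ps n)) \<longlonglongrightarrow> \<phi> p"
proof -
  obtain W F where F: "local_ext U \<phi> p f W F" "0 < Df F (\<phi> p) u" "\<And>v. v \<in> E \<Longrightarrow> u \<bullet> v = 0 \<Longrightarrow> Df F (\<phi> p) v = 0"
    using f_extension by metis
  have Fp: "F (\<phi> p) = 0" using local_ext_eq[OF F(1) U(2) local_ext_mem[OF F(1)]] fp by simp
  have cD: "Cinf W (\<lambda>y. Df F y u)" by (rule Cinf_Df[OF local_ext_open[OF F(1)] local_ext_Cinf[OF F(1)]])
  define W' where "W' = W \<inter> (\<lambda>y. Df F y u) -` {0<..}"
  have W': "open W'" "\<phi> p \<in> W'"
    unfolding W'_def using open_Int_vimage_Cinf[OF local_ext_open[OF F(1)] cD open_greaterThan] local_ext_mem[OF F(1)] F(2) by auto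
  have "((\<lambda>t. F (\<phi> p + t *\<^sub>R u)) has_real_derivative Df F (\<phi> p) u) (at 0)"
    by (rule Cinf_ray_derivative[OF local_ext_Cinf[OF F(1)] local_ext_mem[OF F(1)]])
  from has_real_derivative_pos_inc_right[OF this F(2)]
  obtain d where d: "d > 0" "\<And>h. 0 < h \<Longrightarrow> h < d \<Longrightarrow> 0 < F (\<phi> p + h *\<^sub>R u)" using Fp by auto
  obtain \<epsilon> where e: "\<epsilon> > 0" "\<And>t. 0 \<le> t \<Longrightarrow> t < \<epsilon> \<Longrightarrow> \<exists>x\<in>U \<inter> V0. \<phi> x = \<phi> p + t *\<^sub>R u"
    using ray_chart[OF u_E] by auto
  obtain \<delta> where \<delta>: "\<delta> > 0" "\<And>t. \<bar>t\<bar> < \<delta> \<Longrightarrow> \<phi> p + t *\<^sub>R u \<in> W'"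
    using ray_in_open[OF W', of u] by blast
  define m where "m = min d (min \<epsilon> \<delta>)"
  have m: "m > 0" using d e \<delta> by (simp add: m_def)
  \<comment> \<open>The shift by 2 gives the strict inequality \<open>s n < m\<close> already for
    \<open>n = 0\<close>.\<close>
  define s where "s = (\<lambda>n. m / real (n + 2))"
  have s: "0 < s n" "s n < d" "s n < \<epsilon>" "s n < \<delta>" for n
  proof -
    have "m * 1 < m * real (n + 2)" using m by (intro mult_strict_left_mono) auto
    then have "s n < m" by (simp add: s_def divide_less_eq)
    then show "0 < s n" "s n < d" "s n < \<epsilon>" "s n < \<delta>" using m by (auto simp: s_def m_def)
  qed
  have "\<forall>n. \<exists>x\<in>U \<inter> V0. \<phi> x = \<phi> p + s n *\<^sub>R u" using e(2) s by (simp add: less_imp_le)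
  then obtain ps where ps: "\<And>n. ps n \<in> U \<inter> V0" "\<And>n. \<phi> (ps n) = \<phi> p + s n *\<^sub>R u" by metis
  have psW: "\<phi> (ps n) \<in> W'" for n using \<delta>(2)[of "s n"] s[of n] ps(2) by auto
  show ?thesis
  proof (rule that[of W F ps, OF F])
    show "ps n \<in> U" "ps n \<in> V0" for n using ps by auto
    show "\<phi> (ps n) \<in> W" "0 < Df F (\<phi> (ps n)) u" for n using psW[of n] by (auto simp: W'_def)
    show "0 < f (ps n)" for n
      using local_ext_eq[OF F(1), of "ps n"] ps psW[of n] d(2)[OF s(1,2), of n] by (auto simp: W'_def)
    have "s \<longlonglongrightarrow> 0" unfolding s_def
      using LIMSEQ_ignore_initial_segment[OF lim_const_over_n[of m], of 2] by simp
    then have "(\<lambda>n. \<phi> p + s n *\<^sub>R u) \<longlonglongrightarrow> \<phi> p + 0 *\<^sub>R u" by (intro tendsto_intros)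
    then show "(\<lambda>n. \<phi> (ps n)) \<longlonglongrightarrow> \<phi> p" using ps(2) by simp
  qed
qed

lemma limitin_chart:
  assumes "\<And>n. ps n \<in> U" "(\<lambda>n. \<phi> (ps n)) \<longlonglongrightarrow> \<phi> p"
  shows "limitin (mtop M) ps p sequentially"
  unfolding limitin_def
proof (intro conjI allI impI p_top)
  fix S assume S: "openin (mtop M) S \<and> p \<in> S"
  obtain \<Omega> where \<Omega>: "open \<Omega>" "\<And>x. x \<in> U \<Longrightarrow> \<phi> x \<in> \<Omega> \<longleftrightarrow> x \<in> S"
    using chart_open_image[OF U(1)] S by blast
  have "\<forall>\<^sub>F n in sequentially. \<phi> (ps n) \<in> \<Omega>"
    by (rule topological_tendstoD[OF assms(2) \<Omega>(1)]) (use \<Omega>(2)[OF U(2)] S in blast)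
  then show "\<forall>\<^sub>F n in sequentially. ps n \<in> S"
    by eventually_elim (use \<Omega>(2) assms(1) in blast)
qed

text \<open>
  Approach \<open>p\<close> from the interior along vectors tangent to the level sets of \<open>f\<close>. The factor
  \<open>\<surd>f\<close>, whose derivative blows up, does not contribute along these, and so the images of the
  vectors in \<open>N\<close> converge although the quotient map is not smooth up to the boundary.
\<close>

lemma red_form_eq_cut_form:
  assumes \<beta>: "differential_form k M \<beta>" and cf: "is_cut_form k u M act N \<beta> \<beta>cut"
    and rf: "is_red_form k u M act N \<beta> \<beta>red" and Ys: "tangent_tuple k red (cmap p) Ys"
  shows "\<beta>red (cmap p) Ys = \<beta>cut (cmap p) (map (push_forward N (\<lambda>q. q)) Ys)"
proof -
  have YsT: "length Ys = k" "\<And>Y. Y \<in> set Ys \<Longrightarrow> Y \<in> tangent_space red (cmap p)"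
    using Ys by (auto simp: tangent_tuple_def)
  have "\<forall>Y\<in>set Ys. \<exists>v. v \<in> E \<and> u \<bullet> v = 0 \<and> push_forward N (\<lambda>q. q) Y = Phi v 0 \<and>
      push_forward red cmap (coord_vec (induced M bd) (U \<inter> bd) \<phi> (\<lambda>x. x) p v) = Y"
    using tangent_red_lift YsT(2) by metis
  then obtain vv where vv: "\<And>Y. Y \<in> set Ys \<Longrightarrow> vv Y \<in> E" "\<And>Y. Y \<in> set Ys \<Longrightarrow> u \<bullet> vv Y = 0"
    "\<And>Y. Y \<in> set Ys \<Longrightarrow> push_forward N (\<lambda>q. q) Y = Phi (vv Y) 0"
    "\<And>Y. Y \<in> set Ys \<Longrightarrow> push_forward red cmap (coord_vec (induced M bd) (U \<inter> bd) \<phi> (\<lambda>x. x) p (vv Y)) = Y"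
    by metis
  define vs where "vs = map vv Ys"
  have vs: "length vs = k" "\<And>v. v \<in> set vs \<Longrightarrow> v \<in> E" "\<And>v. v \<in> set vs \<Longrightarrow> u \<bullet> v = 0"
    using YsT(1) vv by (auto simp: vs_def)
  let ?X = "\<lambda>v. coord_vec M U \<phi> (\<lambda>x. x) p v"
  \<comment> \<open>The lifts enter here: applied to them, the pullback of \<open>\<beta>red\<close>
    to the boundary is on one side \<open>\<beta>red\<close> on \<open>Ys\<close>, on the other the
    restriction of \<open>\<beta>\<close>, that is \<open>\<beta>\<close> on the same coordinate
    directions in \<open>M\<close>.\<close>
  have red: "\<beta>red (cmap p) Ys = \<beta> p (map ?X vs)"
  proof -
    let ?Xs = "map (coord_vec (induced M bd) (U \<inter> bd) \<phi> (\<lambda>x. x) p) vs"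
    have "coord_vec (induced M bd) (U \<inter> bd) \<phi> (\<lambda>x. x) p v \<in> tangent_space (induced M bd) p" if v: "v \<in> set vs" for v
      by (rule coord_vec_chart_tangent[OF good_charts_induced[OF good] tangent_dir_bdry[OF vs(2,3)[OF v]]])
        (use U p_bd in \<open>auto simp: charts_induced\<close>)
    then have t: "tangent_tuple k (induced M bd) p ?Xs"
      using vs(1) p_top p_bd by (auto simp: tangent_tuple_def topspace_induced)
    have 1: "map (push_forward red cmap) ?Xs = Ys"
      by (simp add: vs_def comp_def vv(4) map_idI)
    have 2: "map (push_forward M (\<lambda>x. x)) ?Xs = map ?X vs"
      using push_forward_coord_vec_incl[OF good U tangent_dir_bdry] vs by simp
    have "form_pullback k (induced M bd) red cmap \<beta>red p ?Xs = form_restrict k M bd \<beta> p ?Xs"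
      using rf by (simp add: is_red_form_def reduced_space_def)
    then have "\<beta>red (cmap p) (map (push_forward red cmap) ?Xs) = \<beta> p (map (push_forward M (\<lambda>x. x)) ?Xs)"
      using t by (simp add: form_restrict_def form_pullback_def)
    then show ?thesis unfolding 1 2 .
  qed
  obtain ps W F where F: "local_ext U \<phi> p f W F" "0 < Df F (\<phi> p) u"
    "\<And>v. v \<in> E \<Longrightarrow> u \<bullet> v = 0 \<Longrightarrow> Df F (\<phi> p) v = 0"
    and ps: "\<And>n. ps n \<in> U" "\<And>n. ps n \<in> V0" "\<And>n. \<phi> (ps n) \<in> W" "\<And>n. 0 < f (ps n)" "\<And>n. 0 < Df F (\<phi> (ps n)) u"
    "(\<lambda>n. \<phi> (ps n)) \<longlonglongrightarrow> \<phi> p"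
    by (rule interior_sequence, rule that)
  have lim: "limitin (mtop M) ps p sequentially" by (rule limitin_chart[OF ps(1,6)])
  have intr: "ps n \<in> intr u M" for n using ps(2,4) V0_topspace by (simp add: intr_eq)
  have linF: "linear (Df F (\<phi> (ps n)))" for n by (rule Cinf_linear_Df[OF local_ext_Cinf[OF F(1)] ps(3)])
  have tendsto_Df: "(\<lambda>n. Df G (ys n) w) \<longlonglongrightarrow> Df G y w"
    if "open W'" "Cinf W' G" "y \<in> W'" "ys \<longlonglongrightarrow> y" for W' and G :: "'x::euclidean_space \<Rightarrow> real" and ys y w
  proof -
    have "isCont (\<lambda>y. Df G y w) y"
      using Cinf_continuous[OF Cinf_Df[OF that(1,2)]] that(1,3) by (simp add: continuous_on_eq_continuous_at)
    then show ?thesis using that(4) isCont_tendsto_compose by blast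
  qed
  \<comment> \<open>The multiple of \<open>u\<close> to subtract from \<open>v\<close> to make it
    tangent to the level set of \<open>f\<close> at \<open>ps n\<close>. It tends to 0 because
    \<open>Df F\<close> at \<open>\<phi> p\<close> annihilates \<open>v\<close>.\<close>
  define r where "r = (\<lambda>n v. Df F (\<phi> (ps n)) v / Df F (\<phi> (ps n)) u)"
  define w where "w = (\<lambda>n v. v - r n v *\<^sub>R u)"
  have wE: "w n v \<in> E" if "v \<in> set vs" for n v
    unfolding w_def using vs(2)[OF that] u_E subspace_E by (intro subspace_diff subspace_scale)
  have wF: "Df F (\<phi> (ps n)) (w n v) = 0" for n v
    using ps(5)[of n] linear_diff[OF linF] linear_scale[OF linF] by (simp add: w_def r_def)
  have r0: "(\<lambda>n. r n v) \<longlonglongrightarrow> 0" if v: "v \<in> set vs" for v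
  proof -
    have "(\<lambda>n. r n v) \<longlonglongrightarrow> Df F (\<phi> p) v / Df F (\<phi> p) u"
      unfolding r_def by (intro tendsto_divide tendsto_Df[OF local_ext_open[OF F(1)] local_ext_Cinf[OF F(1)] local_ext_mem[OF F(1)] ps(6)])
        (use F(2) in simp)
    then show ?thesis using F(3)[OF vs(2,3)[OF v]] by simp
  qed
  \<comment> \<open>These vectors live in the induced structure of the interior, where the identity
    between \<open>\<beta>cut\<close> and \<open>\<beta>\<close> is stated.\<close>
  let ?Z = "\<lambda>n v. coord_vec (induced M (intr u M)) (U \<inter> intr u M) \<phi> (\<lambda>x. x) (ps n) (w n v)"
  have Z: "?Z n v \<in> tangent_space (induced M (intr u M)) (ps n)" if v: "v \<in> set vs" for n v
    by (rule coord_vec_chart_tangent[OF good_charts_induced[OF good] chart_tangent_dir[OF U(1) intr_open ps(1) intr wE[OF v]]])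
      (use U ps(1) intr in \<open>auto simp: charts_induced\<close>)
  have pushM: "push_forward M (\<lambda>x. x) (?Z n v) = coord_vec M U \<phi> (\<lambda>x. x) (ps n) (w n v)" if v: "v \<in> set vs" for n v
    by (rule push_forward_coord_vec_incl[OF good U(1) ps(1) chart_tangent_dir[OF U(1) intr_open ps(1) intr wE[OF v]]])
  have eq: "\<beta>cut (cmap (ps n)) (map (push_forward N cmap) (map (?Z n) vs)) =
      \<beta> (ps n) (map (\<lambda>v. coord_vec M U \<phi> (\<lambda>x. x) (ps n) (w n v)) vs)" for n
  proof -
    have t: "tangent_tuple k (induced M (intr u M)) (ps n) (map (?Z n) vs)"
      using vs(1) Z intr[of n] by (auto simp: tangent_tuple_def topspace_induced intr_eq)
    have 2: "map (push_forward M (\<lambda>x. x)) (map (?Z n) vs) = map (\<lambda>v. coord_vec M U \<phi> (\<lambda>x. x) (ps n) (w n v)) vs"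
      using pushM by simp
    have "form_pullback k (induced M (intr u M)) N cmap \<beta>cut (ps n) (map (?Z n) vs) =
        form_restrict k M (intr u M) \<beta> (ps n) (map (?Z n) vs)"
      using cf by (simp add: is_cut_form_def)
    then have "\<beta>cut (cmap (ps n)) (map (push_forward N cmap) (map (?Z n) vs)) =
        \<beta> (ps n) (map (push_forward M (\<lambda>x. x)) (map (?Z n) vs))"
      using t by (simp only: form_restrict_def form_pullback_def if_True)
    then show ?thesis unfolding 2 .
  qed
  have "(\<lambda>n. \<beta> (ps n) (map (\<lambda>v. coord_vec M U \<phi> (\<lambda>x. x) (ps n) (w n v)) vs)) \<longlonglongrightarrow> \<beta> p (map ?X vs)"
  proof (rule form_continuous[OF \<beta> lim])
    have "coord_vec M U \<phi> (\<lambda>x. x) (ps n) (w n v) \<in> tangent_space M (ps n)" if v: "v \<in> set vs" for n v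
      by (rule coord_vec_chart_tangent[OF good chart_tangent_dir_U[OF U(1) ps(1) wE[OF v]] ps(1) U(1)])
    then show "tangent_tuple k M (ps n) (map (\<lambda>v. coord_vec M U \<phi> (\<lambda>x. x) (ps n) (w n v)) vs)" for n
      using vs(1) V0_topspace[OF ps(2)] by (auto simp: tangent_tuple_def)
    have "?X v \<in> tangent_space M p" if v: "v \<in> set vs" for v
      by (rule coord_vec_chart_tangent[OF good chart_tangent_dir_U[OF U vs(2)[OF v]] U(2) U(1)])
    then show "tangent_tuple k M p (map ?X vs)" using vs(1) p_top by (auto simp: tangent_tuple_def)
    fix i g assume i: "i < k" and g: "g \<in> smooth_functions M"
    let ?v = "vs ! i"
    have v: "?v \<in> set vs" using i vs(1) by simp
    obtain W1 G where G: "local_ext U \<phi> p g W1 G" using smooth_functionsD[OF good g U] by (elim smooth_nearE)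
    note tG = tendsto_Df[OF local_ext_open[OF G] local_ext_Cinf[OF G] local_ext_mem[OF G] ps(6)]
    have "(\<lambda>n. Df G (\<phi> (ps n)) ?v - r n ?v * Df G (\<phi> (ps n)) u) \<longlonglongrightarrow> Df G (\<phi> p) ?v - 0 * Df G (\<phi> p) u"
      by (intro tendsto_diff tendsto_mult tG r0 v)
    moreover have "\<forall>\<^sub>F n in sequentially. Df G (\<phi> (ps n)) ?v - r n ?v * Df G (\<phi> (ps n)) u =
        coord_vec M U \<phi> (\<lambda>x. x) (ps n) (w n ?v) g"
      using topological_tendstoD[OF ps(6) local_ext_open[OF G] local_ext_mem[OF G]]
    proof eventually_elim
      fix n assume n: "\<phi> (ps n) \<in> W1"
      have l: "local_ext U \<phi> (ps n) g W1 G" using G n by (simp add: local_ext_def)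
      have lin: "linear (Df G (\<phi> (ps n)))" by (rule Cinf_linear_Df[OF local_ext_Cinf[OF G] n])
      have "coord_vec M U \<phi> (\<lambda>x. x) (ps n) (w n ?v) g = Df G (\<phi> (ps n)) (w n ?v)"
        by (rule coord_vec_eq[OF chart_tangent_dir_U[OF U(1) ps(1) wE[OF v]] g l])
      then show "Df G (\<phi> (ps n)) ?v - r n ?v * Df G (\<phi> (ps n)) u = coord_vec M U \<phi> (\<lambda>x. x) (ps n) (w n ?v) g"
        using linear_diff[OF lin] linear_scale[OF lin] by (simp add: w_def)
    qed
    ultimately have "(\<lambda>n. coord_vec M U \<phi> (\<lambda>x. x) (ps n) (w n ?v) g) \<longlonglongrightarrow> Df G (\<phi> p) ?v"
      using Lim_transform_eventually by fastforce
    moreover have "?X ?v g = Df G (\<phi> p) ?v"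
      by (rule coord_vec_eq[OF chart_tangent_dir_U[OF U vs(2)[OF v]] g G])
    ultimately show "(\<lambda>n. (map (\<lambda>v. coord_vec M U \<phi> (\<lambda>x. x) (ps n) (w n v)) vs ! i) g) \<longlonglongrightarrow> (map ?X vs ! i) g"
      using i vs(1) by simp
  qed
  then have lim1: "(\<lambda>n. \<beta>cut (cmap (ps n)) (map (push_forward N cmap) (map (?Z n) vs))) \<longlonglongrightarrow> \<beta> p (map ?X vs)"
    unfolding eq .
  \<comment> \<open>The same sequence of numbers, now followed inside \<open>N\<close>; uniqueness
    of limits will identify the two values.\<close>
  have "(\<lambda>n. \<beta>cut (cmap (ps n)) (map (push_forward N cmap) (map (?Z n) vs))) \<longlonglongrightarrow> \<beta>cut (cmap p) (map (\<lambda>v. Phi v 0) vs)"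
  proof (rule N.form_continuous)
    show "differential_form k N \<beta>cut" using cf by (simp add: is_cut_form_def)
    show "limitin (mtop N) (\<lambda>n. cmap (ps n)) (cmap p) sequentially"
      using continuous_map_limit[OF cmap_continuous lim] by (simp add: o_def)
    have smI: "(\<lambda>x. h (cmap x)) \<in> smooth_functions (induced M (intr u M))" if "h \<in> smooth_functions N" for h
    proof -
      have "h \<circ> cmap \<in> smooth_functions (induced M (intr u M))"
        using that unfolding smooth_N cut_functions_def by blast
      then show ?thesis by (simp only: o_def)
    qed
    have "push_forward N cmap (?Z n v) \<in> tangent_space N (cmap (ps n))" if v: "v \<in> set vs" for n v
      by (rule push_forward_tangent[OF N.good Z[OF v] smI])
    then show "tangent_tuple k N (cmap (ps n)) (map (push_forward N cmap) (map (?Z n) vs))" for n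
      using vs(1) V0_topspace[OF ps(2)] cmap_surj by (auto simp: tangent_tuple_def)
    show "tangent_tuple k N (cmap p) (map (\<lambda>v. Phi v 0) vs)"
      using vs Phi_tangent p_top cmap_surj by (auto simp: tangent_tuple_def)
    fix i h assume i: "i < k" and h: "h \<in> smooth_functions N"
    let ?v = "vs ! i"
    have v: "?v \<in> set vs" using i vs(1) by simp
    obtain W1 G where G: "local_ext UU \<Psi> (1, p) (\<lambda>w. h (FF w)) W1 G" using smooth_N_local_ext[OF h] by metis
    obtain \<Omega> where \<Omega>: "open \<Omega>" "\<And>x. x \<in> U \<Longrightarrow> \<phi> x \<in> \<Omega> \<longleftrightarrow> x \<in> V0"
      using chart_open_image[OF U(1) V0_open] by blast
    have memG: "(\<phi> p, 0) \<in> W1" using local_ext_mem[OF G] by (simp add: \<Psi>_pt)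
    \<comment> \<open>The root is smooth only where \<open>F\<close> is positive, that is at the
      points \<open>\<phi> (ps n)\<close> but not at \<open>\<phi> p\<close>. So
      \<open>\<eta>\<close> is differentiated only at the former, and the limit is taken in
      \<open>Df G\<close>, since \<open>G\<close> is smooth around the limit point
      \<open>(\<phi> p, 0)\<close>.\<close>
    define W2 where "W2 = W \<inter> F -` {0<..}"
    have W2: "open W2" unfolding W2_def by (rule open_Int_vimage_Cinf[OF local_ext_open[OF F(1)] local_ext_Cinf[OF F(1)] open_greaterThan])
    define \<eta> where "\<eta> = (\<lambda>y. (y, complex_of_real (sqrt (F y))))"
    have sF: "Cinf W2 (\<lambda>y. sqrt (F y))"
      by (rule Cinf_compose[OF Cinf_subset[OF local_ext_Cinf[OF F(1)]] Cinf_sqrt]) (auto simp: W2_def)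
    have \<eta>: "Cinf W2 \<eta>" unfolding \<eta>_def by (rule Cinf_Pair[OF Cinf_id Cinf_linear_comp[OF bounded_linear_of_real sF]])
    define W3 where "W3 = (W2 \<inter> \<eta> -` W1) \<inter> \<Omega>"
    have W3: "open W3" unfolding W3_def by (intro open_Int open_Int_vimage_Cinf[OF W2 \<eta> local_ext_open[OF G]] \<Omega>(1))
    have Fps: "F (\<phi> (ps n)) = f (ps n)" for n by (rule local_ext_eq[OF F(1) ps(1,3)])
    have psW2: "\<phi> (ps n) \<in> W2" for n using ps(3,4) Fps by (simp add: W2_def)
    have "(\<lambda>n. F (\<phi> (ps n))) \<longlonglongrightarrow> F (\<phi> p)"
      using Cinf_continuous[OF local_ext_Cinf[OF F(1)]] local_ext_open[OF F(1)] local_ext_mem[OF F(1)] ps(6)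
      by (intro isCont_tendsto_compose[of _ F]) (auto simp: continuous_on_eq_continuous_at)
    then have "(\<lambda>n. \<eta> (\<phi> (ps n))) \<longlonglongrightarrow> (\<phi> p, complex_of_real (sqrt (F (\<phi> p))))"
      unfolding \<eta>_def by (intro tendsto_intros ps(6))
    then have lim\<eta>: "(\<lambda>n. \<eta> (\<phi> (ps n))) \<longlonglongrightarrow> (\<phi> p, 0)"
      using local_ext_eq[OF F(1) U(2) local_ext_mem[OF F(1)]] fp by simp
    note tG = tendsto_Df[OF local_ext_open[OF G] local_ext_Cinf[OF G] memG lim\<eta>]
    have "(\<lambda>n. Df G (\<eta> (\<phi> (ps n))) (?v, 0) - r n ?v * Df G (\<eta> (\<phi> (ps n))) (u, 0)) \<longlonglongrightarrow>
        Df G (\<phi> p, 0) (?v, 0) - 0 * Df G (\<phi> p, 0) (u, 0)"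
      by (intro tendsto_diff tendsto_mult tG r0 v)
    moreover have "\<forall>\<^sub>F n in sequentially. Df G (\<eta> (\<phi> (ps n))) (?v, 0) - r n ?v * Df G (\<eta> (\<phi> (ps n))) (u, 0) =
        push_forward N cmap (?Z n ?v) h"
      using topological_tendstoD[OF lim\<eta> local_ext_open[OF G] memG]
    proof eventually_elim
      fix n assume n: "\<eta> (\<phi> (ps n)) \<in> W1"
      have l: "local_ext (U \<inter> intr u M) \<phi> (ps n) (\<lambda>x. h (cmap x)) W3 (\<lambda>y. G (\<eta> y))"
        unfolding local_ext_def
      proof (intro conjI ballI impI W3)
        show "\<phi> (ps n) \<in> W3" using psW2 n \<Omega>(2)[OF ps(1)] ps(2) by (simp add: W3_def)
        show "Cinf W3 (\<lambda>y. G (\<eta> y))"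
          by (rule Cinf_compose[OF Cinf_subset[OF \<eta>] local_ext_Cinf[OF G]]) (auto simp: W3_def)
        fix x assume x: "x \<in> U \<inter> intr u M" "\<phi> x \<in> W3"
        have xV: "x \<in> V0" "\<phi> x \<in> W" "\<eta> (\<phi> x) \<in> W1" using x \<Omega>(2)[of x] by (auto simp: W3_def W2_def)
        have "F (\<phi> x) = f x" using local_ext_eq[OF F(1), of x] x xV by blast
        then have "\<Psi> (1, x) = \<eta> (\<phi> x)" "(1, x) \<in> UU" "FF (1, x) = cmap x"
          using x xV act_one[OF xV(1)] by (auto simp: \<Psi>_def UU_def FF_def \<eta>_def)
        then show "G (\<eta> (\<phi> x)) = h (cmap x)" using local_ext_eq[OF G, of "(1, x)"] xV(3) by simp
      qed
      let ?y = "\<phi> (ps n)"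
      \<comment> \<open>The second component is \<open>Df F\<close> times a factor that blows up
        towards the boundary; on \<open>w n ?v\<close> the first factor is exactly 0 by
        \<open>wF\<close>.\<close>
      have d\<eta>: "(\<eta> has_derivative (\<lambda>k. (k, complex_of_real (Df F ?y k * (inverse (sqrt (F ?y)) / 2))))) (at ?y)"
      proof -
        have pos: "0 < F ?y" using ps(4) Fps by simp
        have "(sqrt has_derivative (*) (inverse (sqrt (F ?y)) / 2)) (at (F ?y))"
          using DERIV_real_sqrt[OF pos] by (simp add: has_field_derivative_def)
        from has_derivative_compose[OF Cinf_has_derivative[OF local_ext_Cinf[OF F(1)] ps(3)] this]
        have "((\<lambda>y. sqrt (F y)) has_derivative (\<lambda>k. Df F ?y k * (inverse (sqrt (F ?y)) / 2))) (at ?y)"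
          by (simp only: mult.commute)
        then show ?thesis unfolding \<eta>_def
          by (intro has_derivative_Pair has_derivative_ident has_derivative_of_real)
      qed
      have lin: "linear (Df G (\<eta> ?y))" by (rule Cinf_linear_Df[OF local_ext_Cinf[OF G] n])
      have "push_forward N cmap (?Z n ?v) h = Df (\<lambda>y. G (\<eta> y)) ?y (w n ?v)"
        using h coord_vec_eq[OF chart_tangent_dir[OF U(1) intr_open ps(1) intr wE[OF v]] smI[OF h], where F = "\<lambda>x. x", OF l]
        by (simp add: push_forward_def)
      also have "\<dots> = Df G (\<eta> ?y) (w n ?v, complex_of_real (Df F ?y (w n ?v) * (inverse (sqrt (F ?y)) / 2)))"
        by (rule Df_eqI[OF has_derivative_compose[OF d\<eta> Cinf_has_derivative[OF local_ext_Cinf[OF G] n]]])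
      also have "\<dots> = Df G (\<eta> ?y) ((?v, 0) - r n ?v *\<^sub>R (u, 0))" by (simp add: wF) (simp add: w_def)
      also have "\<dots> = Df G (\<eta> ?y) (?v, 0) - r n ?v * Df G (\<eta> ?y) (u, 0)"
        by (simp only: linear_diff[OF lin] linear_scale[OF lin] real_scaleR_def)
      finally show "Df G (\<eta> ?y) (?v, 0) - r n ?v * Df G (\<eta> ?y) (u, 0) = push_forward N cmap (?Z n ?v) h" by simp
    qed
    ultimately have "(\<lambda>n. push_forward N cmap (?Z n ?v) h) \<longlonglongrightarrow> Df G (\<phi> p, 0) (?v, 0)"
      using Lim_transform_eventually by fastforce
    moreover have "Phi ?v 0 h = Df G (\<phi> p, 0) (?v, 0)" by (rule Phi_eq[OF vs(2,3)[OF v] h G])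
    ultimately show "(\<lambda>n. (map (push_forward N cmap) (map (?Z n) vs) ! i) h) \<longlonglongrightarrow> (map (\<lambda>v. Phi v 0) vs ! i) h"
      using i vs(1) by simp
  qed
  then have "\<beta> p (map ?X vs) = \<beta>cut (cmap p) (map (\<lambda>v. Phi v 0) vs)" by (rule LIMSEQ_unique[OF lim1])
  moreover have "map (\<lambda>v. Phi v 0) vs = map (push_forward N (\<lambda>q. q)) Ys" by (simp add: vs_def vv(3))
  ultimately show ?thesis using red by simp
qed

end

theorem lemma10p1:
  fixes E :: "'e::euclidean_space set" and u :: 'e
    and M :: "('a, 'e) charted"
    and U :: "'a set" and act :: "complex \<Rightarrow> 'a \<Rightarrow> 'a"
    and f :: "'a \<Rightarrow> real"
    and N :: "('a set, 'e) charted"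
    and k :: nat
    and \<beta> :: "'a \<Rightarrow> 'a tvec list \<Rightarrow> real"
    and \<beta>cut \<beta>red :: "'a set \<Rightarrow> 'a set tvec list \<Rightarrow> real"
  assumes "manifold_with_boundary E u M"
    and "free_circle_action_near_boundary u M U act"
    and "invariant_boundary_defining u M U act f"
    and "is_cut_manifold E u M U act f N"
    and "differential_form k M \<beta>"
    and "basic_on_boundary k u M act \<beta>"
    and "invariant_near_boundary k u M U act \<beta>"
    and "is_cut_form k u M act N \<beta> \<beta>cut"
    and "is_red_form k u M act N \<beta> \<beta>red"
  shows "\<beta>red = form_pullback k (reduced_space u M act N) N (\<lambda>p. p) \<beta>cut"
proof (intro ext)
  interpret cutting E u M U act f N
    using assms(1-4) by unfold_locales
  fix q Ys
  have red: "reduced_space u M act N = red" by (simp add: reduced_space_def)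
  show "\<beta>red q Ys = form_pullback k (reduced_space u M act N) N (\<lambda>p. p) \<beta>cut q Ys"
  proof (cases "tangent_tuple k red q Ys")
    case True
    then have "q \<in> cmap ` bd" by (simp add: tangent_tuple_def topspace_red)
    then obtain p where p: "p \<in> bd" "q = cmap p" by blast
    then obtain V \<phi> where V: "(V, \<phi>) \<in> charts M" "p \<in> V" "u \<noteq> 0" "u \<bullet> \<phi> p = 0" unfolding bdry_def by blast
    interpret cutting_pt E u M U act f N p V \<phi>
      by unfold_locales (use p V in auto)
    show ?thesis
      using red_form_eq_cut_form[OF assms(5,8,9)] True p(2) by (simp add: red form_pullback_def)
  next
    case False
    \<comment> \<open>Off tuples of tangent vectors both sides are 0, the left one by the
      normalisation of forms.\<close>
    then show ?thesis using assms(9) by (simp add: is_red_form_def differential_form_def red form_pullback_def)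
  qed
qed

end
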